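(* Let $n=2^K$. The unitary butterfly circuit $U(\theta,\phi)=U^{(K)}\cdots U^{(1)}$ satisfies: 1. Depth: $2\log_2n$. 2. Number of parameters: $T=\frac32n\log_2n$. 3. Universality: the subgroup of $U(n)$ generated by $\{U(\theta,\phi)\}$ is dense in $U(n)$ in the single-particle sector: products of finitely many butterfly circuits approximate any $W\in U(n)$. A single depth-$2\log_2n$ butterfly, by contrast, parametrizes a compact subset (submanifold) of $U(n)$ of dimension at most $\frac32n\log_2n<n^2$, and is therefore not dense in $U(n)$. 4. The dynamical Lie algebra is $\mathfrak u(n)$, of dimension $n^2$.
   Context: Unitary butterfly on modes $0,\dots,n-1$: layer $\ell\in\{1,\dots,K\}$ is $U^{(\ell)}=\big[\bigotimes_{j=1}^{n/2}\mathrm{RBS}(\theta_\ell^{(j)})\big]\bigotimes_{i}R_z(\phi_\ell^{(i)})$, with $R_z$ gates on all $n$ modes and RBS gates on the $n/2$ disjoint pairs with stride $2^{\ell-1}$ (modes whose binary labels differ exactly in bit $\ell-1$). $\mathrm{RBS}(\theta)=\exp(-i\theta G_{ij})$, $G_{ij}=i(|01\rangle\langle10|-|10\rangle\langle01|)_{ij}$, $R_z(\phi)=\mathrm{diag}(e^{i\phi/2},e^{-i\phi/2})$. In the single-particle sector (identified with $\mathbb C^n$), up to global phase, $R_z(\phi)$ on mode $j$ multiplies $e_j$ by $e^{-i\phi}$ and RBS acts as the real rotation $\begin{pmatrix}\cos\theta&-\sin\theta\\ \sin\theta&\cos\theta\end{pmatrix}$ on $\mathrm{span}(e_i,e_j)$.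 Depth counts one parallel $R_z$ layer and one parallel RBS layer as depth 1 each. The dynamical Lie algebra is the real Lie algebra generated, in the single-particle sector, by $i$ times the Hermitian generators of all gates. *)

theory Defs
  imports "HOL-Analysis.Analysis" "HOL-Algebra.Generated_Groups"
begin

text \<open>
  \<open>Theta l i\<close> is the angle of the RBS gate of layer \<open>l\<close> whose pair has lower mode \<open>i\<close>, and
  \<open>Phi l i\<close> the angle of the \<open>R\<^sub>z\<close> gate of layer \<open>l\<close> on mode \<open>i\<close>.
\<close>

datatype param = Theta nat nat | Phi nat nat

datatype 'm gate = Rz (angle: param) 'm | RBS (angle: param) 'm 'm

primrec support :: "'m gate \<Rightarrow> 'm set" where
  "support (Rz p a) = {a}"
| "support (RBS p a b) = {a, b}"

text \<open>
  A circuit is the list of its parallel layers, the layer that acts first coming first.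
\<close>

type_synonym 'm circuit = "'m gate list list"

definition parallel_layer :: "'m gate list \<Rightarrow> bool" where
  "parallel_layer gs \<longleftrightarrow>
     sorted_wrt (\<lambda>g h. support g \<inter> support h = {}) gs \<and>
     ((\<forall>g\<in>set gs. \<exists>p a. g = Rz p a) \<or> (\<forall>g\<in>set gs. \<exists>p a b. a \<noteq> b \<and> g = RBS p a b))"

definition circuit_depth :: "'m circuit \<Rightarrow> nat" where
  "circuit_depth C = length C"

definition circuit_params :: "'m circuit \<Rightarrow> param set" where
  "circuit_params C = angle ` set (concat C)"

text \<open>
  The sector is identified with the space \<open>complex ^ 'm\<close>, where \<open>axis a 1\<close> is the state in which
  exactly mode \<open>a\<close> is occupied. Here \<open>R\<^sub>z(t) = diag(e\<^bsup>it/2\<^esup>, e\<^bsup>-it/2\<^esup>)\<close> on mode \<open>a\<close> is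
  \<open>e\<^bsup>it/2\<^esup>\<close> times the matrix below; this global phase is dropped.
\<close>

primrec gate_op :: "'m::finite gate \<Rightarrow> real \<Rightarrow> complex^'m^'m" where
  "gate_op (Rz p a) t = (\<chi> i j. if i = j then (if i = a then cis (- t) else 1) else 0)"
| "gate_op (RBS p a b) t =
     (\<chi> i j. if i = j then (if i = a \<or> i = b then complex_of_real (cos t) else 1)
            else if i = a \<and> j = b then - complex_of_real (sin t)
            else if i = b \<and> j = a then complex_of_real (sin t)
            else 0)"

text \<open>
  Hermitian generators \<open>H\<close>, normalised so that the gate is \<open>exp(-itH)\<close>: the number operator of
  the mode for \<open>R\<^sub>z\<close> (again up to the dropped phase), and
  \<open>i(|01\<rangle>\<langle>10| - |10\<rangle>\<langle>01|)\<close> for RBS, where \<open>|10\<rangle>\<close> is \<open>axis a 1\<close> and \<open>|01\<rangle>\<close> is \<open>axis b 1\<close>.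
\<close>

primrec gate_generator :: "'m::finite gate \<Rightarrow> complex^'m^'m" where
  "gate_generator (Rz p a) = (\<chi> i j. if i = a \<and> j = a then 1 else 0)"
| "gate_generator (RBS p a b) =
     (\<chi> i j. if i = b \<and> j = a then \<i> else if i = a \<and> j = b then - \<i> else 0)"

definition circuit_op :: "(param \<Rightarrow> real) \<Rightarrow> 'm::finite circuit \<Rightarrow> complex^'m^'m" where
  "circuit_op v C = foldl (\<lambda>M g. gate_op g (v (angle g)) ** M) (mat 1) (concat C)"

text \<open>
  \<open>mode\<close> enumerates the \<open>2 ^ K\<close> modes; the binary digits of \<open>i\<close> are the label of \<open>mode i\<close>.
\<close>

definition rz_layer :: "nat \<Rightarrow> (nat \<Rightarrow> 'm) \<Rightarrow> nat \<Rightarrow> 'm gate list" where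
  "rz_layer K mode l = map (\<lambda>i. Rz (Phi l i) (mode i)) [0..<2 ^ K]"

definition rbs_layer :: "nat \<Rightarrow> (nat \<Rightarrow> 'm) \<Rightarrow> nat \<Rightarrow> 'm gate list" where
  "rbs_layer K mode l =
     map (\<lambda>i. RBS (Theta l i) (mode i) (mode (i + 2 ^ (l - 1))))
       (filter (\<lambda>i. \<not> bit i (l - 1)) [0..<2 ^ K])"

definition butterfly :: "nat \<Rightarrow> (nat \<Rightarrow> 'm) \<Rightarrow> 'm circuit" where
  "butterfly K mode = concat (map (\<lambda>l. [rz_layer K mode l, rbs_layer K mode l]) [1..<Suc K])"

definition butterfly_set :: "nat \<Rightarrow> (nat \<Rightarrow> 'm::finite) \<Rightarrow> (complex^'m^'m) set" where
  "butterfly_set K mode = range (\<lambda>v. circuit_op v (butterfly K mode))"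

definition adj :: "complex^'m^'m \<Rightarrow> complex^'m^'m" where
  "adj A = map_matrix cnj (transpose A)"

definition unitary_group :: "(complex^'m::finite^'m) monoid" where
  "unitary_group = \<lparr>carrier = {A. A ** adj A = mat 1 \<and> adj A ** A = mat 1},
                    mult = (**), one = mat 1\<rparr>"

definition unitary_algebra :: "(complex^'m::finite^'m) set" where
  "unitary_algebra = {A. adj A = - A}"

definition lie_subalgebra :: "(complex^'m::finite^'m) set \<Rightarrow> bool" where
  "lie_subalgebra L \<longleftrightarrow> subspace L \<and> (\<forall>A\<in>L. \<forall>B\<in>L. A ** B - B ** A \<in> L)"

definition dynamical_lie_algebra :: "'m::finite circuit \<Rightarrow> (complex^'m^'m) set" where
  "dynamical_lie_algebra C =
     lie_subalgebra hull ((\<lambda>g. map_matrix ((*) \<i>) (gate_generator g)) ` set (concat C))"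

text \<open>\<open>Ck_on k f S\<close> is meant for open \<open>S\<close>, since it uses full derivatives at the points of \<open>S\<close>.\<close>

primrec Ck_on :: "nat \<Rightarrow> ('a::real_normed_vector \<Rightarrow> 'b::real_normed_vector) \<Rightarrow> 'a set \<Rightarrow> bool" where
  "Ck_on 0 f S \<longleftrightarrow> continuous_on S f"
| "Ck_on (Suc k) f S \<longleftrightarrow>
     (\<forall>x\<in>S. f differentiable (at x)) \<and> (\<forall>v. Ck_on k (\<lambda>x. frechet_derivative f (at x) v) S)"

definition smooth_on :: "('a::real_normed_vector \<Rightarrow> 'b::real_normed_vector) \<Rightarrow> 'a set \<Rightarrow> bool" where
  "smooth_on f S \<longleftrightarrow> (\<forall>k. Ck_on k f S)"

text \<open>
  Embedded smooth submanifolds of dimension \<open>d\<close>, through local parametrizations that are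
  immersions and homeomorphisms onto relatively open pieces of \<open>M\<close>. Since the dimension is not a
  type, the parameters range over an open subset of a \<open>d\<close>-dimensional subspace \<open>L\<close> of the ambient
  space; a smooth map on \<open>L\<close> extends by precomposing with the projection onto \<open>L\<close>, so that it is no
  restriction to have \<open>f\<close> smooth on an open set of the ambient space.
\<close>

definition embedded_submanifold :: "nat \<Rightarrow> 'a::euclidean_space set \<Rightarrow> bool" where
  "embedded_submanifold d M \<longleftrightarrow>
     (\<forall>p\<in>M. \<exists>U W L (f :: 'a \<Rightarrow> 'a) g.
        open U \<and> p \<in> U \<and> open W \<and> subspace L \<and> dim L = d \<and>
        smooth_on f W \<and>
        homeomorphism (W \<inter> L) (M \<inter> U) f g \<and>
        (\<forall>x\<in>W \<inter> L. inj_on (frechet_derivative f (at x)) L))"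

lemma adj_adj: "adj (adj A) = A"
  by (simp add: adj_def vec_eq_iff transpose_def)

lemma adj_mult: "adj (A ** B) = adj B ** adj (A :: complex^'m::finite^'m)"
  by (simp add: adj_def vec_eq_iff transpose_def matrix_matrix_mult_def mult.commute)

lemma group_unitary_group: "group (unitary_group :: (complex^'m::finite^'m) monoid)"
proof (rule groupI)
  fix A B :: "complex^'m^'m"
  assume "A \<in> carrier unitary_group" "B \<in> carrier unitary_group"
  then have A: "A ** adj A = mat 1" "adj A ** A = mat 1"
    and B: "B ** adj B = mat 1" "adj B ** B = mat 1"
    by (auto simp: unitary_group_def)
  have "(A ** B) ** (adj B ** adj A) = A ** (B ** adj B) ** adj A"
    and "(adj B ** adj A) ** (A ** B) = adj B ** (adj A ** A) ** B"
    by (simp_all add: matrix_mul_assoc)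
  then show "A \<otimes>\<^bsub>unitary_group\<^esub> B \<in> carrier unitary_group"
    using A B by (simp add: unitary_group_def adj_mult)
next
  have "adj (mat 1 :: complex^'m^'m) = mat 1"
    by (auto simp: adj_def vec_eq_iff transpose_def mat_def)
  then show "\<one>\<^bsub>unitary_group\<^esub> \<in> carrier (unitary_group :: (complex^'m^'m) monoid)"
    by (simp add: unitary_group_def)
next
  fix A :: "complex^'m^'m"
  assume "A \<in> carrier unitary_group"
  then show "\<exists>B\<in>carrier unitary_group. B \<otimes>\<^bsub>unitary_group\<^esub> A = \<one>\<^bsub>unitary_group\<^esub>"
    by (intro bexI[of _ "adj A"]) (auto simp: unitary_group_def adj_adj)
qed (auto simp: unitary_group_def matrix_mul_assoc)

text \<open>The gate with generator \<open>H\<close> is the one-parameter group \<open>t \<mapsto> exp(-itH)\<close>.\<close>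

lemma gate_op_0: "gate_op g 0 = mat 1"
  by (cases g) (auto simp: mat_def vec_eq_iff)

lemma gate_generator_hermitian:
  assumes "\<And>p a b. g = RBS p a b \<Longrightarrow> a \<noteq> b"
  shows "adj (gate_generator g) = gate_generator g"
proof (cases g)
  case (Rz p a)
  then show ?thesis
    by (auto simp: adj_def vec_eq_iff transpose_def)
next
  case (RBS p a b)
  with assms have "a \<noteq> b" by blast
  then show ?thesis
    unfolding RBS vec_eq_iff adj_def transpose_def by simp
qed

lemma has_vector_derivative_vecI:
  fixes f :: "real \<Rightarrow> 'b::real_normed_vector ^ 'n"
  assumes "\<And>i. ((\<lambda>t. f t $ i) has_vector_derivative D $ i) (at t)"
  shows "(f has_vector_derivative D) (at t)"
proof -
  have "((\<lambda>y. ((f y - f t) - (y - t) *\<^sub>R D) /\<^sub>R norm (y - t)) \<longlongrightarrow> 0) (at t)"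
  proof (rule vec_tendstoI)
    fix i
    have "((\<lambda>y. ((f y $ i - f t $ i) - (y - t) *\<^sub>R D $ i) /\<^sub>R norm (y - t)) \<longlongrightarrow> 0) (at t)"
      using assms[of i] unfolding has_vector_derivative_def has_derivative_at_within by blast
    then show "((\<lambda>y. (((f y - f t) - (y - t) *\<^sub>R D) /\<^sub>R norm (y - t)) $ i) \<longlongrightarrow> 0 $ i) (at t)"
      by simp
  qed
  then show ?thesis
    unfolding has_vector_derivative_def has_derivative_at_within
    using bounded_linear_scaleR_left by blast
qed

lemma gate_op_deriv:
  assumes "\<And>p a b. g = RBS p a b \<Longrightarrow> a \<noteq> b"
  shows "(gate_op g has_vector_derivative
          map_matrix ((*) (- \<i>)) (gate_generator g) ** gate_op g t) (at t)"
proof -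
  define D where "D = map_matrix ((*) (- \<i>)) (gate_generator g) ** gate_op g t"
  have entry: "((\<lambda>t. gate_op g t $ i $ j) has_vector_derivative D $ i $ j) (at t)" for i j
  proof (cases g)
    case (Rz p a)
    have "D $ i $ j = (\<Sum>k\<in>UNIV. if k = a then (if i = a then - \<i> * gate_op g t $ k $ j else 0) else 0)"
      unfolding D_def matrix_matrix_mult_def vec_lambda_beta by (rule sum.cong) (auto simp: Rz)
    then have "D $ i $ j = (if i = a \<and> j = a then - \<i> * cis (- t) else 0)"
      by (auto simp: Rz)
    moreover have "((\<lambda>t. cis (- t)) has_vector_derivative - \<i> * cis (- t)) (at t)"
    proof -
      have "((\<lambda>z. exp (- (\<i> * z))) has_field_derivative - \<i> * cis (- t)) (at (of_real t))"
        by (rule derivative_eq_intros refl | simp add: cis_conv_exp)+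
      then show ?thesis
        unfolding cis_conv_exp by (auto dest: has_vector_derivative_real_field)
    qed
    ultimately show ?thesis
      by (cases "i = j"; cases "i = a"; cases "j = a"; simp add: Rz)
  next
    case (RBS p a b)
    with assms have ab: "a \<noteq> b" by blast
    have "D $ i $ j = (\<Sum>k\<in>UNIV. if k = (if i = a then b else a)
        then (if i = a then - gate_op g t $ k $ j else if i = b then gate_op g t $ k $ j else 0) else 0)"
      unfolding D_def matrix_matrix_mult_def vec_lambda_beta using ab by (intro sum.cong) (auto simp: RBS)
    then have "D $ i $ j =
        (if i = a then - gate_op g t $ b $ j else if i = b then gate_op g t $ a $ j else 0)"
      by simp
    moreover have "((\<lambda>t. complex_of_real (sin t)) has_vector_derivative complex_of_real (cos t)) (at t)"
      by (rule has_vector_derivative_of_real)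
        (simp flip: has_real_derivative_iff_has_vector_derivative)
    moreover have "((\<lambda>t. complex_of_real (cos t)) has_vector_derivative complex_of_real (- sin t)) (at t)"
      by (rule has_vector_derivative_of_real)
        (simp flip: has_real_derivative_iff_has_vector_derivative)
    moreover have
      "((\<lambda>t. - complex_of_real (sin t)) has_vector_derivative - complex_of_real (cos t)) (at t)"
      using calculation(2) by (rule has_vector_derivative_minus)
    ultimately show ?thesis
      using ab by (cases "i = j"; cases "i = a"; cases "i = b"; cases "j = a"; cases "j = b"; simp add: RBS)
  qed
  show ?thesis
    unfolding D_def[symmetric] by (intro has_vector_derivative_vecI entry)
qed

end

theory Submission
  imports Defs
begin

text \<open>
  Write \<open>T\<close> for the diagonal unitaries, \<open>R\<^sub>l\<close> for the real rotations of the pairs of stride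
  \<open>2\<^bsup>l-1\<^esup>\<close> and \<open>H\<^sub>l\<close> for all unitaries supported on these pairs. The butterfly set is
  \<open>R\<^sub>K T R\<^bsub>K-1\<^esub> \<dots> R\<^sub>1 T\<close>, and since \<open>H\<^sub>l = T R\<^sub>l T\<close> (Euler angles) it equals
  \<open>R\<^sub>K F\<^bsub>K-1\<^esub>\<close> with \<open>F\<^sub>0 = T\<close> and \<open>F\<^sub>l = H\<^sub>l F\<^bsub>l-1\<^esub>\<close>. As \<open>F\<^bsub>l-1\<^esub>\<close> is block diagonal for
  the blocks of size \<open>2\<^bsup>l-1\<^esup>\<close> and invariant under \<open>T\<close>, whereas \<open>H\<^sub>l\<close> couples different blocks, the
  factors of a product in \<open>H\<^sub>l F\<^bsub>l-1\<^esub>\<close> are determined up to \<open>T\<close> by its blocks. So charts of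
  \<open>F\<^bsub>l-1\<^esub>\<close> extend to charts of \<open>H\<^sub>l F\<^bsub>l-1\<^esub>\<close>, each step adding at most \<open>n\<close> dimensions and the last
  factor \<open>R\<^sub>K\<close> at most \<open>n / 2\<close>. Universality is Givens elimination: the pairs form a connected
  graph on the modes (the hypercube), and conjugation with quarter turns yields rotations of all
  pairs. Commutators along the same graph give the dynamical Lie algebra.
\<close>

section \<open>Calculus of smooth maps\<close>

text \<open>The image of a smooth map may cross itself or lose rank, so a count of angles does not
  make the butterfly set a manifold. For K >= 2 the angles are redundant: phases that agree on both
  modes of a pair commute with its rotation. Passing to cosets of the torus removes this redundancy,
  and charts are inverted through entries of the product, not through angles. The count becomes n
  for the torus, n for each of K - 1 full pair layers modulo the torus, and n/2 for the last real
  layer: (2K + 1) n/2 in all. A coordinate x is normalised to (1 + x) / sqrt(1 + |x|^2), both for a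
  phase and for a pair. So every parameter domain is a whole linear space, the charts contain no
  trigonometric functions, and their inverses are built from quotients of entries. Density of the
  generated group is proved as equality, by exact elimination. That one butterfly is not dense needs
  no dimension theory: its image is compact, hence closed, and an explicit unitary lies outside
  it.\<close>

lemma Ck_on_SucD: "Ck_on (Suc k) f S \<Longrightarrow> Ck_on k f S"
proof (induction k arbitrary: f)
  case 0
  then show ?case
    by (auto intro!: differentiable_imp_continuous_on simp: differentiable_on_def
        intro: differentiable_at_imp_differentiable_on differentiable_at_withinI)
next
  case (Suc k)
  then show ?case by auto
qed

text \<open>Derivatives at a point are unique, so any candidate \<open>f'\<close> may stand in for
  \<open>frechet_derivative\<close>; the closure rules below only have to exhibit one.\<close>

lemma Ck_on_UNIV_SucI:
  assumes "\<And>x. (f has_derivative f' x) (at x)" and "\<And>v. Ck_on k (\<lambda>x. f' x v) UNIV"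
  shows "Ck_on (Suc k) f UNIV"
proof -
  have "frechet_derivative f (at x) = f' x" for x
    using assms(1)[of x] by (rule frechet_derivative_at[symmetric])
  with assms show ?thesis
    by (auto simp: differentiable_def)
qed

lemma Ck_on_UNIV_has_derivative:
  assumes "Ck_on (Suc k) f UNIV"
  shows "(f has_derivative frechet_derivative f (at x)) (at x)"
  using assms by (simp add: frechet_derivative_works)

lemma Ck_on_const: "Ck_on k (\<lambda>x. c) UNIV"
proof (induction k arbitrary: c)
  case (Suc k)
  show ?case by (rule Ck_on_UNIV_SucI[where f' = "\<lambda>x v. 0"]) (use Suc in auto)
qed auto

lemma Ck_on_linear:
  assumes "bounded_linear h"
  shows "Ck_on k h UNIV"
proof (cases k)
  case 0
  then show ?thesis using assms by (simp add: linear_continuous_on)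
next
  case (Suc l)
  show ?thesis
    unfolding Suc by (rule Ck_on_UNIV_SucI[where f' = "\<lambda>x. h"])
      (auto intro: bounded_linear_imp_has_derivative assms Ck_on_const)
qed

lemma Ck_on_linear_comp:
  assumes "bounded_linear h" and "Ck_on k f UNIV"
  shows "Ck_on k (\<lambda>x. h (f x)) UNIV"
  using assms(2)
proof (induction k arbitrary: f)
  case 0
  then show ?case
    using assms(1) by (auto intro: bounded_linear.continuous_on)
next
  case (Suc k)
  show ?case
    by (rule Ck_on_UNIV_SucI[where f' = "\<lambda>x v. h (frechet_derivative f (at x) v)"])
      (use Suc Ck_on_UNIV_has_derivative[OF Suc.prems] in
        \<open>auto intro: bounded_linear.has_derivative[OF assms(1)]\<close>)
qed

text \<open>For a linear inner map the derivative in direction \<open>v\<close> is again a composite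
  with \<open>h\<close>, taken in direction \<open>h v\<close>. So the induction closes, and
  precomposition with the linear projection \<open>block_part\<close> is covered.\<close>

lemma Ck_on_comp_linear:
  assumes "bounded_linear h" and "Ck_on k f UNIV"
  shows "Ck_on k (\<lambda>x. f (h x)) UNIV"
  using assms(2)
proof (induction k arbitrary: f)
  case 0
  then show ?case
    using continuous_on_compose[of UNIV h f] linear_continuous_on[OF assms(1), of UNIV]
    by (auto simp: o_def intro: continuous_on_subset)
next
  case (Suc k)
  show ?case
  proof (rule Ck_on_UNIV_SucI[where f' = "\<lambda>x v. frechet_derivative f (at (h x)) (h v)"])
    fix x
    show "((\<lambda>x. f (h x)) has_derivative (\<lambda>v. frechet_derivative f (at (h x)) (h v))) (at x)"
      by (rule has_derivative_compose[OF bounded_linear_imp_has_derivative[OF assms(1)]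
            Ck_on_UNIV_has_derivative[OF Suc.prems]])
  qed (use Suc in auto)
qed

lemma Ck_on_add:
  assumes "Ck_on k f UNIV" and "Ck_on k g UNIV"
  shows "Ck_on k (\<lambda>x. f x + g x) UNIV"
  using assms
proof (induction k arbitrary: f g)
  case 0
  then show ?case by (auto intro: continuous_on_add)
next
  case (Suc k)
  show ?case
    by (rule Ck_on_UNIV_SucI[where f' = "\<lambda>x v. frechet_derivative f (at x) v + frechet_derivative g (at x) v"])
      (use Suc Ck_on_UNIV_has_derivative[OF Suc.prems(1)] Ck_on_UNIV_has_derivative[OF Suc.prems(2)] in
        \<open>auto intro: has_derivative_add\<close>)
qed

lemma Ck_on_sum:
  assumes "\<And>i. i \<in> I \<Longrightarrow> Ck_on k (f i) UNIV"
  shows "Ck_on k (\<lambda>x. \<Sum>i\<in>I. f i x) UNIV"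
  using assms
proof (induction I rule: infinite_finite_induct)
  case (insert i I)
  then show ?case by (simp add: Ck_on_add)
qed (simp_all add: Ck_on_const)

text \<open>The product rule gives two bilinear terms, each with one differentiated factor;
  \<open>Ck_on_SucD\<close> lowers the order of the other one.\<close>

lemma Ck_on_bilinear:
  assumes "bounded_bilinear h" and "Ck_on k f UNIV" and "Ck_on k g UNIV"
  shows "Ck_on k (\<lambda>x. h (f x) (g x)) UNIV"
  using assms(2,3)
proof (induction k arbitrary: f g)
  case 0
  then show ?case by (auto intro: bounded_bilinear.continuous_on[OF assms(1)])
next
  case (Suc k)
  show ?case
  proof (rule Ck_on_UNIV_SucI[where f' = "\<lambda>x v. h (f x) (frechet_derivative g (at x) v)
        + h (frechet_derivative f (at x) v) (g x)"])
    fix v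
    show "Ck_on k (\<lambda>x. h (f x) (frechet_derivative g (at x) v)
        + h (frechet_derivative f (at x) v) (g x)) UNIV"
      by (intro Ck_on_add Suc.IH Suc.prems[THEN Ck_on_SucD]) (use Suc.prems in auto)
  qed (intro bounded_bilinear.FDERIV[OF assms(1)] Suc.prems[THEN Ck_on_UNIV_has_derivative])
qed

text \<open>With u = w^(-1/2) the derivative is -1/2 w' u^3, a polynomial in w' and in u itself. The
  induction therefore feeds on its own hypothesis, without separate rules for roots and
  inverses.\<close>

lemma Ck_on_rsqrt:
  fixes w :: "'a::real_normed_vector \<Rightarrow> real"
  assumes "\<And>x. w x > 0" and "Ck_on k w UNIV"
  shows "Ck_on k (\<lambda>x. 1 / sqrt (w x)) UNIV"
  using assms(2)
proof (induction k)
  case 0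
  then show ?case using assms(1) by (auto intro!: continuous_intros simp: less_imp_neq[symmetric])
next
  case (Suc k)
  define u where "u = (\<lambda>x. 1 / sqrt (w x))"
  have u: "Ck_on k u UNIV"
    unfolding u_def by (rule Suc.IH) (rule Ck_on_SucD[OF Suc.prems])
  let ?f' = "\<lambda>x v. (- 1/2) * (frechet_derivative w (at x) v * (u x * (u x * u x)))"
  have "(u has_derivative ?f' x) (at x)" for x
  proof -
    have *: "((\<lambda>z. 1 / sqrt z) has_real_derivative - (1/2) * (1 / sqrt z * (1 / sqrt z * (1 / sqrt z)))) (at z)"
      if "z > 0" for z
      using that by (auto intro!: derivative_eq_intros simp: field_simps power2_eq_square)
    show ?thesis
      using has_derivative_compose[OF Ck_on_UNIV_has_derivative[OF Suc.prems, of x]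
          *[OF assms(1)[of x], unfolded has_field_derivative_def]]
      unfolding u_def by (simp add: mult_ac)
  qed
  moreover have "Ck_on k (\<lambda>x. ?f' x v) UNIV" for v
    by (intro Ck_on_bilinear[OF bounded_bilinear_mult] Ck_on_const u)
      (use Suc.prems in auto)
  ultimately show ?case
    unfolding u_def[symmetric] by (rule Ck_on_UNIV_SucI)
qed

lemma Ck_on_rsqrt_1_plus:
  fixes w :: "'a::real_normed_vector \<Rightarrow> real"
  assumes "\<And>x. w x \<ge> 0" and "Ck_on k w UNIV"
  shows "Ck_on k (\<lambda>x. 1 / sqrt (1 + w x)) UNIV"
  by (intro Ck_on_rsqrt Ck_on_add Ck_on_const assms(2)) (simp add: add_pos_nonneg assms(1))

lemma Ck_on_vec:
  fixes f :: "'a::real_normed_vector \<Rightarrow> 'b::euclidean_space ^ 'n"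
  assumes "\<And>i. Ck_on k (\<lambda>x. f x $ i) UNIV"
  shows "Ck_on k f UNIV"
proof -
  have "f = (\<lambda>x. \<Sum>i\<in>UNIV. axis i (f x $ i))"
    by (auto simp: vec_eq_iff axis_def fun_eq_iff)
  moreover have "bounded_linear (axis i :: 'b \<Rightarrow> 'b ^ 'n)" for i
    by (auto simp: linear_conv_bounded_linear[symmetric] linear_iff axis_def vec_eq_iff)
  ultimately show ?thesis
    using Ck_on_sum[of UNIV k "\<lambda>i x. axis i (f x $ i)"] Ck_on_linear_comp[OF _ assms]
    by metis
qed

lemma bounded_bilinear_matrix_mult:
  "bounded_bilinear ((**) :: complex^'n^'n \<Rightarrow> complex^'n^'n \<Rightarrow> complex^'n^'n)"
  unfolding bilinear_conv_bounded_bilinear[symmetric]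
  by (auto simp: bilinear_def linear_iff matrix_matrix_mult_def vec_eq_iff distrib_right
      distrib_left sum.distrib scaleR_sum_right)

lemma bounded_linear_adj: "bounded_linear (adj :: complex^'n^'n \<Rightarrow> complex^'n^'n)"
  unfolding linear_conv_bounded_linear[symmetric]
  by (auto simp: linear_iff adj_def transpose_def vec_eq_iff)

section \<open>Unitaries supported on pairs\<close>

abbreviation unitaries :: "(complex^'n::finite^'n) set" where
  "unitaries \<equiv> carrier unitary_group"

lemma adj_nth [simp]: "adj A $ i $ j = cnj (A $ j $ i)"
  by (simp add: adj_def transpose_def)

lemma mem_unitaries: "A \<in> unitaries \<longleftrightarrow> A ** adj A = mat 1 \<and> adj A ** A = mat 1"
  by (simp add: unitary_group_def)

lemma unitaries_mult: "A \<in> unitaries \<Longrightarrow> B \<in> unitaries \<Longrightarrow> A ** B \<in> unitaries"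
  using group.is_monoid[OF group_unitary_group, THEN monoid.m_closed, of A B]
  by (simp add: unitary_group_def)

lemma unitaries_adj: "A \<in> unitaries \<Longrightarrow> adj A \<in> unitaries"
  by (simp add: mem_unitaries adj_adj)

lemma adj_mat_1 [simp]: "adj (mat 1) = mat 1"
  by (auto simp: vec_eq_iff mat_def)

lemma unitaries_mat_1: "mat 1 \<in> unitaries"
  by (simp add: mem_unitaries)

lemma unitariesI:
  fixes A :: "complex^'n^'n"
  assumes "adj A ** A = mat 1"
  shows "A \<in> unitaries"
  using assms matrix_left_right_inverse[of "adj A" A] by (simp add: mem_unitaries)

lemma unitaries_cancel:
  assumes "A \<in> unitaries"
  shows "A ** (adj A ** B) = B" and "adj A ** (A ** B) = B"
  using assms by (simp_all add: mem_unitaries matrix_mul_assoc)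

section \<open>Diagonal unitaries and products of sets of matrices\<close>

definition diag_mat :: "('n \<Rightarrow> complex) \<Rightarrow> complex^'n^'n" where
  "diag_mat d = (\<chi> i j. if i = j then d i else 0)"

lemma diag_mat_nth: "diag_mat d $ i $ j = (if i = j then d i else 0)"
  by (simp add: diag_mat_def)

lemma diag_mat_mult_left: "(diag_mat d ** A) $ i $ j = d i * A $ i $ j"
proof -
  have "(diag_mat d ** A) $ i $ j = (\<Sum>k\<in>UNIV. if k = i then d i * A $ k $ j else 0)"
    unfolding matrix_matrix_mult_def vec_lambda_beta by (rule sum.cong) (auto simp: diag_mat_def)
  then show ?thesis by simp
qed

lemma diag_mat_mult_right: "(A ** diag_mat d) $ i $ j = A $ i $ j * d j"
proof -
  have "(A ** diag_mat d) $ i $ j = (\<Sum>k\<in>UNIV. if k = j then A $ i $ k * d j else 0)"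
    unfolding matrix_matrix_mult_def vec_lambda_beta by (rule sum.cong) (auto simp: diag_mat_def)
  then show ?thesis by simp
qed

definition diag_unitaries :: "(complex^'n::finite^'n) set" where
  "diag_unitaries = {diag_mat d | d. \<forall>i. cmod (d i) = 1}"

lemma diag_unitariesI: "(\<And>i. cmod (d i) = 1) \<Longrightarrow> diag_mat d \<in> diag_unitaries"
  unfolding diag_unitaries_def by blast

lemma diag_unitaries_mult:
  assumes "A \<in> diag_unitaries" and "B \<in> diag_unitaries"
  shows "A ** B \<in> diag_unitaries"
proof -
  from assms obtain a b where ab: "A = diag_mat a" "B = diag_mat b"
    "\<forall>i. cmod (a i) = 1" "\<forall>i. cmod (b i) = 1"
    by (auto simp: diag_unitaries_def)
  have "A ** B = diag_mat (\<lambda>i. a i * b i)"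
    by (simp add: vec_eq_iff ab(1,2) diag_mat_mult_left) (simp add: diag_mat_nth)
  then show ?thesis
    using ab(3,4) by (auto intro!: diag_unitariesI simp: norm_mult)
qed

lemma cnj_mult_norm: "cnj z * z = (of_real (cmod z))\<^sup>2" "z * cnj z = (of_real (cmod z))\<^sup>2"
  using complex_norm_square[of z] by (simp_all add: mult.commute)

lemma cmod_1_cnj: "cmod z = 1 \<Longrightarrow> cnj z * z = 1" "cmod z = 1 \<Longrightarrow> z * cnj z = 1"
  using complex_norm_square[of z] by (simp_all add: mult.commute)

lemma diag_unitaries_subset: "diag_unitaries \<subseteq> unitaries"
proof
  fix A :: "complex^'n^'n" assume "A \<in> diag_unitaries"
  then obtain d where d: "A = diag_mat d" "\<And>i. cmod (d i) = 1" by (auto simp: diag_unitaries_def)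
  then have "adj A ** A = mat 1"
    by (simp add: vec_eq_iff diag_mat_mult_right d(1)) (simp add: diag_mat_nth mat_def cmod_1_cnj d(2))
  then show "A \<in> unitaries" by (rule unitariesI)
qed

lemma mat_1_diag_unitaries: "(mat 1 :: complex^'n::finite^'n) \<in> diag_unitaries"
proof -
  have "(mat 1 :: complex^'n^'n) = diag_mat (\<lambda>_. 1)"
    by (simp add: vec_eq_iff mat_def diag_mat_nth)
  then show ?thesis using diag_unitariesI[of "\<lambda>_. 1"] by simp
qed

definition product_set :: "(complex^'n::finite^'n) set \<Rightarrow> (complex^'n^'n) set \<Rightarrow> (complex^'n^'n) set" where
  "product_set G N = (\<lambda>(g, n). g ** n) ` (G \<times> N)"

lemma product_setI: "g \<in> G \<Longrightarrow> n \<in> N \<Longrightarrow> g ** n \<in> product_set G N"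
  by (auto simp: product_set_def)

lemma product_setE:
  assumes "m \<in> product_set G N" obtains g n where "g \<in> G" "n \<in> N" "m = g ** n"
  using assms by (auto simp: product_set_def)

lemma product_set_assoc: "product_set (product_set G H) N = product_set G (product_set H N)"
  by (force simp: product_set_def matrix_mul_assoc image_iff)

text \<open>A fixed-point-free involution encodes disjoint pairs without ordering them; a predicate
  \<open>low\<close> selects one mode of each pair where an order matters.\<close>

locale pairing =
  fixes \<sigma> :: "'n::finite \<Rightarrow> 'n"
  assumes inv [simp]: "\<sigma> (\<sigma> i) = i" and fixfree [simp]: "\<sigma> i \<noteq> i" 
begin

lemma fixfree' [simp]: "i \<noteq> \<sigma> i"
  using fixfree[of i] by metis

lemma eq_iff: "i = \<sigma> j \<longleftrightarrow> j = \<sigma> i"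
  by auto

definition pair_supported :: "complex^'n^'n \<Rightarrow> bool" where
  "pair_supported A \<longleftrightarrow> (\<forall>i j. i \<noteq> j \<longrightarrow> i \<noteq> \<sigma> j \<longrightarrow> A $ i $ j = 0)"

lemma sum_pair:
  assumes "\<And>k. k \<noteq> i \<Longrightarrow> k \<noteq> \<sigma> i \<Longrightarrow> f k = (0::'b::comm_monoid_add)"
  shows "(\<Sum>k\<in>UNIV. f k) = f i + f (\<sigma> i)"
proof -
  have "(\<Sum>k\<in>UNIV. f k) = (\<Sum>k\<in>{i, \<sigma> i}. f k)"
    using assms by (intro sum.mono_neutral_right) auto
  then show ?thesis by simp
qed

lemma mult_left_nth:
  "pair_supported A \<Longrightarrow> (A ** B) $ i $ j = A $ i $ i * B $ i $ j + A $ i $ \<sigma> i * B $ \<sigma> i $ j"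
  unfolding matrix_matrix_mult_def vec_lambda_beta
  by (rule sum_pair) (auto simp: pair_supported_def eq_iff[of i])

lemma pair_supported_mult:
  assumes "pair_supported A" "pair_supported B" shows "pair_supported (A ** B)"
  unfolding pair_supported_def mult_left_nth[OF assms(1)]
  using assms by (auto simp: pair_supported_def) (metis inv)

lemma pair_supported_adj: "pair_supported A \<Longrightarrow> pair_supported (adj A)"
  by (auto simp: pair_supported_def) (metis inv)

definition pair_unitaries :: "(complex^'n^'n) set" where
  "pair_unitaries = {U \<in> unitaries. pair_supported U}"

text \<open>Among real orthogonal blocks the two entry conditions select determinant 1, so each
  block is ((c, -s), (s, c)). They are symmetric under \<open>\<sigma>\<close>, up to the sign of
  s.\<close>

definition pair_rotations :: "(complex^'n^'n) set" where
  "pair_rotations = {U \<in> pair_unitaries. (\<forall>i j. Im (U $ i $ j) = 0) \<and>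
     (\<forall>i. U $ \<sigma> i $ \<sigma> i = U $ i $ i \<and> U $ i $ \<sigma> i = - U $ \<sigma> i $ i)}"

lemma pair_unitaries_mult: "A \<in> pair_unitaries \<Longrightarrow> B \<in> pair_unitaries \<Longrightarrow> A ** B \<in> pair_unitaries"
  by (simp add: pair_unitaries_def unitaries_mult pair_supported_mult)

lemma pair_unitaries_adj: "A \<in> pair_unitaries \<Longrightarrow> adj A \<in> pair_unitaries"
  by (simp add: pair_unitaries_def unitaries_adj pair_supported_adj)

lemma pair_rotations_mult:
  assumes "A \<in> pair_rotations" and "B \<in> pair_rotations"
  shows "A ** B \<in> pair_rotations"
proof -
  have A: "pair_supported A" "\<And>i j. Im (A $ i $ j) = 0" "\<And>i. A $ \<sigma> i $ \<sigma> i = A $ i $ i"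
      "\<And>i. A $ i $ \<sigma> i = - A $ \<sigma> i $ i"
    and B: "\<And>i j. Im (B $ i $ j) = 0" "\<And>i. B $ \<sigma> i $ \<sigma> i = B $ i $ i"
      "\<And>i. B $ i $ \<sigma> i = - B $ \<sigma> i $ i"
    using assms by (auto simp: pair_rotations_def pair_unitaries_def)
  show ?thesis
    using assms unfolding pair_rotations_def
    by (simp add: pair_unitaries_mult mult_left_nth[OF A(1)] A B)
qed

lemma pair_rotations_adj: "A \<in> pair_rotations \<Longrightarrow> adj A \<in> pair_rotations"
  unfolding pair_rotations_def by (auto simp: pair_unitaries_adj)

lemma pair_unitaries_eqs:
  assumes "U \<in> pair_unitaries"
  shows "U $ i $ i * cnj (U $ i $ i) + U $ i $ \<sigma> i * cnj (U $ i $ \<sigma> i) = 1"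
    and "cnj (U $ i $ i) * U $ i $ i + cnj (U $ \<sigma> i $ i) * U $ \<sigma> i $ i = 1"
    and "U $ i $ i * cnj (U $ \<sigma> i $ i) + U $ i $ \<sigma> i * cnj (U $ \<sigma> i $ \<sigma> i) = 0"
    and "cnj (U $ i $ i) * U $ i $ \<sigma> i + cnj (U $ \<sigma> i $ i) * U $ \<sigma> i $ \<sigma> i = 0"
proof -
  have s: "pair_supported U" and u: "U ** adj U = mat 1" "adj U ** U = mat 1"
    using assms by (auto simp: pair_unitaries_def mem_unitaries)
  have u': "(U ** adj U) $ i $ j = (if i = j then 1 else 0)"
    "(adj U ** U) $ i $ j = (if i = j then 1 else 0)" for i j
    by (simp_all add: u mat_def)
  from u'[of i i] u'[of i "\<sigma> i"] show
    "U $ i $ i * cnj (U $ i $ i) + U $ i $ \<sigma> i * cnj (U $ i $ \<sigma> i) = 1"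
    "cnj (U $ i $ i) * U $ i $ i + cnj (U $ \<sigma> i $ i) * U $ \<sigma> i $ i = 1"
    "U $ i $ i * cnj (U $ \<sigma> i $ i) + U $ i $ \<sigma> i * cnj (U $ \<sigma> i $ \<sigma> i) = 0"
    "cnj (U $ i $ i) * U $ i $ \<sigma> i + cnj (U $ \<sigma> i $ i) * U $ \<sigma> i $ \<sigma> i = 0"
    by (simp_all add: mult_left_nth[OF s] mult_left_nth[OF pair_supported_adj[OF s]])
qed

text \<open>Orthonormal columns suffice: a left inverse of a square matrix is also a right
  inverse.\<close>

lemma pair_unitariesI:
  assumes "pair_supported U"
    and "\<And>i. cnj (U $ i $ i) * U $ i $ i + cnj (U $ \<sigma> i $ i) * U $ \<sigma> i $ i = 1"
    and "\<And>i. cnj (U $ i $ i) * U $ i $ \<sigma> i + cnj (U $ \<sigma> i $ i) * U $ \<sigma> i $ \<sigma> i = 0"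
  shows "U \<in> pair_unitaries"
proof -
  have "(adj U ** U) $ i $ j = mat 1 $ i $ j" for i j
  proof -
    consider "i = j" | "j = \<sigma> i" | "i \<noteq> j" "j \<noteq> \<sigma> i" by blast
    then show ?thesis
    proof cases
      case 1
      then show ?thesis
        using assms(2)[of i] by (simp add: mult_left_nth[OF pair_supported_adj[OF assms(1)]] mat_def)
    next
      case 2
      then show ?thesis
        using assms(3)[of i] by (simp add: mult_left_nth[OF pair_supported_adj[OF assms(1)]] mat_def)
    next
      case 3
      then have "pair_supported (adj U ** U)"
        using assms(1) by (simp add: pair_supported_adj pair_supported_mult)
      with 3 show ?thesis by (auto simp: pair_supported_def mat_def eq_iff[of i])
    qed
  qed
  then have "adj U ** U = mat 1" by (simp add: vec_eq_iff)
  with assms(1) show ?thesis by (simp add: pair_unitaries_def unitariesI)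
qed

lemma diag_unitaries_subset_pair: "diag_unitaries \<subseteq> pair_unitaries"
  using diag_unitaries_subset
  by (auto simp: pair_unitaries_def pair_supported_def diag_unitaries_def diag_mat_nth)

text \<open>
  Euler decomposition: on each pair the block is \<open>((p, -d cnj r), (r, d cnj p))\<close> with determinant
  \<open>d\<close>, and the phases of \<open>p\<close>, \<open>r\<close> and \<open>d\<close> can be moved into diagonal factors.
\<close>

lemma pair_unitaries_euler:
  assumes U: "U \<in> pair_unitaries" and low: "\<And>i. low (\<sigma> i) \<longleftrightarrow> \<not> low i"
  obtains s R t where "s \<in> diag_unitaries" "R \<in> pair_rotations" "t \<in> diag_unitaries"
    "U = s ** (R ** t)"
proof -
  \<comment> \<open>The phase of 0 is set to 1, so that \<open>ph z\<close> is always a unit and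
    modulus times phase still gives \<open>z\<close>.\<close>
  define ph where "ph z = (if z = 0 then 1 else z / of_real (cmod z))" for z :: complex
  have ph: "cmod (ph z) = 1" "of_real (cmod z) * ph z = z" for z
    by (auto simp: ph_def norm_divide)
  have ph': "cnj (ph z) * ph z = 1" "ph z * cnj (ph z) = 1" for z
    using ph(1) by (simp_all add: cmod_1_cnj)
  have cph: "of_real (cmod z) * cnj (ph z) = cnj z" for z
    using arg_cong[OF ph(2)[of z], of cnj] by simp
  note eqs = pair_unitaries_eqs[OF U]
  \<comment> \<open>\<open>a i\<close> is the lower mode of the pair of \<open>i\<close>, which
    makes \<open>p\<close>, \<open>r\<close> and \<open>d\<close> constant on pairs.\<close>
  define a where "a i = (if low i then i else \<sigma> i)" for i
  define p r d where "p i = U $ a i $ a i" and "r i = U $ \<sigma> (a i) $ a i"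
    and "d i = U $ a i $ a i * U $ \<sigma> (a i) $ \<sigma> (a i) - U $ a i $ \<sigma> (a i) * U $ \<sigma> (a i) $ a i" for i
  have a_sigma: "a (\<sigma> i) = a i" for i by (simp add: a_def low)
  \<comment> \<open>Expand the determinant times \<open>cnj (p i)\<close>, trade the mixed term by
    orthogonality of the columns, and use that the first column is a unit vector. The other entry
    follows in the same way.\<close>
  have s_eq: "U $ \<sigma> (a i) $ \<sigma> (a i) = d i * cnj (p i)" for i
  proof -
    have "d i * cnj (p i) = (cnj (p i) * p i) * U $ \<sigma> (a i) $ \<sigma> (a i)
        - (cnj (U $ a i $ a i) * U $ a i $ \<sigma> (a i)) * r i"
      by (simp add: d_def p_def r_def algebra_simps)
    also have "cnj (U $ a i $ a i) * U $ a i $ \<sigma> (a i) = - (cnj (r i) * U $ \<sigma> (a i) $ \<sigma> (a i))"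
      using eqs(4)[of "a i"] by (simp add: r_def add_eq_0_iff2)
    finally have "d i * cnj (p i) = (cnj (p i) * p i + cnj (r i) * r i) * U $ \<sigma> (a i) $ \<sigma> (a i)"
      by (simp add: algebra_simps)
    then show ?thesis using eqs(2)[of "a i"] by (simp add: p_def r_def)
  qed
  have q_eq: "U $ a i $ \<sigma> (a i) = - (d i * cnj (r i))" for i
  proof -
    have "- (d i * cnj (r i)) = (cnj (r i) * r i) * U $ a i $ \<sigma> (a i)
        - (cnj (r i) * U $ \<sigma> (a i) $ \<sigma> (a i)) * p i"
      by (simp add: d_def p_def r_def algebra_simps)
    also have "cnj (r i) * U $ \<sigma> (a i) $ \<sigma> (a i) = - (cnj (p i) * U $ a i $ \<sigma> (a i))"
      using eqs(4)[of "a i"] by (simp add: r_def p_def add_eq_0_iff)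
    finally have "- (d i * cnj (r i)) = (cnj (p i) * p i + cnj (r i) * r i) * U $ a i $ \<sigma> (a i)"
      by (simp add: algebra_simps)
    then show ?thesis using eqs(2)[of "a i"] by (simp add: p_def r_def)
  qed
  have norm_pr: "(cmod (p i))\<^sup>2 + (cmod (r i))\<^sup>2 = 1" for i
  proof -
    have "complex_of_real ((cmod (p i))\<^sup>2 + (cmod (r i))\<^sup>2) = 1"
      using eqs(2)[of "a i"] by (simp add: p_def r_def cnj_mult_norm)
    then show ?thesis by (simp only: of_real_eq_1_iff)
  qed
  have d: "cmod (d i) = 1" for i
  proof -
    have "cnj (d i * cnj (p i)) * (d i * cnj (p i)) + cnj (d i * cnj (r i)) * (d i * cnj (r i)) = 1"
      using eqs(2)[of "\<sigma> (a i)"] by (simp add: s_eq q_eq)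
    then have "complex_of_real ((cmod (d i * cnj (p i)))\<^sup>2 + (cmod (d i * cnj (r i)))\<^sup>2) = 1"
      by (simp only: cnj_mult_norm of_real_add of_real_power)
    then have "(cmod (d i))\<^sup>2 * ((cmod (p i))\<^sup>2 + (cmod (r i))\<^sup>2) = 1"
      unfolding of_real_eq_1_iff by (simp add: norm_mult power_mult_distrib distrib_left)
    then show ?thesis
      by (simp add: norm_pr power2_eq_1_iff) (metis norm_ge_zero not_one_le_zero neg_0_le_iff_le)
  qed
  \<comment> \<open>Rows carry the phases of \<open>p\<close> and \<open>r\<close>. With the low
    column factor normalised to 1, the high column must supply \<open>d\<close> and cancel both row
    phases, which forces \<open>t\<close>.\<close>
  define s where "s i = (if low i then ph (p i) else ph (r i))" for i
  define t where "t i = (if low i then 1 else d i * cnj (ph (p i)) * cnj (ph (r i)))" for i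
  define R :: "complex^'n^'n" where "R = (\<chi> i j. if i = j then of_real (cmod (p i))
      else if i = \<sigma> j then (if low j then of_real (cmod (r j)) else - of_real (cmod (r j))) else 0)"
  have pr_sigma: "p (\<sigma> i) = p i" "r (\<sigma> i) = r i" for i
    by (simp_all add: p_def r_def a_sigma)
  have R: "R \<in> pair_rotations"
  proof -
    have n: "complex_of_real (cmod (p i)) * of_real (cmod (p i))
        + of_real (cmod (r i)) * of_real (cmod (r i)) = 1" for i
      using norm_pr[of i] by (simp add: power2_eq_square flip: of_real_mult of_real_add)
    have "R \<in> pair_unitaries"
      by (rule pair_unitariesI) (auto simp: R_def pair_supported_def low pr_sigma n)
    then show ?thesis
      by (auto simp: pair_rotations_def R_def pr_sigma low)
  qed
  have "U $ i $ j = s i * (R $ i $ j * t j)" for i j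
  proof -
    consider "i = j" "low j" | "i = j" "\<not> low j" | "i = \<sigma> j" "low j" | "i = \<sigma> j" "\<not> low j"
      | "i \<noteq> j" "i \<noteq> \<sigma> j" by blast
    then show ?thesis
    proof cases
      case 1
      then show ?thesis
        using ph(2)[of "p i"] by (simp add: s_def t_def R_def mult.commute) (simp add: p_def a_def)
    next
      case 2
      have "s i * (R $ i $ j * t j) = d i * (of_real (cmod (p i)) * cnj (ph (p i))) * (ph (r i) * cnj (ph (r i)))"
        using 2 by (simp add: s_def t_def R_def)
      also have "\<dots> = U $ i $ j" using 2 s_eq[of i] by (simp only: cph ph') (simp add: a_def)
      finally show ?thesis ..
    next
      case 3
      then show ?thesis
        using ph(2)[of "r j"] by (simp add: s_def t_def R_def low mult.commute pr_sigma) (simp add: r_def a_def)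
    next
      case 4
      have "s i * (R $ i $ j * t j) = - (d j * (of_real (cmod (r j)) * cnj (ph (r j))) * (ph (p j) * cnj (ph (p j))))"
        using 4 by (simp add: s_def t_def R_def low pr_sigma)
      also have "\<dots> = U $ i $ j" using 4 q_eq[of j] by (simp only: cph ph') (simp add: a_def)
      finally show ?thesis ..
    next
      case 5
      with U have "U $ i $ j = 0" by (auto simp: pair_unitaries_def pair_supported_def)
      with 5 show ?thesis by (simp add: R_def)
    qed
  qed
  then have "U = diag_mat s ** (R ** diag_mat t)"
    by (simp add: vec_eq_iff diag_mat_mult_left diag_mat_mult_right)
  moreover have "diag_mat s \<in> diag_unitaries" "diag_mat t \<in> diag_unitaries"
    by (auto intro!: diag_unitariesI simp: s_def t_def ph norm_mult d)
  ultimately show ?thesis using R that by blast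
qed

text \<open>In the Euler form s R t the right factor t is absorbed by \<open>N\<close>, while s
  becomes the phase layer that precedes the next rotation layer. So one phase layer per stage
  already yields all pair unitaries.\<close>

lemma product_set_pair_unitaries:
  assumes low: "\<And>i. low (\<sigma> i) \<longleftrightarrow> \<not> low i"
    and N: "product_set diag_unitaries N \<subseteq> N"
  shows "product_set diag_unitaries (product_set pair_rotations N) = product_set pair_unitaries N"
proof
  show "product_set diag_unitaries (product_set pair_rotations N) \<subseteq> product_set pair_unitaries N"
  proof
    fix m assume "m \<in> product_set diag_unitaries (product_set pair_rotations N)"
    then obtain t R n where *: "t \<in> diag_unitaries" "R \<in> pair_rotations" "n \<in> N" "m = t ** (R ** n)"
      by (metis product_setE)
    then have "t ** R \<in> pair_unitaries"
      using diag_unitaries_subset_pair by (auto simp: pair_rotations_def intro: pair_unitaries_mult)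
    with * show "m \<in> product_set pair_unitaries N"
      by (auto simp: matrix_mul_assoc intro: product_setI)
  qed
  show "product_set pair_unitaries N \<subseteq> product_set diag_unitaries (product_set pair_rotations N)"
  proof
    fix m assume "m \<in> product_set pair_unitaries N"
    then obtain U n where U: "U \<in> pair_unitaries" and n: "n \<in> N" and m: "m = U ** n"
      by (elim product_setE)
    obtain s R t where *: "s \<in> diag_unitaries" "R \<in> pair_rotations" "t \<in> diag_unitaries"
      "U = s ** (R ** t)"
      using pair_unitaries_euler[of U low] U low by metis
    then have "m = s ** (R ** (t ** n))" by (simp add: m matrix_mul_assoc)
    moreover have "t ** n \<in> N" using * n N by (blast intro: product_setI)
    ultimately show "m \<in> product_set diag_unitaries (product_set pair_rotations N)"
      using * by (auto intro!: product_setI)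
  qed
qed

end

section \<open>Charts\<close>

lemma smooth_onI: "(\<And>k. Ck_on k f S) \<Longrightarrow> smooth_on f S"
  by (simp add: smooth_on_def)

lemma smooth_onD: "smooth_on f S \<Longrightarrow> Ck_on k f S"
  by (simp add: smooth_on_def)

lemma Ck_on_matrix:
  fixes f :: "'a::real_normed_vector \<Rightarrow> complex^'n^'m"
  assumes "\<And>i j. Ck_on k (\<lambda>x. f x $ i $ j) UNIV"
  shows "Ck_on k f UNIV"
  by (intro Ck_on_vec assms)

lemma bounded_linear_nth_nth: "bounded_linear (\<lambda>A :: complex^'n^'m. A $ i $ j)"
  by (rule bounded_linear_compose[OF bounded_linear_vec_nth bounded_linear_vec_nth])

lemma differentiable_linear: "bounded_linear h \<Longrightarrow> h differentiable F"
  using bounded_linear_imp_has_derivative by (auto simp: differentiable_def)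

lemma differentiable_linear_comp:
  "bounded_linear h \<Longrightarrow> f differentiable (at x) \<Longrightarrow> (\<lambda>x. h (f x)) differentiable (at x)"
  by (rule differentiable_compose[of h f x UNIV, simplified]) (auto intro: differentiable_linear)

lemma differentiable_vec:
  fixes f :: "'a::real_normed_vector \<Rightarrow> 'b::euclidean_space ^ 'n"
  assumes "\<And>i. (\<lambda>x. f x $ i) differentiable (at x)"
  shows "f differentiable (at x)"
proof -
  have "f = (\<lambda>x. \<Sum>i\<in>UNIV. axis i (f x $ i))"
    by (auto simp: vec_eq_iff axis_def fun_eq_iff)
  moreover have "bounded_linear (axis i :: 'b \<Rightarrow> 'b ^ 'n)" for i
    by (auto simp: linear_conv_bounded_linear[symmetric] linear_iff axis_def vec_eq_iff)
  ultimately show ?thesis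
    using differentiable_sum[of UNIV "\<lambda>i x. axis i (f x $ i)" "at x"] differentiable_linear_comp[OF _ assms]
    by (metis finite)
qed

lemma differentiable_matrix_mult:
  fixes f g :: "'a::real_normed_vector \<Rightarrow> complex^'n^'n"
  assumes "f differentiable (at x)" and "g differentiable (at x)"
  shows "(\<lambda>x. f x ** g x) differentiable (at x)"
  using assms bounded_bilinear.FDERIV[OF bounded_bilinear_matrix_mult]
  unfolding differentiable_def by blast

lemma differentiable_matrix:
  fixes f :: "'a::real_normed_vector \<Rightarrow> complex^'n^'m"
  assumes "\<And>i j. (\<lambda>x. f x $ i $ j) differentiable (at x)"
  shows "f differentiable (at x)"
  by (intro differentiable_vec assms)

lemma smooth_on_imp_differentiable: "smooth_on f UNIV \<Longrightarrow> f differentiable (at x)"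
  using smooth_onD[of f UNIV "Suc 0"] by simp

text \<open>
  Charts defined on a whole linear space of parameters, with an inverse that is differentiable in the
  ambient space; by the chain rule this forces the parametrization to be an immersion.
\<close>

definition is_chart :: "'a::euclidean_space set \<Rightarrow> 'a set \<Rightarrow> 'a set \<Rightarrow> ('a \<Rightarrow> 'a) \<Rightarrow> ('a \<Rightarrow> 'a) \<Rightarrow> bool"
  where "is_chart L M U f g \<longleftrightarrow> open U \<and> smooth_on f UNIV \<and> (\<forall>y\<in>U. g differentiable (at y)) \<and>
     (\<forall>x\<in>L. f x \<in> M \<inter> U \<and> g (f x) = x) \<and> (\<forall>m\<in>M \<inter> U. g m \<in> L \<and> f (g m) = m)"

definition chartable :: "'a::euclidean_space set \<Rightarrow> 'a set \<Rightarrow> bool" where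
  "chartable L M \<longleftrightarrow> subspace L \<and> (\<forall>p\<in>M. \<exists>U f g. p \<in> U \<and> is_chart L M U f g)"

lemma chartable_imp_embedded_submanifold:
  assumes "chartable L M"
  shows "embedded_submanifold (dim L) M"
  unfolding embedded_submanifold_def
proof
  fix p assume "p \<in> M"
  with assms obtain U f g where U: "open U" "p \<in> U" and f: "smooth_on f UNIV"
    and g: "\<And>y. y \<in> U \<Longrightarrow> g differentiable (at y)"
    and fg: "\<And>x. x \<in> L \<Longrightarrow> f x \<in> M \<inter> U \<and> g (f x) = x"
    and gf: "\<And>m. m \<in> M \<inter> U \<Longrightarrow> g m \<in> L \<and> f (g m) = m"
    unfolding chartable_def is_chart_def by metis
  from assms have L: "subspace L" by (simp add: chartable_def)
  have df: "(f has_derivative frechet_derivative f (at x)) (at x)" for x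
    using smooth_on_imp_differentiable[OF f] frechet_derivative_works by blast
  have "continuous_on L f"
    by (meson df continuous_at_imp_continuous_on has_derivative_continuous)
  moreover have "continuous_on (M \<inter> U) g"
    by (meson g IntD2 continuous_at_imp_continuous_on differentiable_imp_continuous_within)
  ultimately have hom: "homeomorphism L (M \<inter> U) f g"
    using fg gf by (intro homeomorphismI) auto
  have inj: "inj_on (frechet_derivative f (at x)) L" if x: "x \<in> L" for x
  proof (rule inj_on_inverseI)
    fix v assume v: "v \<in> L"
    let ?g' = "frechet_derivative g (at (f x))"
    have dg: "(g has_derivative ?g') (at (f x))"
      using g fg x frechet_derivative_works by blast
    \<comment> \<open>\<open>g\<close> inverts \<open>f\<close> only on \<open>L\<close>, so the
      chain rule is applied along a line that stays inside \<open>L\<close>.\<close>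
    have line: "((\<lambda>t. x + t *\<^sub>R v) has_derivative (\<lambda>t. t *\<^sub>R v)) (at (0::real))"
      by (auto intro!: derivative_eq_intros)
    have "((\<lambda>t. g (f (x + t *\<^sub>R v))) has_derivative (\<lambda>t. ?g' (frechet_derivative f (at x) (t *\<^sub>R v)))) (at 0)"
      using has_derivative_compose[OF has_derivative_compose[OF line df], of g ?g'] dg by simp
    moreover have "g (f (x + t *\<^sub>R v)) = x + t *\<^sub>R v" for t
      using fg L x v by (meson subspace_add subspace_scale)
    ultimately have "(\<lambda>t. ?g' (frechet_derivative f (at x) (t *\<^sub>R v))) = (\<lambda>t. t *\<^sub>R v)"
      using has_derivative_unique line by auto
    from fun_cong[OF this, of 1] show "?g' (frechet_derivative f (at x) v) = v" by simp
  qed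
  show "\<exists>U W L' (f :: 'a \<Rightarrow> 'a) g. open U \<and> p \<in> U \<and> open W \<and> subspace L' \<and> dim L' = dim L \<and>
      smooth_on f W \<and> homeomorphism (W \<inter> L') (M \<inter> U) f g \<and>
      (\<forall>x\<in>W \<inter> L'. inj_on (frechet_derivative f (at x)) L')"
    by (rule exI[of _ U], rule exI[of _ UNIV], rule exI[of _ L], rule exI[of _ f], rule exI[of _ g])
      (use U L f hom inj in simp)
qed

section \<open>Charts of the torus of diagonal unitaries\<close>

definition imaginary_diagonals :: "(complex^'n::finite^'n) set" where
  "imaginary_diagonals = range (\<lambda>v :: real^'n. diag_mat (\<lambda>i. \<i> * of_real (v $ i)))"

lemma linear_imaginary_diagonals:
  "linear (\<lambda>v :: real^'n::finite. diag_mat (\<lambda>i. \<i> * of_real (v $ i)))"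
  by (auto simp: linear_iff diag_mat_def vec_eq_iff complex_eq_iff)

lemma subspace_imaginary_diagonals: "subspace imaginary_diagonals"
  unfolding imaginary_diagonals_def by (intro linear_subspace_image linear_imaginary_diagonals subspace_UNIV)

lemma dim_imaginary_diagonals: "dim (imaginary_diagonals :: (complex^'n::finite^'n) set) \<le> CARD('n)"
  unfolding imaginary_diagonals_def using dim_image_le[OF linear_imaginary_diagonals, of UNIV] by simp

text \<open>Central projection of the circle: a real v goes to (1 + i v) / sqrt(1 + v^2), a
  bijection onto the open right half circle with inverse Im / Re. Multiplication by \<open>d\<close>
  centres it at the given point.\<close>

lemma chartable_diag_unitaries:
  "chartable imaginary_diagonals (diag_unitaries :: (complex^'n::finite^'n) set)"
  unfolding chartable_def
proof (intro conjI ballI subspace_imaginary_diagonals)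
  fix p :: "complex^'n^'n" assume "p \<in> diag_unitaries"
  then obtain d where p: "p = diag_mat d" and d: "\<And>i. cmod (d i) = 1"
    by (auto simp: diag_unitaries_def)
  define f where "f A = diag_mat (\<lambda>j. d j * ((1 + \<i> * of_real (Im (A $ j $ j))) *
      of_real (1 / sqrt (1 + (Im (A $ j $ j))\<^sup>2))))" for A :: "complex^'n^'n"
  \<comment> \<open>\<open>q j\<close> rotates the j-th phase back so that \<open>p\<close> sits at
    1; the chart domain is then the half plane on which Im / Re is defined.\<close>
  define q where "q j m = cnj (d j) * (m $ j $ j)" for j and m :: "complex^'n^'n"
  define g where "g m = diag_mat (\<lambda>j. \<i> * of_real (Im (q j m) / Re (q j m)))" for m
  define U where "U = (\<Inter>j. {m. Re (q j m) > 0})"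
  have pos: "1 + x\<^sup>2 > 0" for x :: real by (simp add: add_pos_nonneg)
  have Ck_Im: "Ck_on k (\<lambda>A :: complex^'n^'n. Im (A $ j $ j)) UNIV" for j k
    by (intro Ck_on_linear_comp[OF bounded_linear_Im] Ck_on_linear bounded_linear_nth_nth)
  have "smooth_on f UNIV"
  proof (intro smooth_onI Ck_on_matrix)
    fix k i j
    have "Ck_on k (\<lambda>A. d i * ((1 + \<i> * of_real (Im (A $ i $ i))) *
      of_real (1 / sqrt (1 + (Im (A $ i $ i))\<^sup>2)))) UNIV"
      unfolding power2_eq_square
      by (intro Ck_on_bilinear[OF bounded_bilinear_mult] Ck_on_add Ck_on_const
          Ck_on_linear_comp[OF bounded_linear_of_real] Ck_on_rsqrt_1_plus Ck_Im) simp
    then show "Ck_on k (\<lambda>A. f A $ i $ j) UNIV"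
      by (cases "i = j") (simp_all add: f_def diag_mat_nth Ck_on_const)
  qed
  moreover have "open U"
    unfolding U_def q_def
    by (intro open_INT open_Collect_less continuous_intros ballI finite_class.finite_UNIV)
  moreover have "p \<in> U"
  proof -
    have "q j p = 1" for j by (simp add: q_def p diag_mat_nth cmod_1_cnj[OF d])
    then show ?thesis by (simp add: U_def)
  qed
  moreover have "g differentiable (at y)" if y: "y \<in> U" for y
  proof (rule differentiable_matrix)
    fix i j
    have q: "(q i) differentiable (at y)"
      unfolding q_def by (intro differentiable_mult differentiable_const differentiable_linear bounded_linear_nth_nth)
    have "Re (q i y) \<noteq> 0"
      using y by (auto simp: U_def dest: spec[of _ i])
    then have "(\<lambda>m. \<i> * of_real (Im (q i m) / Re (q i m))) differentiable (at y)"
      by (intro differentiable_mult differentiable_const differentiable_linear_comp[OF bounded_linear_of_real]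
          differentiable_divide differentiable_linear_comp[OF bounded_linear_Im]
          differentiable_linear_comp[OF bounded_linear_Re] q)
    then show "(\<lambda>m. g m $ i $ j) differentiable (at y)"
      by (cases "i = j") (simp_all add: g_def diag_mat_nth)
  qed
  moreover have "f x \<in> diag_unitaries \<inter> U \<and> g (f x) = x" if x: "x \<in> imaginary_diagonals" for x
  proof -
    obtain v :: "real^'n" where v: "x = diag_mat (\<lambda>i. \<i> * of_real (v $ i))"
      using x by (auto simp: imaginary_diagonals_def)
    have q: "q j (f x) = (1 + \<i> * of_real (v $ j)) * of_real (1 / sqrt (1 + (v $ j)\<^sup>2))" for j
      unfolding q_def f_def diag_mat_nth v using cmod_1_cnj(1)[OF d, of j]
      by (simp add: mult.assoc[symmetric])
    have "cmod (1 + \<i> * of_real y) = sqrt (1 + y\<^sup>2)" for y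
      by (simp add: cmod_def)
    then have "f x \<in> diag_unitaries"
      unfolding f_def using pos by (intro diag_unitariesI)
        (simp add: norm_mult d v diag_mat_nth norm_divide less_imp_neq[symmetric])
    moreover have "f x \<in> U" using pos by (simp add: U_def q)
    moreover have "\<i> * of_real (Im (q j (f x)) / Re (q j (f x))) = \<i> * of_real (v $ j)" for j
    proof -
      define u where "u = 1 / sqrt (1 + (v $ j)\<^sup>2)"
      have "u \<noteq> 0" using pos[of "v $ j"] by (simp add: u_def)
      then show ?thesis unfolding q u_def[symmetric] by simp
    qed
    then have "g (f x) = x"
      unfolding g_def by (simp only: v)
    ultimately show ?thesis by blast
  qed
  moreover have "g m \<in> imaginary_diagonals \<and> f (g m) = m" if m: "m \<in> diag_unitaries \<inter> U" for m
  proof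
    show "g m \<in> imaginary_diagonals"
      unfolding imaginary_diagonals_def g_def
      by (rule image_eqI[where x = "\<chi> j. Im (q j m) / Re (q j m)"]) simp_all
    obtain e where e: "m = diag_mat e" "\<And>i. cmod (e i) = 1"
      using m by (auto simp: diag_unitaries_def)
    have "d j * ((1 + \<i> * of_real (Im (q j m) / Re (q j m))) *
      of_real (1 / sqrt (1 + (Im (q j m) / Re (q j m))\<^sup>2))) = e j" for j
    proof -
      define z where "z = q j m"
      have z: "cmod z = 1" "Re z > 0" "d j * z = e j"
        using m by (simp_all add: z_def q_def U_def e diag_mat_nth d norm_mult mult.assoc[symmetric] cmod_1_cnj)
      have "1 + (Im z / Re z)\<^sup>2 = (1 / Re z)\<^sup>2"
        using z(1,2) cmod_power2[of z] by (simp add: field_simps)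
      then have "1 / sqrt (1 + (Im z / Re z)\<^sup>2) = Re z"
        using z(2) by (simp add: real_sqrt_unique)
      moreover have "(1 + \<i> * of_real (Im z / Re z)) * of_real (Re z) = z"
        using z(2) by (simp add: complex_eq_iff)
      ultimately show ?thesis using z(3) unfolding z_def[symmetric] by simp
    qed
    then show "f (g m) = m"
      by (simp add: vec_eq_iff f_def e(1) diag_mat_nth) (simp add: g_def diag_mat_nth e(1))
  qed
  ultimately have "p \<in> U \<and> is_chart imaginary_diagonals diag_unitaries U f g"
    unfolding is_chart_def by (intro conjI ballI) blast+
  then show "\<exists>U f g. p \<in> U \<and> is_chart imaginary_diagonals (diag_unitaries :: (complex^'n^'n) set) U f g"
    by (intro exI)
qed

lemma dim_sums_le:
  fixes S T :: "'a::euclidean_space set"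
  assumes "subspace S" and "subspace T"
  shows "dim {x + y | x y. x \<in> S \<and> y \<in> T} \<le> dim S + dim T"
  using dim_sums_Int[OF assms] by linarith

definition block_matrices :: "('n::finite \<Rightarrow> 'b) \<Rightarrow> (complex^'n^'n) set" where
  "block_matrices blk = {A. \<forall>i j. blk i \<noteq> blk j \<longrightarrow> A $ i $ j = 0}"

definition block_part :: "('n::finite \<Rightarrow> 'b) \<Rightarrow> complex^'n^'n \<Rightarrow> complex^'n^'n" where
  "block_part blk A = (\<chi> i j. if blk i = blk j then A $ i $ j else 0)"

lemma bounded_linear_block_part: "bounded_linear (block_part blk)"
  unfolding linear_conv_bounded_linear[symmetric]
  by (auto simp: linear_iff block_part_def vec_eq_iff)

section \<open>Coordinates on pair unitaries modulo the torus, and charts of products\<close>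

context pairing
begin

text \<open>The first condition includes i = j, so the diagonal vanishes: these are the tangent
  directions of the pair unitaries transversal to the torus, with one free complex number per
  pair.\<close>

definition pair_skew :: "(complex^'n^'n) set" where
  "pair_skew = {A. (\<forall>i j. i \<noteq> \<sigma> j \<longrightarrow> A $ i $ j = 0) \<and> (\<forall>i. A $ i $ \<sigma> i = - cnj (A $ \<sigma> i $ i))}"

definition pair_real_skew :: "(complex^'n^'n) set" where
  "pair_real_skew = {A \<in> pair_skew. \<forall>i j. Im (A $ i $ j) = 0}"

definition pair_scale :: "complex^'n^'n \<Rightarrow> 'n \<Rightarrow> real" where
  "pair_scale A j = 1 / sqrt (1 + (cmod (A $ \<sigma> j $ j))\<^sup>2)"

text \<open>The polar (unitary) part of \<open>1 + A\<close> when \<open>A\<close> is in \<open>pair_skew\<close>.\<close>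

definition pair_section :: "complex^'n^'n \<Rightarrow> complex^'n^'n" where
  "pair_section A = (\<chi> i j. if i = j then of_real (pair_scale A j)
     else if i = \<sigma> j then A $ i $ j * of_real (pair_scale A j) else 0)"

text \<open>Dividing a column by its diagonal entry cancels any diagonal factor on the right, so
  this is a coordinate on the cosets of the torus. It undoes \<open>pair_section\<close> on
  \<open>pair_skew\<close>.\<close>

definition pair_quotient :: "complex^'n^'n \<Rightarrow> complex^'n^'n" where
  "pair_quotient A = (\<chi> i j. if i = \<sigma> j then A $ i $ j / A $ j $ j else 0)"

lemma subspace_pair_skew: "subspace pair_skew"
  by (auto simp: subspace_def pair_skew_def)

lemma subspace_pair_real_skew: "subspace pair_real_skew"
  using subspace_pair_skew by (auto simp: subspace_def pair_real_skew_def)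

lemma one_plus_pos: "1 + (cmod z)\<^sup>2 > 0"
  by (simp add: add_pos_nonneg)

lemma pair_scale_pos: "pair_scale A j > 0"
  by (simp add: pair_scale_def one_plus_pos)

text \<open>For skew A the linear terms of adj(1 + A) (1 + A) cancel, leaving 1 + |a|^2 on each
  pair. The scale is the same on both modes of a pair, so it turns 1 + A into a unitary.\<close>

lemma pair_section_mem:
  assumes "A \<in> pair_skew"
  shows "pair_section A \<in> pair_unitaries"
proof -
  have A: "A $ i $ \<sigma> i = - cnj (A $ \<sigma> i $ i)" for i
    using assms by (simp add: pair_skew_def)
  have scale: "pair_scale A (\<sigma> i) = pair_scale A i" for i
    by (simp add: pair_scale_def A)
  have "(pair_scale A i)\<^sup>2 * (1 + (cmod (A $ \<sigma> i $ i))\<^sup>2) = 1" for i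
    using one_plus_pos[of "A $ \<sigma> i $ i"] by (simp add: pair_scale_def power_divide)
  then have "complex_of_real ((pair_scale A i)\<^sup>2 * (1 + (cmod (A $ \<sigma> i $ i))\<^sup>2)) = 1" for i
    by simp
  then have "complex_of_real (pair_scale A i) * of_real (pair_scale A i) + cnj (A $ \<sigma> i $ i) *
      of_real (pair_scale A i) * (A $ \<sigma> i $ i * of_real (pair_scale A i)) = 1" for i
    by (simp only: of_real_mult of_real_add of_real_1 complex_norm_square)
      (simp add: power2_eq_square algebra_simps)
  then show ?thesis
    by (intro pair_unitariesI) (auto simp: pair_supported_def pair_section_def A scale)
qed

lemma pair_section_real_mem:
  assumes "A \<in> pair_real_skew"
  shows "pair_section A \<in> pair_rotations"
proof -
  have A: "A \<in> pair_skew" "\<And>i j. Im (A $ i $ j) = 0"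
    using assms by (auto simp: pair_real_skew_def)
  have A': "A $ i $ \<sigma> i = - A $ \<sigma> i $ i" for i
    using A by (simp add: pair_skew_def complex_eq_iff)
  have "pair_scale A (\<sigma> i) = pair_scale A i" for i
    by (simp add: pair_scale_def A')
  then show ?thesis
    using pair_section_mem[OF A(1)] by (auto simp: pair_rotations_def pair_section_def A(2) A')
qed

text \<open>Skewness is the orthogonality of the two columns of a block, divided by diagonal
  entries.\<close>

lemma pair_quotient_mem:
  assumes "h \<in> pair_unitaries" and nz: "\<And>j. h $ j $ j \<noteq> 0"
  shows "pair_quotient h \<in> pair_skew"
proof -
  have "h $ i $ \<sigma> i / h $ \<sigma> i $ \<sigma> i = - cnj (h $ \<sigma> i $ i / h $ i $ i)" for i
  proof -
    have "cnj (h $ i $ i) * h $ i $ \<sigma> i = - (cnj (h $ \<sigma> i $ i) * h $ \<sigma> i $ \<sigma> i)"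
      using pair_unitaries_eqs(4)[OF assms(1), of i] by (simp only: eq_neg_iff_add_eq_0)
    moreover have "cnj (h $ i $ i) \<noteq> 0" "h $ \<sigma> i $ \<sigma> i \<noteq> 0" using nz by simp_all
    ultimately have "h $ i $ \<sigma> i / h $ \<sigma> i $ \<sigma> i = - cnj (h $ \<sigma> i $ i) / cnj (h $ i $ i)"
      by (subst frac_eq_eq) (simp_all add: mult.commute)
    then show ?thesis by simp
  qed
  then show ?thesis by (simp add: pair_skew_def pair_quotient_def)
qed

lemma pair_quotient_real_mem:
  assumes "h \<in> pair_rotations" and "\<And>j. h $ j $ j \<noteq> 0"
  shows "pair_quotient h \<in> pair_real_skew"
  using assms pair_quotient_mem[of h]
  by (simp add: pair_real_skew_def pair_quotient_def pair_rotations_def Im_divide)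

text \<open>\<open>h\<close> and the section of its quotient have proportional columns. Both are
  unitary, so the factors are phases, namely those of the diagonal entries of
  \<open>h\<close>.\<close>

lemma pair_section_quotient:
  assumes "h \<in> pair_unitaries" and nz: "\<And>j. h $ j $ j \<noteq> 0"
  shows "adj (pair_section (pair_quotient h)) ** h \<in> diag_unitaries"
proof -
  define t where "t j = h $ j $ j / of_real (cmod (h $ j $ j))" for j
  have scale: "pair_scale (pair_quotient h) j = cmod (h $ j $ j)" for j
  proof -
    have "complex_of_real ((cmod (h $ j $ j))\<^sup>2 + (cmod (h $ \<sigma> j $ j))\<^sup>2) = 1"
      using pair_unitaries_eqs(2)[OF assms(1), of j] by (simp add: cnj_mult_norm)
    then have "(cmod (h $ j $ j))\<^sup>2 + (cmod (h $ \<sigma> j $ j))\<^sup>2 = 1"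
      by (simp only: of_real_eq_1_iff)
    then have "1 + (cmod (h $ \<sigma> j $ j / h $ j $ j))\<^sup>2 = (1 / cmod (h $ j $ j))\<^sup>2"
      using nz by (simp add: norm_divide field_simps)
    then show ?thesis using nz by (simp add: pair_scale_def pair_quotient_def real_sqrt_unique)
  qed
  have "pair_section (pair_quotient h) ** diag_mat t = h"
  proof -
    have "(pair_section (pair_quotient h) ** diag_mat t) $ i $ j = h $ i $ j" for i j
    proof -
      have "i \<noteq> j \<Longrightarrow> i \<noteq> \<sigma> j \<Longrightarrow> h $ i $ j = 0"
        using assms(1) by (simp add: pair_unitaries_def pair_supported_def)
      then show ?thesis
        unfolding diag_mat_mult_right using nz
        by (auto simp: pair_section_def scale t_def) (simp add: pair_quotient_def)
    qed
    then show ?thesis by (simp add: vec_eq_iff)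
  qed
  moreover have "pair_section (pair_quotient h) \<in> unitaries"
    using pair_section_mem[OF pair_quotient_mem[OF assms]] by (simp add: pair_unitaries_def)
  ultimately have "adj (pair_section (pair_quotient h)) ** h = diag_mat t"
    by (metis unitaries_cancel(2))
  moreover have "diag_mat t \<in> diag_unitaries"
    using nz by (intro diag_unitariesI) (simp add: t_def norm_divide)
  ultimately show ?thesis by simp
qed

lemma Ck_on_pair_section: "Ck_on k pair_section UNIV"
proof (intro Ck_on_matrix)
  fix i j
  have scale: "Ck_on k (\<lambda>A. complex_of_real (pair_scale A j)) UNIV"
    unfolding pair_scale_def cmod_power2 unfolding power2_eq_square
    by (intro Ck_on_linear_comp[OF bounded_linear_of_real] Ck_on_rsqrt_1_plus Ck_on_add
        Ck_on_bilinear[OF bounded_bilinear_mult] Ck_on_linear_comp[OF bounded_linear_Re]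
        Ck_on_linear_comp[OF bounded_linear_Im] Ck_on_linear bounded_linear_nth_nth) simp
  moreover have "Ck_on k (\<lambda>A. A $ i $ j * complex_of_real (pair_scale A j)) UNIV"
    by (intro Ck_on_bilinear[OF bounded_bilinear_mult] scale Ck_on_linear bounded_linear_nth_nth)
  ultimately show "Ck_on k (\<lambda>A. pair_section A $ i $ j) UNIV"
    by (cases "i = j"; cases "i = \<sigma> j") (simp_all add: pair_section_def Ck_on_const)
qed

text \<open>A row of \<open>h ** n\<close> mixes the rows i and \<open>\<sigma> i\<close> of
  \<open>n\<close>. These live in different blocks, so inside the block of i only the first
  contributes.\<close>

lemma block_part_pair_mult:
  assumes h: "pair_supported h" and n: "n \<in> block_matrices blk" and blk: "\<And>i. blk (\<sigma> i) \<noteq> blk i"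
  shows "block_part blk (h ** n) = diag_mat (\<lambda>i. h $ i $ i) ** n"
proof -
  have "block_part blk (h ** n) $ i $ j = (diag_mat (\<lambda>i. h $ i $ i) ** n) $ i $ j" for i j
  proof -
    have "blk i = blk j \<Longrightarrow> n $ \<sigma> i $ j = 0" "blk i \<noteq> blk j \<Longrightarrow> n $ i $ j = 0"
      using n blk[of i] by (auto simp: block_matrices_def)
    then show ?thesis
      by (simp add: diag_mat_mult_left block_part_def mult_left_nth[OF h])
  qed
  then show ?thesis by (simp add: vec_eq_iff)
qed

text \<open>
  Around \<open>g0 ** n0\<close> the product set is parametrized by \<open>x + y \<mapsto> g0 ** pair_section x ** f y\<close>, where
  \<open>f\<close> is a chart of \<open>N\<close> around \<open>n0\<close>. As \<open>N\<close> is block diagonal while \<open>x\<close> sits outside the blocks, \<open>x\<close>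
  is read off the product \<open>q = h ** n\<close> from the entries of \<open>q ** adj (block_part q)\<close>, which are
  \<open>h $ i $ j * cnj (h $ j $ j)\<close>.
\<close>

lemma chartable_product_set:
  fixes blk :: "'n \<Rightarrow> 'b"
  assumes blk: "\<And>i. blk (\<sigma> i) \<noteq> blk i"
    and H: "H \<subseteq> pair_unitaries" and H_adj_mult: "\<And>g h. g \<in> H \<Longrightarrow> h \<in> H \<Longrightarrow> adj g ** h \<in> H"
    and X: "subspace X" "X \<subseteq> pair_skew"
    and H_section: "\<And>g x. g \<in> H \<Longrightarrow> x \<in> X \<Longrightarrow> g ** pair_section x \<in> H"
    and H_quotient: "\<And>h. h \<in> H \<Longrightarrow> (\<And>j. h $ j $ j \<noteq> 0) \<Longrightarrow> pair_quotient h \<in> X"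
    and N: "N \<subseteq> unitaries" "N \<subseteq> block_matrices blk" "product_set diag_unitaries N \<subseteq> N"
    and L: "chartable L N" "L \<subseteq> block_matrices blk"
  shows "chartable {x + y | x y. x \<in> X \<and> y \<in> L} (product_set H N)"
  unfolding chartable_def
proof (intro conjI ballI)
  from L(1) have subL: "subspace L" by (simp add: chartable_def)
  show "subspace {x + y | x y. x \<in> X \<and> y \<in> L}" by (rule subspace_sums[OF X(1) subL])
  fix p assume "p \<in> product_set H N"
  then obtain g0 n0 where g0: "g0 \<in> H" and n0: "n0 \<in> N" and p: "p = g0 ** n0"
    by (elim product_setE)
  obtain U f g where n0U: "n0 \<in> U" and chart: "is_chart L N U f g"
    using L(1) n0 by (auto simp: chartable_def)
  then have U: "open U" and f: "smooth_on f UNIV"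
    and dg: "\<And>y. y \<in> U \<Longrightarrow> g differentiable (at y)"
    and fg: "\<And>x. x \<in> L \<Longrightarrow> f x \<in> N \<and> f x \<in> U \<and> g (f x) = x"
    and gf: "\<And>m. m \<in> N \<Longrightarrow> m \<in> U \<Longrightarrow> g m \<in> L \<and> f (g m) = m"
    by (auto simp: is_chart_def)
  have HU: "h \<in> unitaries" "pair_supported h" if "h \<in> H" for h
    using that H by (auto simp: pair_unitaries_def)
  define f' where "f' A = g0 ** (pair_section A ** f (block_part blk A))" for A
  \<comment> \<open>Removing \<open>g0\<close> centres the first factor at the identity, whose
    diagonal entries are nonzero.\<close>
  define q where "q m = adj g0 ** m" for m :: "complex^'n^'n"
  define E where "E m = q m ** adj (block_part blk (q m))" for m
  \<comment> \<open>Dividing out the section of the recovered coset leaves the second factor,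
    possibly changed by a diagonal unitary on its left.\<close>
  define n' where "n' m = adj (pair_section (pair_quotient (E m))) ** q m" for m
  define g' where "g' m = pair_quotient (E m) + g (n' m)" for m
  \<comment> \<open>On the product set these entries are the squared moduli of the diagonal entries
    of \<open>h\<close>, so \<open>V\<close> is where the quotient coordinate exists.\<close>
  define V where "V = {m. \<forall>j. E m $ j $ j \<noteq> 0}"
  define U' where "U' = V \<inter> n' -` U"

  have E_eq: "E m $ i $ j = h $ i $ j * cnj (h $ j $ j)"
    if "q m = h ** n" "pair_supported h" "n \<in> N" for m h n i j
  proof -
    have n: "n \<in> unitaries" "n \<in> block_matrices blk" using that(3) N by auto
    have "E m = h ** (n ** (adj n ** adj (diag_mat (\<lambda>i. h $ i $ i))))"
      unfolding E_def that(1) block_part_pair_mult[OF that(2) n(2) blk] adj_mult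
      by (rule matrix_mul_assoc[symmetric])
    then have "E m = h ** adj (diag_mat (\<lambda>i. h $ i $ i))"
      by (simp only: unitaries_cancel(1)[OF n(1)])
    also have "adj (diag_mat (\<lambda>i. h $ i $ i)) = diag_mat (\<lambda>i. cnj (h $ i $ i))"
      by (simp add: vec_eq_iff diag_mat_nth)
    finally show ?thesis by (simp add: diag_mat_mult_right)
  qed
  \<comment> \<open>The common column factor \<open>cnj (h $ j $ j)\<close> cancels in the
    quotient.\<close>
  have quot_eq: "pair_quotient (E m) = pair_quotient h"
    if "q m = h ** n" "pair_supported h" "n \<in> N" "\<And>j. h $ j $ j \<noteq> 0" for m h n
    using that(4) by (simp add: vec_eq_iff pair_quotient_def E_eq[OF that(1,2,3)])

  have bl_q: "bounded_linear q"
    unfolding q_def by (rule bounded_bilinear.bounded_linear_right[OF bounded_bilinear_matrix_mult])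
  have dE: "E differentiable (at m)" for m
    unfolding E_def
    by (intro differentiable_matrix_mult differentiable_linear_comp[OF bounded_linear_adj]
        differentiable_linear_comp[OF bounded_linear_block_part] differentiable_linear bl_q)
  have dEn: "(\<lambda>m. E m $ i $ j) differentiable (at m)" for i j m
    by (rule differentiable_linear_comp[OF bounded_linear_nth_nth dE])
  have dquot: "(\<lambda>m. pair_quotient (E m)) differentiable (at m)" if "m \<in> V" for m
  proof (rule differentiable_matrix)
    fix i j
    have "(\<lambda>m. E m $ i $ j / E m $ j $ j) differentiable (at m)"
      using that by (intro differentiable_divide dEn) (simp add: V_def)
    then show "(\<lambda>m. pair_quotient (E m) $ i $ j) differentiable (at m)"
      by (cases "i = \<sigma> j") (simp_all add: pair_quotient_def)
  qed
  have dn': "n' differentiable (at m)" if "m \<in> V" for m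
  proof -
    have "pair_section differentiable (at A)" for A
      by (intro smooth_on_imp_differentiable smooth_onI Ck_on_pair_section)
    from differentiable_chain_at[OF dquot[OF that] this]
    have "(\<lambda>m. pair_section (pair_quotient (E m))) differentiable (at m)"
      by (simp add: o_def)
    then show ?thesis
      unfolding n'_def
      by (intro differentiable_matrix_mult differentiable_linear_comp[OF bounded_linear_adj]
          differentiable_linear[OF bl_q])
  qed

  have "open V"
  proof -
    have "continuous_on UNIV (\<lambda>m. E m $ j $ j)" for j
      by (intro continuous_at_imp_continuous_on ballI differentiable_imp_continuous_within dEn)
    then have "open (\<Inter>j. {m. E m $ j $ j \<noteq> 0})"
      by (intro open_INT ballI open_Collect_neq continuous_on_const) auto
    moreover have "V = (\<Inter>j. {m. E m $ j $ j \<noteq> 0})" by (auto simp: V_def)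
    ultimately show ?thesis by simp
  qed
  then have "open U'"
    unfolding U'_def
    by (intro continuous_open_preimage U continuous_at_imp_continuous_on ballI
        differentiable_imp_continuous_within dn')
  moreover have "p \<in> U'"
  proof -
    have q: "q p = n0"
      by (simp add: p q_def unitaries_cancel HU[OF g0])
    then have q': "q p = mat 1 ** n0" by simp
    have s: "pair_supported (mat 1 :: complex^'n^'n)" by (simp add: pair_supported_def mat_def)
    have "pair_quotient (mat 1 :: complex^'n^'n) = 0"
      by (simp add: pair_quotient_def vec_eq_iff mat_def)
    then have "pair_quotient (E p) = 0"
      using quot_eq[OF q' s n0] by (simp add: mat_def)
    moreover have "pair_section 0 = mat 1"
      by (simp add: pair_section_def pair_scale_def vec_eq_iff mat_def)
    ultimately have "n' p = n0" by (simp add: n'_def q)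
    with n0U show ?thesis
      using E_eq[OF q' s n0] by (simp add: U'_def V_def mat_def)
  qed
  moreover have "smooth_on f' UNIV"
    unfolding f'_def
    by (intro smooth_onI Ck_on_bilinear[OF bounded_bilinear_matrix_mult] Ck_on_const
        Ck_on_pair_section Ck_on_comp_linear[OF bounded_linear_block_part] smooth_onD[OF f])
  moreover have "g' differentiable (at m)" if "m \<in> U'" for m
  proof -
    have "m \<in> V" "n' m \<in> U" using that by (auto simp: U'_def)
    with differentiable_chain_at[OF dn' dg]
    have "(\<lambda>m. g (n' m)) differentiable (at m)" by (simp add: o_def)
    then show ?thesis
      unfolding g'_def by (intro differentiable_add dquot \<open>m \<in> V\<close>)
  qed
  moreover have "f' A \<in> product_set H N \<inter> U' \<and> g' (f' A) = A" if A_mem: "A \<in> {x + y | x y. x \<in> X \<and> y \<in> L}" for A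
  proof -
    obtain x y where x: "x \<in> X" and y: "y \<in> L" and A: "A = x + y" using A_mem by auto
    have xn: "x $ i $ j = 0" if "i \<noteq> \<sigma> j" for i j
      using x X(2) that by (auto simp: pair_skew_def)
    have yn: "y $ i $ j = 0" if "blk i \<noteq> blk j" for i j
      using y L(2) that by (auto simp: block_matrices_def)
    \<comment> \<open>\<open>x\<close> and \<open>y\<close> occupy disjoint sets of entries, off and
      on the blocks, so each can be read off their sum.\<close>
    have part: "block_part blk A = y"
      using xn yn blk by (simp add: block_part_def vec_eq_iff A) metis
    have sect: "pair_section A = pair_section x"
      using yn blk by (simp add: pair_section_def vec_eq_iff A pair_scale_def)
    let ?c = "pair_section x"
    have c: "?c \<in> unitaries" "pair_supported ?c"
      using pair_section_mem x X(2) by (auto simp: pair_unitaries_def)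
    have nz: "?c $ j $ j \<noteq> 0" for j
      using pair_scale_pos[of x j] by (simp add: pair_section_def)
    have f'A: "f' A = (g0 ** ?c) ** f y"
      by (simp add: f'_def part sect matrix_mul_assoc)
    have q: "q (f' A) = ?c ** f y"
      by (simp add: f'_def q_def part sect unitaries_cancel HU[OF g0])
    have fy: "f y \<in> N" "f y \<in> U" "g (f y) = y" using fg[OF y] by auto
    have "pair_quotient ?c = x"
      using pair_scale_pos[of x] xn
      by (auto simp: pair_quotient_def pair_section_def vec_eq_iff less_imp_neq[symmetric])
    then have quot: "pair_quotient (E (f' A)) = x"
      using quot_eq[OF q c(2) fy(1) nz] by simp
    have "n' (f' A) = f y"
      by (simp add: n'_def quot q unitaries_cancel c(1))
    moreover have "f' A \<in> product_set H N"
      unfolding f'A by (intro product_setI H_section g0 x fy)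
    moreover have "f' A \<in> V"
      using nz E_eq[OF q c(2) fy(1)] by (simp add: V_def)
    ultimately show ?thesis
      using fy quot by (simp add: U'_def g'_def) (simp add: A)
  qed
  moreover have "g' m \<in> {x + y | x y. x \<in> X \<and> y \<in> L} \<and> f' (g' m) = m" if m: "m \<in> product_set H N \<inter> U'" for m
  proof -
    obtain k n where k: "k \<in> H" and n: "n \<in> N" and m_eq: "m = k ** n"
      using m by (auto elim: product_setE)
    define h where "h = adj g0 ** k"
    have h: "h \<in> H" unfolding h_def by (rule H_adj_mult[OF g0 k])
    have q: "q m = h ** n" by (simp add: q_def h_def m_eq matrix_mul_assoc)
    have nz: "h $ j $ j \<noteq> 0" for j
      using m E_eq[OF q HU(2)[OF h] n, of j j] by (auto simp: U'_def V_def)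
    define x where "x = pair_quotient h"
    have x: "x \<in> X" unfolding x_def by (rule H_quotient[OF h nz])
    have quot: "pair_quotient (E m) = x"
      unfolding x_def by (rule quot_eq[OF q HU(2)[OF h] n nz])
    have n'_eq: "n' m = (adj (pair_section x) ** h) ** n"
      by (simp add: n'_def quot q matrix_mul_assoc)
    \<comment> \<open>The factorization of \<open>m\<close> is unique only up to the torus; this
      diagonal discrepancy is absorbed by the left invariance of \<open>N\<close>.\<close>
    have "adj (pair_section x) ** h \<in> diag_unitaries"
      unfolding x_def using h H nz by (intro pair_section_quotient) auto
    then have n'N: "n' m \<in> N" unfolding n'_eq using n N(3) product_setI by blast
    have n'U: "n' m \<in> U" using m by (simp add: U'_def)
    define y where "y = g (n' m)"
    have y: "y \<in> L" "f y = n' m" using gf[OF n'N n'U] by (simp_all add: y_def)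
    have g'm: "g' m = x + y" by (simp add: g'_def quot y_def)
    have xn: "x $ i $ j = 0" if "i \<noteq> \<sigma> j" for i j
      using x X(2) that by (auto simp: pair_skew_def)
    have yn: "y $ i $ j = 0" if "blk i \<noteq> blk j" for i j
      using y L(2) that by (auto simp: block_matrices_def)
    have part: "block_part blk (x + y) = y"
      using xn yn blk by (simp add: block_part_def vec_eq_iff) metis
    have sect: "pair_section (x + y) = pair_section x"
      using yn blk by (simp add: pair_section_def vec_eq_iff pair_scale_def)
    have "pair_section x \<in> unitaries"
      using pair_section_mem x X(2) by (auto simp: pair_unitaries_def)
    then have "f' (x + y) = g0 ** q m"
      by (simp add: f'_def part sect y(2) n'_def quot unitaries_cancel)
    also have "\<dots> = m" by (simp add: q_def unitaries_cancel HU[OF g0])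
    finally show ?thesis using x y g'm by auto
  qed
  ultimately have "p \<in> U' \<and> is_chart {x + y | x y. x \<in> X \<and> y \<in> L} (product_set H N) U' f' g'"
    unfolding is_chart_def by (intro conjI ballI) blast+
  then show "\<exists>U f g. p \<in> U \<and> is_chart {x + y | x y. x \<in> X \<and> y \<in> L} (product_set H N) U f g"
    by (intro exI)
qed

end

section \<open>Circuits and layers\<close>

text \<open>The flattened form of \<open>circuit_op\<close>, so that inductions peel off single
  gates.\<close>

definition gates_op :: "(param \<Rightarrow> real) \<Rightarrow> 'm::finite gate list \<Rightarrow> complex^'m^'m" where
  "gates_op v gs = foldl (\<lambda>M g. gate_op g (v (angle g)) ** M) (mat 1) gs"

lemma circuit_op_eq_gates_op: "circuit_op v C = gates_op v (concat C)"
  by (simp add: circuit_op_def gates_op_def)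

lemma foldl_gate_op:
  "foldl (\<lambda>M g. gate_op g (v (angle g)) ** M) M gs = gates_op v gs ** (M :: complex^'m::finite^'m)"
proof (induction gs arbitrary: M)
  case (Cons g gs)
  from Cons[of "gate_op g (v (angle g)) ** M"] Cons[of "gate_op g (v (angle g)) ** mat 1"] show ?case
    by (simp add: gates_op_def matrix_mul_assoc)
qed (simp add: gates_op_def)

lemma gates_op_Nil [simp]: "gates_op v [] = mat 1"
  by (simp add: gates_op_def)

lemma gates_op_Cons: "gates_op v (g # gs) = gates_op v gs ** gate_op g (v (angle g))"
  using foldl_gate_op[of v "gate_op g (v (angle g))" gs] by (simp add: gates_op_def)

lemma gates_op_append: "gates_op v (gs @ hs) = gates_op v hs ** gates_op v gs"
  by (induction gs) (simp_all add: gates_op_Cons matrix_mul_assoc)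

lemma gates_op_cong:
  "(\<And>g. g \<in> set gs \<Longrightarrow> v (angle g) = w (angle g)) \<Longrightarrow> gates_op v gs = gates_op w gs"
  by (induction gs) (simp_all add: gates_op_Cons)

lemma circuit_op_append: "circuit_op v (C @ D) = circuit_op v D ** circuit_op v C"
  by (simp add: circuit_op_eq_gates_op gates_op_append)

text \<open>Since no angle is shared, assignments chosen independently for the two circuits can be
  glued into one.\<close>

lemma range_circuit_op_append:
  assumes "circuit_params C \<inter> circuit_params D = {}"
  shows "range (\<lambda>v. circuit_op v (C @ D)) = product_set (range (\<lambda>v. circuit_op v D)) (range (\<lambda>v. circuit_op v C))"
proof
  show "range (\<lambda>v. circuit_op v (C @ D)) \<subseteq> product_set (range (\<lambda>v. circuit_op v D)) (range (\<lambda>v. circuit_op v C))"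
    by (auto simp: circuit_op_append intro!: product_setI)
  show "product_set (range (\<lambda>v. circuit_op v D)) (range (\<lambda>v. circuit_op v C)) \<subseteq> range (\<lambda>v. circuit_op v (C @ D))"
  proof
    fix M assume "M \<in> product_set (range (\<lambda>v. circuit_op v D)) (range (\<lambda>v. circuit_op v C))"
    then obtain v w where M: "M = circuit_op v D ** circuit_op w C" by (auto elim!: product_setE)
    define u where "u p = (if p \<in> circuit_params C then w p else v p)" for p
    have par: "angle g \<in> circuit_params E" if "g \<in> set (concat E)" for g :: "'m gate" and E
      using that unfolding circuit_params_def by (rule imageI)
    have "circuit_op u C = circuit_op w C"
      unfolding circuit_op_eq_gates_op by (rule gates_op_cong) (simp only: u_def par if_True)
    moreover have "circuit_op u D = circuit_op v D"
      unfolding circuit_op_eq_gates_op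
    proof (rule gates_op_cong)
      fix g assume "g \<in> set (concat D)"
      then have "angle g \<notin> circuit_params C" using par assms by blast
      then show "u (angle g) = v (angle g)" by (simp add: u_def)
    qed
    ultimately show "M \<in> range (\<lambda>v. circuit_op v (C @ D))"
      by (auto simp: M circuit_op_append intro!: image_eqI[where x = u])
  qed
qed

lemma gate_op_off_support: "i \<notin> support g \<Longrightarrow> gate_op g t $ i $ j = (if i = j then 1 else 0)"
  by (cases g) auto

lemma gate_op_support: "i \<in> support g \<Longrightarrow> j \<notin> support g \<Longrightarrow> gate_op g t $ i $ j = 0"
  by (cases g) auto

lemma gates_op_off_support:
  "(\<And>g. g \<in> set gs \<Longrightarrow> i \<notin> support g) \<Longrightarrow> gates_op v gs $ i $ j = (if i = j then 1 else 0)"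
proof (induction gs arbitrary: j)
  case (Cons g gs)
  have "gates_op v (g # gs) $ i $ j = (\<Sum>k\<in>UNIV. if k = i then gate_op g (v (angle g)) $ k $ j else 0)"
    unfolding gates_op_Cons matrix_matrix_mult_def vec_lambda_beta
    using Cons by (intro sum.cong) auto
  also have "\<dots> = gate_op g (v (angle g)) $ i $ j" by simp
  finally show ?case using Cons.prems by (simp add: gate_op_off_support)
qed (simp add: mat_def)

text \<open>Row i of the gate at i is supported on modes that every other gate of the layer fixes,
  so the remaining factors leave the row unchanged.\<close>

lemma gates_op_row:
  assumes "sorted_wrt (\<lambda>g h. support g \<inter> support h = {}) gs" and "g \<in> set gs" and "i \<in> support g"
  shows "gates_op v gs $ i $ j = gate_op g (v (angle g)) $ i $ j"
  using assms
proof (induction gs arbitrary: j)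
  case (Cons h gs)
  have "gates_op v (h # gs) $ i $ j = (\<Sum>k\<in>UNIV. gates_op v gs $ i $ k * gate_op h (v (angle h)) $ k $ j)"
    unfolding gates_op_Cons matrix_matrix_mult_def vec_lambda_beta ..
  also have "\<dots> = gate_op g (v (angle g)) $ i $ j"
  proof (cases "g \<in> set gs")
    case True
    then have disj: "support h \<inter> support g = {}" using Cons.prems(1) by auto
    have "(\<Sum>k\<in>UNIV. gates_op v gs $ i $ k * gate_op h (v (angle h)) $ k $ j)
        = (\<Sum>k\<in>UNIV. if k = j then gate_op g (v (angle g)) $ i $ k else 0)"
    proof (rule sum.cong)
      fix k
      have IH: "gates_op v gs $ i $ k = gate_op g (v (angle g)) $ i $ k"
        using Cons True by simp
      show "gates_op v gs $ i $ k * gate_op h (v (angle h)) $ k $ j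
        = (if k = j then gate_op g (v (angle g)) $ i $ k else 0)"
      proof (cases "k \<in> support g")
        case True
        with disj have "k \<notin> support h" by blast
        then show ?thesis unfolding IH by (simp add: gate_op_off_support)
      next
        case False
        then show ?thesis unfolding IH using Cons.prems(3) by (auto simp: gate_op_support)
      qed
    qed simp
    then show ?thesis by simp
  next
    case False
    then have "g = h" using Cons.prems by simp
    then have "\<And>h. h \<in> set gs \<Longrightarrow> i \<notin> support h" using Cons.prems by auto
    then have "gates_op v gs $ i $ k = (if i = k then 1 else 0)" for k
      by (rule gates_op_off_support)
    then show ?thesis by (simp add: \<open>g = h\<close> if_distrib[of "\<lambda>x. x * _"] cong: if_cong)
  qed
  finally show ?case .
qed simp

section \<open>Indexing of modes and the matrices of the butterfly layers\<close>

lemma flip_bit_less: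
  assumes "i < 2 ^ K" and "m < K" shows "flip_bit m i < (2 ^ K :: nat)"
proof -
  have "take_bit K (flip_bit m i) = flip_bit m i"
    using assms by (simp add: take_bit_flip_bit_eq take_bit_nat_eq_self)
  then show ?thesis by (simp only: take_bit_nat_eq_self_iff)
qed

locale butterfly_modes =
  fixes K :: nat and mode :: "nat \<Rightarrow> 'n::finite"
  assumes bij_mode: "bij_betw mode {..<2 ^ K} UNIV"
begin

definition idx :: "'n \<Rightarrow> nat" where
  "idx = the_inv_into {..<2 ^ K} mode"

lemma idx_less: "idx a < 2 ^ K"
  using bij_betw_the_inv_into[OF bij_mode] by (auto simp: idx_def bij_betw_def)

lemma mode_idx [simp]: "mode (idx a) = a"
  using bij_mode by (simp add: idx_def f_the_inv_into_f_bij_betw)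

lemma idx_mode [simp]: "i < 2 ^ K \<Longrightarrow> idx (mode i) = i"
  using bij_mode by (simp add: idx_def the_inv_into_f_f bij_betw_def)

lemma mode_eq_iff: "i < 2 ^ K \<Longrightarrow> j < 2 ^ K \<Longrightarrow> mode i = mode j \<longleftrightarrow> i = j"
  using idx_mode by metis

lemma idx_eq_iff: "idx a = idx b \<longleftrightarrow> a = b"
  using mode_idx by metis

definition partner :: "nat \<Rightarrow> 'n \<Rightarrow> 'n" where
  "partner l a = mode (flip_bit (l - 1) (idx a))"

definition low :: "nat \<Rightarrow> 'n \<Rightarrow> bool" where
  "low l a \<longleftrightarrow> \<not> bit (idx a) (l - 1)"

lemma idx_partner: "1 \<le> l \<Longrightarrow> l \<le> K \<Longrightarrow> idx (partner l a) = flip_bit (l - 1) (idx a)"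
  by (simp add: partner_def flip_bit_less idx_less)

lemma low_partner: "1 \<le> l \<Longrightarrow> l \<le> K \<Longrightarrow> low l (partner l a) \<longleftrightarrow> \<not> low l a"
  by (simp add: low_def idx_partner bit_flip_bit_iff)

lemma pairing_partner:
  assumes "1 \<le> l" and "l \<le> K" shows "pairing (partner l)"
proof
  fix a
  have "flip_bit (l - 1) (flip_bit (l - 1) (idx a)) = idx a"
    by (auto simp: bit_eq_iff bit_flip_bit_iff)
  then show "partner l (partner l a) = a"
    using assms by (simp add: idx_partner flip: idx_eq_iff)
  show "partner l a \<noteq> a" using low_partner[OF assms, of a] by auto
qed

text \<open>Modes with the same bits from position k on form a block of size 2^k. Flipping bit l - 1
  leaves the block of level l - 1 but stays in that of level l, which is exactly what makes the
  layers couple smaller blocks into larger ones.\<close>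

lemma block_partner:
  assumes "1 \<le> l" and "l \<le> K"
  shows "drop_bit (l - 1) (idx (partner l a)) \<noteq> drop_bit (l - 1) (idx a)"
    and "drop_bit l (idx (partner l a)) = drop_bit l (idx a)"
proof -
  have "bit (drop_bit (l - 1) (idx (partner l a))) 0 \<noteq> bit (drop_bit (l - 1) (idx a)) 0"
    using assms by (simp only: bit_drop_bit_eq o_def) (simp add: idx_partner bit_flip_bit_iff)
  then show "drop_bit (l - 1) (idx (partner l a)) \<noteq> drop_bit (l - 1) (idx a)" by metis
  show "drop_bit l (idx (partner l a)) = drop_bit l (idx a)"
    using assms by (intro bit_eqI) (auto simp: bit_drop_bit_eq idx_partner bit_flip_bit_iff)
qed

text \<open>Adding a power of two at a clear bit produces no carry, so the stride is a bit
  flip.\<close>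

lemma mode_add:
  assumes "1 \<le> l" and "l \<le> K" and "i < 2 ^ K" and "\<not> bit i (l - 1)"
  shows "mode (i + 2 ^ (l - 1)) = partner l (mode i)"
  using assms by (simp add: partner_def flip_bit_eq_if set_bit_eq)

lemma rbs_layer_eq:
  assumes "1 \<le> l" and "l \<le> K"
  shows "rbs_layer K mode l = map (\<lambda>i. RBS (Theta l i) (mode i) (partner l (mode i)))
    (filter (\<lambda>i. \<not> bit i (l - 1)) [0..<2 ^ K])"
  unfolding rbs_layer_def using mode_add[OF assms] by (intro map_cong) auto

lemma parallel_rz_layer: "parallel_layer (rz_layer K mode l)"
proof -
  have "sorted_wrt (\<lambda>g h. support g \<inter> support h = {}) (rz_layer K mode l)"
    unfolding rz_layer_def sorted_wrt_map
    by (rule sorted_wrt_mono_rel[OF _ sorted_wrt_upt]) (simp add: mode_eq_iff)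
  then show ?thesis by (auto simp: parallel_layer_def rz_layer_def)
qed

lemma parallel_rbs_layer:
  assumes "1 \<le> l" and "l \<le> K"
  shows "parallel_layer (rbs_layer K mode l)"
proof -
  interpret pairing "partner l" by (rule pairing_partner[OF assms])
  have "{mode i, partner l (mode i)} \<inter> {mode j, partner l (mode j)} = {}"
    if "i < 2 ^ K" "j < 2 ^ K" "\<not> bit i (l - 1)" "\<not> bit j (l - 1)" "i < j" for i j
  proof -
    have "low l (mode i)" "low l (mode j)" using that by (simp_all add: low_def)
    then have "mode i \<noteq> partner l (mode j)" "partner l (mode i) \<noteq> mode j"
      using low_partner[OF assms] by metis+
    moreover have "mode i \<noteq> mode j" using that by (simp add: mode_eq_iff)
    moreover have "partner l (mode i) \<noteq> partner l (mode j)" using \<open>mode i \<noteq> mode j\<close> inv by metis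
    ultimately show ?thesis by simp
  qed
  then have "sorted_wrt (\<lambda>g h. support g \<inter> support h = {}) (rbs_layer K mode l)"
    unfolding rbs_layer_eq[OF assms] sorted_wrt_map
    by (intro sorted_wrt_mono_rel[OF _ sorted_wrt_filter[OF sorted_wrt_upt]]) auto
  then show ?thesis by (auto simp: parallel_layer_def rbs_layer_eq[OF assms])
qed

lemma gates_op_rz_layer: "gates_op v (rz_layer K mode l) = diag_mat (\<lambda>a. cis (- v (Phi l (idx a))))"
proof -
  have "gates_op v (rz_layer K mode l) $ a $ b = gate_op (Rz (Phi l (idx a)) a) (v (Phi l (idx a))) $ a $ b" for a b
  proof -
    have "Rz (Phi l (idx a)) a \<in> set (rz_layer K mode l)"
      using idx_less[of a] by (auto simp: rz_layer_def intro!: image_eqI[of _ _ "idx a"])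
    from gates_op_row[OF _ this, of a v b] parallel_rz_layer[of l] show ?thesis
      by (simp add: parallel_layer_def)
  qed
  then show ?thesis by (simp add: vec_eq_iff diag_mat_nth)
qed

text \<open>Both modes of a pair must read the same angle, which is stored under the lower
  one.\<close>

definition low_idx :: "nat \<Rightarrow> 'n \<Rightarrow> nat" where
  "low_idx l a = (if low l a then idx a else idx (partner l a))"

lemma gates_op_rbs_layer:
  assumes "1 \<le> l" and "l \<le> K"
  shows "gates_op v (rbs_layer K mode l) $ a $ b =
    (if a = b then of_real (cos (v (Theta l (low_idx l a))))
     else if a = partner l b then (if low l a then - of_real (sin (v (Theta l (low_idx l a))))
       else of_real (sin (v (Theta l (low_idx l a))))) else 0)"
proof -
  interpret pairing "partner l" by (rule pairing_partner[OF assms])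
  define c where "c = (if low l a then a else partner l a)"
  have c: "low l c" "low_idx l a = idx c" "a \<in> {c, partner l c}"
    using low_partner[OF assms] by (auto simp: c_def low_idx_def)
  have mem: "RBS (Theta l (idx c)) c (partner l c) \<in> set (rbs_layer K mode l)"
    using idx_less[of c] c(1) unfolding rbs_layer_eq[OF assms]
    by (auto simp: low_def intro!: image_eqI[of _ _ "idx c"])
  have "gates_op v (rbs_layer K mode l) $ a $ b = gate_op (RBS (Theta l (idx c)) c (partner l c)) (v (Theta l (idx c))) $ a $ b"
    using gates_op_row[OF _ mem, of a v b] parallel_rbs_layer[OF assms] c(3)
    by (simp add: parallel_layer_def)
  also have "\<dots> = (if a = b then of_real (cos (v (Theta l (idx c))))
     else if b = partner l a then (if low l a then - of_real (sin (v (Theta l (idx c))))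
       else of_real (sin (v (Theta l (idx c))))) else 0)"
  proof (cases "low l a")
    case True
    then have "c = a" by (simp add: c_def)
    then show ?thesis using True by auto
  next
    case False
    then have "c = partner l a" by (simp add: c_def)
    then show ?thesis using False by auto
  qed
  finally show ?thesis
    unfolding c(2) eq_iff[of a b] .
qed

end

section \<open>The butterfly set as an embedded submanifold\<close>

context pairing
begin

text \<open>One real number per mode suffices: the low mode stores the real part and the high mode
  the imaginary part of the free entry of the pair.\<close>

lemma dim_pair_skew:
  assumes low: "\<And>i. low (\<sigma> i) \<longleftrightarrow> \<not> low i"
  shows "dim pair_skew \<le> CARD('n)"
proof -
  define F :: "real^'n \<Rightarrow> complex^'n^'n" where
    "F v = (\<chi> i j. if i = \<sigma> j then Complex (if low j then v $ j else - (v $ i)) (if low j then v $ i else v $ j) else 0)"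
    for v
  have F: "linear F"
    by (auto simp: F_def linear_iff vec_eq_iff complex_eq_iff)
  have "pair_skew \<subseteq> range F"
  proof
    fix A assume A: "A \<in> pair_skew"
    have nz: "A $ i $ j = 0" if "i \<noteq> \<sigma> j" for i j
      using A that by (simp add: pair_skew_def)
    have skew: "A $ i $ \<sigma> i = - cnj (A $ \<sigma> i $ i)" for i
      using A by (simp add: pair_skew_def)
    have "A $ i $ j = F (\<chi> i. if low i then Re (A $ \<sigma> i $ i) else Im (A $ i $ \<sigma> i)) $ i $ j" for i j
    proof (cases "i = \<sigma> j")
      case True
      then show ?thesis by (cases "low j") (simp_all add: F_def low complex_eq_iff skew[of j])
    qed (simp add: F_def nz)
    then have "A = F (\<chi> i. if low i then Re (A $ \<sigma> i $ i) else Im (A $ i $ \<sigma> i))"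
      by (simp add: vec_eq_iff)
    then show "A \<in> range F" by (rule range_eqI)
  qed
  then have "dim pair_skew \<le> dim (range F)" by (rule dim_subset)
  also have "\<dots> \<le> CARD('n)" using dim_image_le[OF F, of UNIV] by simp
  finally show ?thesis .
qed

text \<open>Only the real part of the free entry is left, so each pair contributes one spanning
  matrix, indexed by its low mode.\<close>

lemma dim_pair_real_skew:
  assumes low: "\<And>i. low (\<sigma> i) \<longleftrightarrow> \<not> low i"
  shows "dim pair_real_skew \<le> card {i. low i}"
proof -
  define B :: "'n \<Rightarrow> complex^'n^'n" where
    "B a = (\<chi> i j. if i = \<sigma> j then if a = (if low j then j else \<sigma> j) then if low j then 1 else - 1 else 0 else 0)" for a
  have "pair_real_skew \<subseteq> span (B ` {i. low i})"
  proof
    fix A assume A: "A \<in> pair_real_skew"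
    have nz: "A $ i $ j = 0" if "i \<noteq> \<sigma> j" for i j
      using A that by (simp add: pair_real_skew_def pair_skew_def)
    have re: "A $ i $ j = of_real (Re (A $ i $ j))" for i j
      using A by (simp add: pair_real_skew_def complex_eq_iff)
    have skew: "A $ i $ \<sigma> i = - A $ \<sigma> i $ i" for i
      using A by (simp add: pair_real_skew_def pair_skew_def complex_eq_iff)
    have "(\<Sum>a\<in>{i. low i}. Re (A $ \<sigma> a $ a) *\<^sub>R B a) $ i $ j = A $ i $ j" for i j
    proof (cases "i = \<sigma> j")
      case True
      let ?c = "if low j then j else \<sigma> j"
      have "(\<Sum>a\<in>{i. low i}. Re (A $ \<sigma> a $ a) *\<^sub>R B a) $ i $ j
          = (\<Sum>a\<in>{i. low i}. if a = ?c then of_real (Re (A $ \<sigma> a $ a)) * (if low j then 1 else - 1) else 0)"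
        unfolding sum_component using True by (intro sum.cong) (auto simp: B_def complex_eq_iff)
      also have "\<dots> = A $ \<sigma> ?c $ ?c * (if low j then 1 else - 1)"
        by (simp add: low re[symmetric])
      also have "\<dots> = A $ i $ j"
        using True skew[of j] by simp
      finally show ?thesis .
    next
      case False
      then show ?thesis by (simp add: sum_component B_def nz)
    qed
    then have "A = (\<Sum>a\<in>{i. low i}. Re (A $ \<sigma> a $ a) *\<^sub>R B a)" by (simp add: vec_eq_iff)
    also have "\<dots> \<in> span (B ` {i. low i})"
      by (intro span_sum span_scale span_base) auto
    finally show "A \<in> span (B ` {i. low i})" .
  qed
  then have "dim pair_real_skew \<le> card (B ` {i. low i})" by (rule dim_le_card) simp
  also have "\<dots> \<le> card {i. low i}" by (rule card_image_le) simp
  finally show ?thesis .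
qed

lemma card_low:
  assumes low: "\<And>i. low (\<sigma> i) \<longleftrightarrow> \<not> low i"
  shows "2 * card {i. low i} = CARD('n)"
proof -
  have "bij_betw \<sigma> {i. low i} {i. \<not> low i}"
    by (rule bij_betwI[where g = \<sigma>]) (auto simp: low)
  then have "card {i. low i} = card {i. \<not> low i}" by (rule bij_betw_same_card)
  moreover have "card {i. low i} + card {i. \<not> low i} = card ({i. low i} \<union> {i. \<not> low i})"
    by (intro card_Un_disjoint[symmetric]) auto
  moreover have "{i. low i} \<union> {i. \<not> low i} = UNIV" by auto
  ultimately show ?thesis by simp
qed

end

lemma exists_cis: "cmod z = 1 \<Longrightarrow> \<exists>t. z = cis t"
  by (rule exI[of _ "Arg z"]) (subst cis_Arg, auto simp: sgn_eq)

section \<open>The ranges of single layers and the factorization of the butterfly set\<close>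

context butterfly_modes
begin

lemma range_rz_layer: "range (\<lambda>v. circuit_op v [rz_layer K mode l]) = diag_unitaries"
proof
  show "range (\<lambda>v. circuit_op v [rz_layer K mode l]) \<subseteq> diag_unitaries"
    by (auto simp: circuit_op_eq_gates_op gates_op_rz_layer intro!: diag_unitariesI)
  show "diag_unitaries \<subseteq> range (\<lambda>v. circuit_op v [rz_layer K mode l])"
  proof
    fix D :: "complex^'n^'n" assume "D \<in> diag_unitaries"
    then obtain d where D: "D = diag_mat d" and "\<forall>a. cmod (d a) = 1"
      by (auto simp: diag_unitaries_def)
    then have "\<exists>t. \<forall>a. d a = cis (t a)" by (intro choice allI exists_cis) simp
    then obtain t where t: "\<And>a. d a = cis (t a)" by blast
    define v where "v p = (case p of Phi _ i \<Rightarrow> - t (mode i) | Theta _ _ \<Rightarrow> 0)" for p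
    have "D = circuit_op v [rz_layer K mode l]"
      unfolding circuit_op_eq_gates_op D by (simp add: gates_op_rz_layer v_def vec_eq_iff diag_mat_nth t)
    then show "D \<in> range (\<lambda>v. circuit_op v [rz_layer K mode l])" by blast
  qed
qed

lemma range_rbs_layer:
  assumes l: "1 \<le> l" "l \<le> K"
  shows "range (\<lambda>v. circuit_op v [rbs_layer K mode l]) = pairing.pair_rotations (partner l)"
proof
  interpret pairing "partner l" by (rule pairing_partner[OF l])
  have low_idx: "low_idx l (partner l a) = low_idx l a" for a
    by (simp add: low_idx_def low_partner[OF l])
  note entry = gates_op_rbs_layer[OF l]
  show "range (\<lambda>v. circuit_op v [rbs_layer K mode l]) \<subseteq> pair_rotations"
  proof
    fix R assume "R \<in> range (\<lambda>v. circuit_op v [rbs_layer K mode l])"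
    then obtain v where R: "R = gates_op v (rbs_layer K mode l)"
      by (auto simp: circuit_op_eq_gates_op)
    have sc: "complex_of_real (cos t) * of_real (cos t) + of_real (sin t) * of_real (sin t) = 1" for t
    proof -
      have "complex_of_real (cos t * cos t + sin t * sin t) = 1" by (simp flip: power2_eq_square)
      then show ?thesis by (simp only: of_real_mult of_real_add)
    qed
    have "R \<in> pair_unitaries"
      by (rule pair_unitariesI)
        (simp_all add: R pair_supported_def entry low_idx low_partner[OF l] sc)
    then show "R \<in> pair_rotations"
      by (simp add: pair_rotations_def R entry low_idx low_partner[OF l])
  qed
  show "pair_rotations \<subseteq> range (\<lambda>v. circuit_op v [rbs_layer K mode l])"
  proof
    fix U assume U: "U \<in> pair_rotations"
    then have re: "U $ a $ b = of_real (Re (U $ a $ b))"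
      and rot: "U $ partner l a $ partner l a = U $ a $ a" "U $ a $ partner l a = - U $ partner l a $ a" for a b
      by (simp_all add: pair_rotations_def complex_eq_iff)
    have ex: "\<exists>t. Re (U $ a $ a) = cos t \<and> Re (U $ partner l a $ a) = sin t" for a
    proof -
      have "U \<in> pair_unitaries" using U by (simp add: pair_rotations_def)
      from pair_unitaries_eqs(2)[OF this, of a]
      have "complex_of_real ((cmod (U $ a $ a))\<^sup>2 + (cmod (U $ partner l a $ a))\<^sup>2) = 1"
        by (simp add: cnj_mult_norm)
      moreover have "cmod (U $ i $ j) = \<bar>Re (U $ i $ j)\<bar>" for i j
        by (subst re) simp
      ultimately have "(Re (U $ a $ a))\<^sup>2 + (Re (U $ partner l a $ a))\<^sup>2 = 1"
        by (simp only: of_real_eq_1_iff power2_abs)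
      then show ?thesis by (blast dest: sincos_total_2pi_le)
    qed
    have "\<exists>t. \<forall>a. Re (U $ a $ a) = cos (t a) \<and> Re (U $ partner l a $ a) = sin (t a)"
      by (intro choice allI ex)
    then obtain t where t': "\<And>a. Re (U $ a $ a) = cos (t a)" "\<And>a. Re (U $ partner l a $ a) = sin (t a)"
      by blast
    have t: "U $ a $ a = of_real (cos (t a))" "U $ partner l a $ a = of_real (sin (t a))" for a
      using re[of a a] re[of "partner l a" a] unfolding t' .
    define v where "v p = (case p of Theta _ i \<Rightarrow> t (mode i) | Phi _ _ \<Rightarrow> 0)" for p
    have supp: "U $ a $ b = 0" if "a \<noteq> b" "a \<noteq> partner l b" for a b
      using U that by (simp add: pair_rotations_def pair_unitaries_def pair_supported_def)
    have "gates_op v (rbs_layer K mode l) $ a $ b = U $ a $ b" for a b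
    proof -
      have low_mode: "mode (low_idx l c) = (if low l c then c else partner l c)" for c
        by (simp add: low_idx_def)
      consider "a = b" | "a \<noteq> b" "a = partner l b" | "a \<noteq> b" "a \<noteq> partner l b" by blast
      then show ?thesis
      proof cases
        case 1
        then show ?thesis
          unfolding entry v_def by (simp add: low_mode rot(1) flip: t(1))
      next
        case 2
        then have b: "b = partner l a" by simp
        show ?thesis
        proof (cases "low l a")
          case True
          then show ?thesis
            unfolding b entry v_def by (simp add: low_mode rot(2) flip: t(2))
        next
          case False
          then show ?thesis
            unfolding b entry v_def using t(2)[of "partner l a"] by (simp add: low_mode)
        qed
      next
        case 3
        then show ?thesis unfolding entry by (simp add: supp)
      qed
    qed
    then have "U = circuit_op v [rbs_layer K mode l]"
      by (simp add: vec_eq_iff circuit_op_eq_gates_op)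
    then show "U \<in> range (\<lambda>v. circuit_op v [rbs_layer K mode l])" by blast
  qed
qed

definition layers_upto :: "nat \<Rightarrow> 'n circuit" where
  "layers_upto k = concat (map (\<lambda>l. [rz_layer K mode l, rbs_layer K mode l]) [1..<Suc k])"

lemma layers_upto_0 [simp]: "layers_upto 0 = []"
  by (simp add: layers_upto_def)

lemma layers_upto_Suc: "layers_upto (Suc k) = (layers_upto k @ [rz_layer K mode (Suc k)]) @ [rbs_layer K mode (Suc k)]"
  by (simp add: layers_upto_def)

lemma butterfly_eq_layers_upto: "butterfly K mode = layers_upto K"
  by (simp add: butterfly_def layers_upto_def)

lemma circuit_params_append: "circuit_params (C @ D) = circuit_params C \<union> circuit_params D"
  by (simp add: circuit_params_def image_Un)

lemma circuit_params_rz: "circuit_params [rz_layer K mode l] = Phi l ` {..<2 ^ K}"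
  unfolding circuit_params_def rz_layer_def by (auto simp: image_iff)

lemma circuit_params_rbs: "circuit_params [rbs_layer K mode l] = Theta l ` {i. i < 2 ^ K \<and> \<not> bit i (l - 1)}"
  unfolding circuit_params_def rbs_layer_def by (auto simp: image_iff)

lemma circuit_params_layers_upto:
  "circuit_params (layers_upto k) = (\<Union>l\<in>{1..k}. Phi l ` {..<2 ^ K} \<union> Theta l ` {i. i < 2 ^ K \<and> \<not> bit i (l - 1)})"
proof (induction k)
  case 0
  then show ?case by (simp add: circuit_params_def)
next
  case (Suc k)
  have "{1..Suc k} = insert (Suc k) {1..k}" by auto
  then show ?case
    unfolding layers_upto_Suc circuit_params_append Suc circuit_params_rz circuit_params_rbs by auto
qed

text \<open>The sets \<open>F\<close> of the overview. The torus in front is the phase layer of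
  stage k + 1, taken in early so that the set is invariant under the torus from the left.\<close>

definition prefix_set :: "nat \<Rightarrow> (complex^'n^'n) set" where
  "prefix_set k = product_set diag_unitaries (range (\<lambda>v. circuit_op v (layers_upto k)))"

lemma product_set_diag: "product_set diag_unitaries (diag_unitaries :: (complex^'n^'n) set) = diag_unitaries"
proof
  show "product_set diag_unitaries (diag_unitaries :: (complex^'n^'n) set) \<subseteq> diag_unitaries"
    by (auto elim!: product_setE intro: diag_unitaries_mult)
  show "(diag_unitaries :: (complex^'n^'n) set) \<subseteq> product_set diag_unitaries diag_unitaries"
  proof
    fix D :: "complex^'n^'n" assume "D \<in> diag_unitaries"
    then have "mat 1 ** D \<in> product_set diag_unitaries diag_unitaries"
      by (intro product_setI mat_1_diag_unitaries)
    then show "D \<in> product_set diag_unitaries diag_unitaries" by simp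
  qed
qed

lemma diag_prefix_set: "product_set diag_unitaries (prefix_set k) = prefix_set k"
  by (simp add: prefix_set_def product_set_assoc[symmetric] product_set_diag)

lemma range_layers_upto_Suc:
  assumes "Suc k \<le> K"
  shows "range (\<lambda>v. circuit_op v (layers_upto (Suc k))) =
    product_set (pairing.pair_rotations (partner (Suc k))) (prefix_set k)"
proof -
  have "circuit_params (layers_upto k @ [rz_layer K mode (Suc k)]) \<inter> circuit_params [rbs_layer K mode (Suc k)] = {}"
    "circuit_params (layers_upto k) \<inter> circuit_params [rz_layer K mode (Suc k)] = {}"
    unfolding circuit_params_append circuit_params_layers_upto circuit_params_rz circuit_params_rbs by auto
  then show ?thesis
    using assms by (simp add: layers_upto_Suc range_circuit_op_append range_rz_layer range_rbs_layer prefix_set_def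
        del: append_assoc)
qed

lemma butterfly_set_eq:
  assumes "1 \<le> K"
  shows "butterfly_set K mode = product_set (pairing.pair_rotations (partner K)) (prefix_set (K - 1))"
  using range_layers_upto_Suc[of "K - 1"] assms by (simp add: butterfly_set_def butterfly_eq_layers_upto)

lemma prefix_set_0: "prefix_set 0 = diag_unitaries"
proof -
  have "range (\<lambda>v. circuit_op v (layers_upto 0)) = {mat 1 :: complex^'n^'n}"
    by (auto simp: circuit_op_eq_gates_op)
  moreover have "product_set N {mat 1} = N" for N :: "(complex^'n^'n) set"
    by (simp add: product_set_def image_def)
  ultimately show ?thesis by (simp add: prefix_set_def)
qed

lemma prefix_set_Suc:
  assumes "Suc k \<le> K"
  shows "prefix_set (Suc k) = product_set (pairing.pair_unitaries (partner (Suc k))) (prefix_set k)"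
  unfolding prefix_set_def[of "Suc k"] range_layers_upto_Suc[OF assms]
  by (rule pairing.product_set_pair_unitaries[where low = "low (Suc k)"])
    (use assms in \<open>simp_all add: pairing_partner low_partner diag_prefix_set\<close>)

section \<open>Block structure and charts of the partial products\<close>

abbreviation blk :: "nat \<Rightarrow> 'n \<Rightarrow> nat" where
  "blk k a \<equiv> drop_bit k (idx a)"

lemma block_matrices_mono: "block_matrices (blk k) \<subseteq> block_matrices (blk (Suc k))"
proof -
  have step: "drop_bit (Suc k) m = drop_bit 1 (drop_bit k m)" for m :: nat by (simp add: drop_bit_drop_bit)
  have "blk k i \<noteq> blk k j" if "blk (Suc k) i \<noteq> blk (Suc k) j" for i j
    using that unfolding step by metis
  then show ?thesis by (simp add: block_matrices_def subset_iff)
qed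

lemma prefix_set_subset:
  assumes "k \<le> K"
  shows "prefix_set k \<subseteq> unitaries" and "prefix_set k \<subseteq> block_matrices (blk k)"
proof -
  have "prefix_set k \<subseteq> unitaries \<inter> block_matrices (blk k)"
    using assms
  proof (induction k)
    case 0
    have "diag_unitaries \<subseteq> block_matrices (blk 0)"
      by (auto simp: block_matrices_def diag_unitaries_def diag_mat_nth)
    then show ?case using diag_unitaries_subset by (simp add: prefix_set_0)
  next
    case (Suc k)
    then have k: "1 \<le> Suc k" "Suc k \<le> K" by auto
    interpret pairing "partner (Suc k)" by (rule pairing_partner[OF k])
    show ?case
    proof
      fix m assume "m \<in> prefix_set (Suc k)"
      then obtain h n where h: "h \<in> pair_unitaries" and n: "n \<in> prefix_set k" and m: "m = h ** n"
        unfolding prefix_set_Suc[OF k(2)] by (elim product_setE)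
      have n': "n \<in> unitaries" "n \<in> block_matrices (blk (Suc k))"
        using n Suc k block_matrices_mono[of k] by auto
      have h': "h \<in> unitaries" "pair_supported h" using h by (simp_all add: pair_unitaries_def)
      have "m $ i $ j = 0" if "blk (Suc k) i \<noteq> blk (Suc k) j" for i j
        using that n'(2) block_partner(2)[OF k, of i]
        by (simp add: m mult_left_nth[OF h'(2)] block_matrices_def)
      then show "m \<in> unitaries \<inter> block_matrices (blk (Suc k))"
        using unitaries_mult[OF h'(1) n'(1)] by (simp add: m block_matrices_def)
    qed
  qed
  then show "prefix_set k \<subseteq> unitaries" "prefix_set k \<subseteq> block_matrices (blk k)" by auto
qed

text \<open>The inclusion of \<open>L\<close> in the block matrices belongs to the induction: it
  lets the next stage separate the old coordinates from its own, which lie outside the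
  blocks.\<close>

lemma chartable_prefix_set:
  assumes "k \<le> K"
  shows "\<exists>L. chartable L (prefix_set k) \<and> L \<subseteq> block_matrices (blk k) \<and> dim L \<le> Suc k * CARD('n)"
  using assms
proof (induction k)
  case 0
  have "imaginary_diagonals \<subseteq> block_matrices (blk 0)"
    by (auto simp: block_matrices_def imaginary_diagonals_def diag_mat_nth)
  then show ?case
    using chartable_diag_unitaries dim_imaginary_diagonals by (auto simp: prefix_set_0)
next
  case (Suc k)
  then have k: "1 \<le> Suc k" "Suc k \<le> K" by auto
  interpret pairing "partner (Suc k)" by (rule pairing_partner[OF k])
  obtain L where L: "chartable L (prefix_set k)" "L \<subseteq> block_matrices (blk k)" "dim L \<le> Suc k * CARD('n)"
    using Suc by auto
  let ?L = "{x + y | x y. x \<in> pair_skew \<and> y \<in> L}"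
  have "chartable ?L (product_set pair_unitaries (prefix_set k))"
  proof (rule chartable_product_set[where blk = "blk k"])
    show "blk k (partner (Suc k) i) \<noteq> blk k i" for i using block_partner(1)[OF k, of i] by simp
    show "g ** pair_section x \<in> pair_unitaries" if "g \<in> pair_unitaries" "x \<in> pair_skew" for g x
      using that by (intro pair_unitaries_mult pair_section_mem)
  qed (use k L prefix_set_subset[of k] diag_prefix_set[of k] in
      \<open>simp_all add: pair_unitaries_mult pair_unitaries_adj subspace_pair_skew pair_quotient_mem\<close>)
  moreover have "?L \<subseteq> block_matrices (blk (Suc k))"
  proof
    fix z assume "z \<in> ?L"
    then obtain x y where z: "z = x + y" and x: "x \<in> pair_skew" and y: "y \<in> block_matrices (blk (Suc k))"
      using L(2) block_matrices_mono[of k] by blast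
    have "x $ i $ j = 0" if "blk (Suc k) i \<noteq> blk (Suc k) j" for i j
    proof -
      have "i \<noteq> partner (Suc k) j" using that block_partner(2)[OF k, of j] by auto
      then show ?thesis using x by (simp add: pair_skew_def)
    qed
    with y show "z \<in> block_matrices (blk (Suc k))" by (simp add: z block_matrices_def)
  qed
  moreover have "dim ?L \<le> Suc (Suc k) * CARD('n)"
  proof -
    have "subspace L" using L(1) by (simp add: chartable_def)
    then have "dim ?L \<le> dim pair_skew + dim L" by (intro dim_sums_le subspace_pair_skew)
    also have "\<dots> \<le> CARD('n) + Suc k * CARD('n)"
      using L(3) dim_pair_skew[of "low (Suc k)"] low_partner[OF k] by (intro add_mono) auto
    finally show ?thesis by simp
  qed
  ultimately show ?case unfolding prefix_set_Suc[OF k(2)] by blast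
qed

lemma embedded_submanifold_butterfly_set:
  assumes K: "1 \<le> K"
  shows "\<exists>d. embedded_submanifold d (butterfly_set K mode) \<and> 2 * d \<le> (2 * K + 1) * CARD('n)"
proof -
  have k: "1 \<le> K" "K \<le> K" using K by auto
  interpret pairing "partner K" by (rule pairing_partner[OF k])
  obtain L where L: "chartable L (prefix_set (K - 1))" "L \<subseteq> block_matrices (blk (K - 1))"
    "dim L \<le> Suc (K - 1) * CARD('n)"
    using chartable_prefix_set[of "K - 1"] by auto
  let ?L = "{x + y | x y. x \<in> pair_real_skew \<and> y \<in> L}"
  \<comment> \<open>The product lemma once more, with real rotations in place of all pair unitaries:
    no phase layer follows the last rotations.\<close>
  have "chartable ?L (product_set pair_rotations (prefix_set (K - 1)))"
  proof (rule chartable_product_set[where blk = "blk (K - 1)"])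
    show "blk (K - 1) (partner K i) \<noteq> blk (K - 1) i" for i using block_partner(1)[OF k, of i] by simp
    show "g ** pair_section x \<in> pair_rotations" if "g \<in> pair_rotations" "x \<in> pair_real_skew" for g x
      using that by (intro pair_rotations_mult pair_section_real_mem)
    show "pair_rotations \<subseteq> pair_unitaries" "pair_real_skew \<subseteq> pair_skew"
      by (auto simp: pair_rotations_def pair_real_skew_def)
  qed (use L prefix_set_subset[of "K - 1"] diag_prefix_set[of "K - 1"] in
      \<open>simp_all add: pair_rotations_mult pair_rotations_adj subspace_pair_real_skew pair_quotient_real_mem\<close>)
  then have "embedded_submanifold (dim ?L) (butterfly_set K mode)"
    unfolding butterfly_set_eq[OF K] by (rule chartable_imp_embedded_submanifold)
  moreover have "2 * dim ?L \<le> (2 * K + 1) * CARD('n)"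
  proof -
    have "subspace L" using L(1) by (simp add: chartable_def)
    then have "dim ?L \<le> dim pair_real_skew + dim L" by (intro dim_sums_le subspace_pair_real_skew)
    moreover have "2 * dim pair_real_skew \<le> CARD('n)"
      using dim_pair_real_skew[of "low K"] card_low[of "low K"] low_partner[OF k] by simp
    moreover have "dim L \<le> K * CARD('n)" using L(3) K by simp
    ultimately show ?thesis by (simp add: algebra_simps)
  qed
  ultimately show ?thesis by blast
qed

end

section \<open>Compactness, non-density and counting\<close>

text \<open>Gates are periodic with period 2 pi in their angle, so the range is the image of the
  cube of all angles in [0, 2 pi], which is compact by Tychonoff.\<close>

lemma compact_range_circuit_op:
  fixes C :: "'m::finite circuit"
  shows "compact (range (\<lambda>v. circuit_op v C))"
proof -
  define B :: "(param \<Rightarrow> real) set" where "B = (\<Pi>\<^sub>E p\<in>UNIV. {0..2 * pi})"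
  have "compactin (product_topology (\<lambda>_. euclidean) UNIV) B"
    unfolding B_def by (simp add: compactin_PiE)
  then have "compact B"
    by (simp add: euclidean_product_topology)
  have gate: "continuous_on UNIV (gate_op g)" for g :: "'m gate"
  proof -
    have split: "continuous_on UNIV (\<lambda>x. if P then f x else h x)"
      if "continuous_on UNIV f" "continuous_on UNIV h" for P and f h :: "real \<Rightarrow> complex"
      using that by (cases P) simp_all
    have "continuous_on UNIV (\<lambda>t. gate_op g t $ i $ j)" for i j
      by (cases g; cases "i = j") (auto intro!: continuous_intros split)
    then have "continuous_on UNIV (\<lambda>t. \<chi> i. \<chi> j. gate_op g t $ i $ j)"
      by (intro continuous_on_vec_lambda)
    then show ?thesis by simp
  qed
  have "continuous_on UNIV (\<lambda>v. gates_op v gs)" for gs :: "'m gate list"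
  proof (induction gs)
    case (Cons g gs)
    have "continuous_on UNIV (\<lambda>v. gate_op g (v (angle g)))"
      by (rule continuous_on_compose2[OF gate continuous_on_product_coordinates]) simp
    with Cons show ?case
      unfolding gates_op_Cons by (intro bounded_bilinear.continuous_on[OF bounded_bilinear_matrix_mult])
  qed (simp add: continuous_on_const)
  then have "compact ((\<lambda>v. circuit_op v C) ` B)"
    unfolding circuit_op_eq_gates_op
    by (intro compact_continuous_image \<open>compact B\<close>) (auto intro: continuous_on_subset)
  moreover have "(\<lambda>v. circuit_op v C) ` B = range (\<lambda>v. circuit_op v C)"
  proof (intro equalityI subsetI)
    fix M assume "M \<in> range (\<lambda>v. circuit_op v C)"
    then obtain v where M: "M = circuit_op v C" by blast
    have "\<exists>w. \<forall>p. 0 \<le> w p \<and> w p \<le> 2 * pi \<and> cos (v p) = cos (w p) \<and> sin (v p) = sin (w p)"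
      by (intro choice allI sincos_total_2pi_le) simp
    then obtain w where w: "\<And>p. 0 \<le> w p" "\<And>p. w p \<le> 2 * pi"
      "\<And>p. cos (v p) = cos (w p)" "\<And>p. sin (v p) = sin (w p)" by blast
    have "gate_op g (v p) = gate_op g (w p)" for g :: "'m gate" and p
      by (cases g) (auto simp: vec_eq_iff complex_eq_iff w(3,4))
    then have "gates_op v gs = gates_op w gs" for gs :: "'m gate list"
      by (induction gs) (simp_all add: gates_op_Cons)
    then have "M = circuit_op w C" by (simp add: M circuit_op_eq_gates_op)
    moreover have "w \<in> B" by (simp add: B_def w(1,2) PiE_UNIV_domain)
    ultimately show "M \<in> (\<lambda>v. circuit_op v C) ` B" by blast
  qed blast
  ultimately show ?thesis by simp
qed

context butterfly_modes
begin

lemma card_UNIV_modes: "CARD('n) = 2 ^ K"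
  using bij_betw_same_card[OF bij_mode] by simp

text \<open>
  In \<open>R ** n\<close> with \<open>R\<close> a real rotation of pairs and \<open>n\<close> block diagonal, paired entries of a column
  are real multiples of one entry of \<open>n\<close>.
\<close>

lemma butterfly_set_neq_unitaries:
  assumes K: "1 \<le> K" shows "\<exists>W\<in>unitaries. W \<notin> butterfly_set K mode"
proof -
  have k: "1 \<le> K" "K \<le> K" using K by auto
  interpret pairing "partner K" by (rule pairing_partner[OF k])
  \<comment> \<open>3/5 and 4/5 give a unit column with rational entries; the factor i makes the
    ratio of the paired entries non-real.\<close>
  define W :: "complex^'n^'n" where
    "W = (\<chi> i j. if i = j then 3 / 5 else if i = partner K j then \<i> * (4 / 5) else 0)"
  have "W \<in> pair_unitaries"
    by (rule pair_unitariesI) (simp_all add: W_def pair_supported_def)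
  moreover have "W \<notin> butterfly_set K mode"
  proof
    assume "W \<in> butterfly_set K mode"
    then obtain R n where R: "R \<in> pair_rotations" and n: "n \<in> prefix_set (K - 1)" and W: "W = R ** n"
      unfolding butterfly_set_eq[OF K] by (elim product_setE)
    define a b where "a = mode 0" and "b = partner K a"
    have [simp]: "partner K b = a" "a \<noteq> b" "b \<noteq> a" by (simp_all add: b_def)
    have R': "pair_supported R" "\<And>i j. Im (R $ i $ j) = 0"
      using R by (simp_all add: pair_rotations_def pair_unitaries_def)
    have "n \<in> block_matrices (blk (K - 1))" using n prefix_set_subset(2)[of "K - 1"] by auto
    then have "n $ b $ a = 0"
      using block_partner(1)[OF k, of a] by (simp add: block_matrices_def b_def)
    then have "W $ a $ a = R $ a $ a * n $ a $ a" "W $ b $ a = R $ b $ a * n $ a $ a"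
      by (simp_all add: W mult_left_nth[OF R'(1)] flip: b_def)
    then have eqs: "R $ a $ a * n $ a $ a = 3 / 5" "R $ b $ a * n $ a $ a = \<i> * (4 / 5)"
      by (simp_all add: W_def b_def)
    then have "R $ b $ a * (R $ a $ a * n $ a $ a) = R $ b $ a * (3 / 5)"
      "R $ a $ a * (R $ b $ a * n $ a $ a) = R $ a $ a * (\<i> * (4 / 5))"
      by (simp_all only: eqs)
    then have "R $ b $ a * (3 / 5) = R $ a $ a * (\<i> * (4 / 5))"
      by (simp only: mult.left_commute)
    then have "Re (R $ a $ a) = 0"
      using R'(2) by (simp add: complex_eq_iff)
    then have "R $ a $ a = 0" using R'(2) by (simp add: complex_eq_iff)
    with eqs(1) show False by simp
  qed
  ultimately show ?thesis by (auto simp: pair_unitaries_def)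
qed

lemma butterfly_set_subset_unitaries:
  assumes K: "1 \<le> K" shows "butterfly_set K mode \<subseteq> unitaries"
proof -
  have k: "1 \<le> K" "K \<le> K" using K by auto
  interpret pairing "partner K" by (rule pairing_partner[OF k])
  show ?thesis
    unfolding butterfly_set_eq[OF K]
  proof
    fix M assume "M \<in> product_set pair_rotations (prefix_set (K - 1))"
    then show "M \<in> unitaries"
      using prefix_set_subset(1)[of "K - 1"]
      by (auto simp: pair_rotations_def pair_unitaries_def elim!: product_setE intro!: unitaries_mult)
  qed
qed

text \<open>A closed set equals its closure, so a single missing unitary excludes density.\<close>

lemma closure_butterfly_set:
  assumes K: "1 \<le> K"
  shows "top_of_set unitaries closure_of butterfly_set K mode \<noteq> unitaries"
proof -
  have "closed (butterfly_set K mode)"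
    unfolding butterfly_set_def by (rule compact_imp_closed[OF compact_range_circuit_op])
  then have "closedin (top_of_set unitaries) (butterfly_set K mode)"
    by (rule closed_subset[OF butterfly_set_subset_unitaries[OF K]])
  then have "top_of_set unitaries closure_of butterfly_set K mode = butterfly_set K mode"
    by (simp add: closure_of_eq)
  then show ?thesis using butterfly_set_neq_unitaries[OF K] by auto
qed

section \<open>Depth and number of parameters\<close>

lemma circuit_depth_butterfly: "circuit_depth (butterfly K mode) = 2 * K"
  by (simp add: circuit_depth_def butterfly_def length_concat o_def sum_list_triv)

lemma parallel_layer_butterfly: "gs \<in> set (butterfly K mode) \<Longrightarrow> parallel_layer gs"
  using parallel_rz_layer parallel_rbs_layer by (force simp: butterfly_def)

lemma card_low_indices:
  assumes l: "1 \<le> l" "l \<le> K" shows "2 * card {i. i < (2::nat) ^ K \<and> \<not> bit i (l - 1)} = 2 ^ K"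
proof -
  interpret pairing "partner l" by (rule pairing_partner[OF l])
  have "bij_betw mode {i. i < (2::nat) ^ K \<and> \<not> bit i (l - 1)} {a. low l a}"
    by (rule bij_betwI[where g = idx]) (auto simp: low_def idx_less)
  then have "card {i. i < (2::nat) ^ K \<and> \<not> bit i (l - 1)} = card {a. low l a}" by (rule bij_betw_same_card)
  then show ?thesis using card_low[of "low l"] low_partner[OF l] card_UNIV_modes by simp
qed

text \<open>Each layer owns n phases and n/2 rotation angles, and no two layers share one; doubling
  avoids division of naturals.\<close>

lemma card_circuit_params_butterfly: "2 * card (circuit_params (butterfly K mode)) = 3 * K * 2 ^ K"
proof -
  define A where "A l = Phi l ` {..<(2::nat) ^ K} \<union> Theta l ` {i. i < (2::nat) ^ K \<and> \<not> bit i (l - 1)}" for l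
  have card_A: "2 * card (A l) = 3 * 2 ^ K" if "l \<in> {1..K}" for l
  proof -
    have "card (A l) = card (Phi l ` {..<(2::nat) ^ K}) + card (Theta l ` {i. i < (2::nat) ^ K \<and> \<not> bit i (l - 1)})"
      unfolding A_def by (intro card_Un_disjoint) auto
    also have "\<dots> = 2 ^ K + card {i. i < (2::nat) ^ K \<and> \<not> bit i (l - 1)}"
      by (simp add: card_image inj_on_def)
    finally show ?thesis using card_low_indices[of l] that by simp
  qed
  have "card (\<Union>l\<in>{1..K}. A l) = (\<Sum>l\<in>{1..K}. card (A l))"
    by (intro card_UN_disjoint) (auto simp: A_def)
  then have "2 * card (\<Union>l\<in>{1..K}. A l) = (\<Sum>l\<in>{1..K}. 2 * card (A l))"
    by (simp add: sum_distrib_left)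
  also have "\<dots> = (\<Sum>l\<in>{1..K}. 3 * 2 ^ K)" by (intro sum.cong refl card_A)
  finally show ?thesis
    unfolding butterfly_eq_layers_upto circuit_params_layers_upto A_def[symmetric] by simp
qed

section \<open>Single layers as special butterflies\<close>

lemma mat_1_layers:
  "mat 1 \<in> range (\<lambda>v. circuit_op v (C :: 'n circuit))"
proof -
  have "gates_op (\<lambda>_. 0) gs = mat 1" for gs :: "'n gate list"
    by (induction gs) (simp_all add: gates_op_Cons gate_op_0)
  then show ?thesis
    by (intro image_eqI[where x = "\<lambda>_. 0"]) (simp_all add: circuit_op_eq_gates_op)
qed

lemma subset_product_set:
  "mat 1 \<in> G \<Longrightarrow> N \<subseteq> product_set G N" "mat 1 \<in> N \<Longrightarrow> G \<subseteq> product_set G N"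
proof -
  show "N \<subseteq> product_set G N" if "mat 1 \<in> G"
  proof
    fix n assume "n \<in> N"
    with that have "mat 1 ** n \<in> product_set G N" by (rule product_setI)
    then show "n \<in> product_set G N" by simp
  qed
  show "G \<subseteq> product_set G N" if "mat 1 \<in> N"
  proof
    fix g assume "g \<in> G"
    then have "g ** mat 1 \<in> product_set G N" using that by (rule product_setI)
    then show "g \<in> product_set G N" by simp
  qed
qed

text \<open>Every layer contains the identity, so switching off all the others isolates one phase or
  rotation layer.\<close>

lemma layers_subset:
  assumes "1 \<le> l" "l \<le> k" "k \<le> K"
  shows "diag_unitaries \<union> pairing.pair_rotations (partner l) \<subseteq> range (\<lambda>v. circuit_op v (layers_upto k))"
  using assms
proof (induction k)
  case (Suc k)
  note eq = range_layers_upto_Suc[OF Suc.prems(3)]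
  have one: "mat 1 \<in> pairing.pair_rotations (partner (Suc k))"
    unfolding range_rbs_layer[OF _ Suc.prems(3), symmetric, simplified] by (rule mat_1_layers)
  have one': "mat 1 \<in> prefix_set k"
    unfolding prefix_set_def by (rule subsetD[OF subset_product_set(1)[OF mat_1_diag_unitaries] mat_1_layers])
  have up: "prefix_set k \<subseteq> range (\<lambda>v. circuit_op v (layers_upto (Suc k)))"
    unfolding eq by (rule subset_product_set(1)[OF one])
  have diag: "diag_unitaries \<subseteq> prefix_set k"
    unfolding prefix_set_def by (rule subset_product_set(2)[OF mat_1_layers])
  have prev: "range (\<lambda>v. circuit_op v (layers_upto k)) \<subseteq> prefix_set k"
    unfolding prefix_set_def by (rule subset_product_set(1)[OF mat_1_diag_unitaries])
  have rot: "pairing.pair_rotations (partner (Suc k)) \<subseteq> range (\<lambda>v. circuit_op v (layers_upto (Suc k)))"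
    unfolding eq by (rule subset_product_set(2)[OF one'])
  show ?case
  proof (cases "l = Suc k")
    case True
    then show ?thesis using rot order_trans[OF diag up] by simp
  next
    case False
    then have "pairing.pair_rotations (partner l) \<subseteq> range (\<lambda>v. circuit_op v (layers_upto k))"
      using Suc by simp
    then show ?thesis using order_trans[OF diag up] order_trans[OF prev up] by (meson Un_least order_trans)
  qed
qed simp

lemma butterfly_set_superset:
  assumes "1 \<le> l" "l \<le> K"
  shows "diag_unitaries \<subseteq> butterfly_set K mode"
    and "pairing.pair_rotations (partner l) \<subseteq> butterfly_set K mode"
  using layers_subset[OF assms order_refl] by (auto simp: butterfly_set_def butterfly_eq_layers_upto)

end

section \<open>Givens elimination\<close>

text \<open>The RBS matrix for an arbitrary pair of modes, including pairs that no layer of the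
  butterfly couples.\<close>

definition givens :: "'n::finite \<Rightarrow> 'n \<Rightarrow> real \<Rightarrow> complex^'n^'n" where
  "givens a b t = gate_op (RBS (Theta 0 0) a b) t"

lemma givens_mult_left:
  assumes "a \<noteq> b"
  shows "(givens a b t ** M) $ i $ j =
    (if i = a then of_real (cos t) * M $ a $ j - of_real (sin t) * M $ b $ j
     else if i = b then of_real (sin t) * M $ a $ j + of_real (cos t) * M $ b $ j else M $ i $ j)"
proof -
  let ?f = "\<lambda>k. givens a b t $ i $ k * M $ k $ j"
  have off: "?f k = 0" if "k \<noteq> i" "k \<noteq> a" "k \<noteq> b" for k
    using that by (auto simp: givens_def)
  show ?thesis
  proof (cases "i = a \<or> i = b")
    case True
    have "(givens a b t ** M) $ i $ j = (\<Sum>k\<in>{a, b}. ?f k)"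
      unfolding matrix_matrix_mult_def vec_lambda_beta using off True
      by (intro sum.mono_neutral_right) auto
    then show ?thesis using True assms by (auto simp: givens_def)
  next
    case False
    have "(givens a b t ** M) $ i $ j = (\<Sum>k\<in>{i}. ?f k)"
      unfolding matrix_matrix_mult_def vec_lambda_beta using False
      by (intro sum.mono_neutral_right) (auto simp: givens_def)
    then show ?thesis using False by (auto simp: givens_def)
  qed
qed

lemma givens_commute: "a \<noteq> b \<Longrightarrow> givens b a t = givens a b (- t)"
  by (auto simp: givens_def vec_eq_iff)

text \<open>A quarter turn in the (j, k) plane carries e_j to e_k and fixes e_i, so it carries
  rotations of the (i, j) plane to rotations of the (i, k) plane.\<close>

lemma givens_conj:
  assumes "i \<noteq> j" "j \<noteq> k" "i \<noteq> k"
  shows "givens j k (pi / 2) ** (givens i j t ** givens j k (- (pi / 2))) = givens i k t"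
proof -
  have "(givens j k (pi / 2) ** (givens i j t ** givens j k (- (pi / 2)))) $ x $ y = givens i k t $ x $ y" for x y
    unfolding givens_mult_left[OF assms(1)] givens_mult_left[OF assms(2)]
    using assms assms[symmetric] by (simp add: givens_def) auto
  then show ?thesis by (simp add: vec_eq_iff)
qed

lemma givens_pair_rotations:
  assumes "pairing \<sigma>" shows "givens a (\<sigma> a) t \<in> pairing.pair_rotations \<sigma>"
proof -
  interpret pairing \<sigma> by (rule assms)
  have sc: "complex_of_real (cos t) * of_real (cos t) + of_real (sin t) * of_real (sin t) = 1"
  proof -
    have "complex_of_real (cos t * cos t + sin t * sin t) = 1" by (simp flip: power2_eq_square)
    then show ?thesis by (simp only: of_real_mult of_real_add)
  qed
  have sig: "\<sigma> i = a \<longleftrightarrow> i = \<sigma> a" "\<sigma> i = \<sigma> a \<longleftrightarrow> i = a" for i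
    by (metis inv)+
  have "givens a (\<sigma> a) t \<in> pair_unitaries"
  proof (rule pair_unitariesI)
    show "pair_supported (givens a (\<sigma> a) t)" by (auto simp: pair_supported_def givens_def)
    fix i
    consider "i = a" | "i = \<sigma> a" | "i \<noteq> a" "i \<noteq> \<sigma> a" "\<sigma> i \<noteq> a" "\<sigma> i \<noteq> \<sigma> a"
      using sig by blast
    note cs = this
    show "cnj (givens a (\<sigma> a) t $ i $ i) * givens a (\<sigma> a) t $ i $ i +
        cnj (givens a (\<sigma> a) t $ \<sigma> i $ i) * givens a (\<sigma> a) t $ \<sigma> i $ i = 1"
      by (rule cs) (simp_all add: givens_def sc)
    show "cnj (givens a (\<sigma> a) t $ i $ i) * givens a (\<sigma> a) t $ i $ \<sigma> i +
        cnj (givens a (\<sigma> a) t $ \<sigma> i $ i) * givens a (\<sigma> a) t $ \<sigma> i $ \<sigma> i = 0"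
      by (rule cs) (simp_all add: givens_def)
  qed
  moreover have "Im (givens a (\<sigma> a) t $ i $ j) = 0" for i j
    by (simp add: givens_def)
  moreover have "givens a (\<sigma> a) t $ \<sigma> i $ \<sigma> i = givens a (\<sigma> a) t $ i $ i \<and>
      givens a (\<sigma> a) t $ i $ \<sigma> i = - givens a (\<sigma> a) t $ \<sigma> i $ i" for i
  proof -
    consider "i = a" | "i = \<sigma> a" | "i \<noteq> a" "i \<noteq> \<sigma> a" "\<sigma> i \<noteq> a" "\<sigma> i \<noteq> \<sigma> a"
      using sig by blast
    then show ?thesis by cases (simp_all add: givens_def)
  qed
  ultimately show ?thesis by (simp add: pair_rotations_def)
qed

lemma givens_unitary:
  assumes "a \<noteq> b" shows "givens a b t \<in> unitaries"
proof -
  have "adj (givens a b t) $ i $ j = givens a b (- t) $ i $ j" for i j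
    using assms by (cases "i = j"; cases "i = a"; cases "i = b"; cases "j = a"; cases "j = b")
      (simp_all add: givens_def)
  then have "adj (givens a b t) = givens a b (- t)" by (simp add: vec_eq_iff)
  moreover have "(givens a b (- t) ** givens a b t) $ i $ j = mat 1 $ i $ j" for i j
  proof -
    have "complex_of_real (cos t * cos t + sin t * sin t) = 1" by (simp flip: power2_eq_square)
    then have sc: "complex_of_real (cos t) * of_real (cos t) + of_real (sin t) * of_real (sin t) = 1"
      by (simp only: of_real_mult of_real_add)
    then have sc': "complex_of_real (sin t) * of_real (sin t) + of_real (cos t) * of_real (cos t) = 1"
      by (simp only: add.commute)
    show ?thesis
      unfolding givens_mult_left[OF assms] using assms assms[symmetric]
      by (cases "i = j"; cases "i = a"; cases "i = b"; cases "j = a"; cases "j = b")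
        (simp_all add: givens_def mat_def sc sc')
  qed
  then have "givens a b (- t) ** givens a b t = mat 1" by (simp add: vec_eq_iff)
  ultimately show ?thesis by (intro unitariesI) simp
qed

definition col_fixed :: "'n set \<Rightarrow> complex^'n::finite^'n \<Rightarrow> bool" where
  "col_fixed F M \<longleftrightarrow> (\<forall>a\<in>F. \<forall>x. M $ x $ a = (if x = a then 1 else 0))"

lemma exists_phase: "\<exists>d. cmod d = 1 \<and> d * z = of_real (cmod z)"
proof (cases "z = 0")
  case False
  have "cnj z / of_real (cmod z) * z = of_real (cmod z)"
    using False by (simp add: cnj_mult_norm power2_eq_square)
  moreover have "cmod (cnj z / of_real (cmod z)) = 1" using False by (simp add: norm_divide)
  ultimately show ?thesis by blast
qed (auto intro: exI[of _ 1])

text \<open>Closure is asked for products only, so the locale serves both the generated group and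
  the plain finite products of butterflies.\<close>

locale givens_closed =
  fixes S :: "(complex^'n::finite^'n) set"
  assumes mult: "A \<in> S \<Longrightarrow> B \<in> S \<Longrightarrow> A ** B \<in> S"
    and diag: "diag_unitaries \<subseteq> S"
    and rot: "a \<noteq> b \<Longrightarrow> givens a b t \<in> S"
begin

text \<open>Phases first make the two entries of column b real and nonnegative, then a rotation
  moves all weight to row b. The remaining conclusions ensure that columns already reduced
  survive.\<close>

lemma eliminate_entry:
  assumes "i \<noteq> b"
  shows "\<exists>g\<in>S \<inter> unitaries. (g ** M) $ i $ b = 0 \<and>
    (\<forall>x y. x \<noteq> i \<longrightarrow> x \<noteq> b \<longrightarrow> (g ** M) $ x $ y = M $ x $ y) \<and>
    (\<forall>y. M $ i $ y = 0 \<longrightarrow> M $ b $ y = 0 \<longrightarrow> (g ** M) $ i $ y = 0 \<and> (g ** M) $ b $ y = 0)"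
proof -
  obtain d1 d2 where d: "cmod d1 = 1" "d1 * M $ i $ b = of_real (cmod (M $ i $ b))"
    "cmod d2 = 1" "d2 * M $ b $ b = of_real (cmod (M $ b $ b))"
    using exists_phase by blast
  define r s where "r = cmod (M $ i $ b)" and "s = cmod (M $ b $ b)"
  \<comment> \<open>Unless both vanish, (s, r) divided by its length is (cos t, sin t); if both
    vanish, any angle works.\<close>
  have "\<exists>t. cos t * r - sin t * s = 0"
  proof (cases "r = 0 \<and> s = 0")
    case False
    define w where "w = sqrt (r\<^sup>2 + s\<^sup>2)"
    have w: "w \<noteq> 0" "w\<^sup>2 = r\<^sup>2 + s\<^sup>2" using False by (auto simp: w_def add_nonneg_eq_0_iff)
    have "(s / w)\<^sup>2 + (r / w)\<^sup>2 = 1"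
      using w(1) by (simp add: power_divide add.commute flip: w(2) add_divide_distrib)
    then obtain t where "s / w = cos t" "r / w = sin t" using sincos_total_2pi_le by blast
    then have "cos t * r - sin t * s = s / w * r - r / w * s" by simp
    then show ?thesis by (intro exI[of _ t]) simp
  qed simp
  then obtain t where t: "cos t * r - sin t * s = 0" by blast
  define e where "e x = (if x = i then d1 else if x = b then d2 else 1)" for x
  define g where "g = givens i b t ** diag_mat e"
  have e: "diag_mat e \<in> diag_unitaries" using d by (intro diag_unitariesI) (simp add: e_def)
  have "g \<in> S" unfolding g_def using e diag by (intro mult rot assms) auto
  moreover have "g \<in> unitaries"
    unfolding g_def using e diag_unitaries_subset by (intro unitaries_mult givens_unitary assms) auto
  moreover have gM: "(g ** M) $ x $ y = (givens i b t ** (diag_mat e ** M)) $ x $ y" for x y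
    by (simp add: g_def matrix_mul_assoc)
  moreover have "(g ** M) $ i $ b = 0"
  proof -
    have "(g ** M) $ i $ b = of_real (cos t * r - sin t * s)"
      unfolding gM givens_mult_left[OF assms] diag_mat_mult_left
      using assms d by (simp add: e_def r_def s_def)
    then show ?thesis by (simp add: t)
  qed
  ultimately show ?thesis
    by (intro bexI[of _ g]) (simp_all add: givens_mult_left[OF assms] diag_mat_mult_left e_def)
qed

text \<open>The rows touched, b and those of \<open>Z\<close>, lie outside \<open>F\<close>. Fixed
  columns are zero there, so the steps do not disturb them.\<close>

lemma eliminate_column:
  assumes "finite Z" and "col_fixed F U" and "b \<notin> F" and "Z \<inter> insert b F = {}"
  shows "\<exists>g\<in>S \<inter> unitaries. col_fixed F (g ** U) \<and> (\<forall>z\<in>Z. (g ** U) $ z $ b = 0)"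
  using assms(1,4)
proof (induction Z rule: finite_induct)
  case empty
  show ?case
    using assms(2) mat_1_diag_unitaries diag unitaries_mat_1 by (intro bexI[of _ "mat 1"]) auto
next
  case (insert i Z)
  then obtain g where g: "g \<in> S" "g \<in> unitaries" "col_fixed F (g ** U)" "\<And>z. z \<in> Z \<Longrightarrow> (g ** U) $ z $ b = 0"
    by auto
  define M where "M = g ** U"
  have ib: "i \<noteq> b" "i \<notin> F" "b \<notin> Z" using insert.prems by auto
  obtain h where h: "h \<in> S" "h \<in> unitaries" "(h ** M) $ i $ b = 0"
    "\<And>x y. x \<noteq> i \<Longrightarrow> x \<noteq> b \<Longrightarrow> (h ** M) $ x $ y = M $ x $ y"
    "\<And>y. M $ i $ y = 0 \<Longrightarrow> M $ b $ y = 0 \<Longrightarrow> (h ** M) $ i $ y = 0 \<and> (h ** M) $ b $ y = 0"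
    using eliminate_entry[OF ib(1), of M] by blast
  have "(h ** M) $ x $ a = (if x = a then 1 else 0)" if a: "a \<in> F" for x a
  proof -
    have col: "M $ y $ a = (if y = a then 1 else 0)" for y
      using g(3) a by (simp add: col_fixed_def M_def)
    have "a \<noteq> i" "a \<noteq> b" using a ib assms(3) by auto
    then have "(h ** M) $ i $ a = 0 \<and> (h ** M) $ b $ a = 0" by (intro h(5)) (simp_all add: col)
    then show ?thesis
      using h(4)[of x a] col[of x] \<open>a \<noteq> i\<close> \<open>a \<noteq> b\<close> by (cases "x = i"; cases "x = b") simp_all
  qed
  then have "col_fixed F (h ** M)" by (simp add: col_fixed_def)
  moreover have "(h ** M) $ z $ b = 0" if "z \<in> insert i Z" for z
  proof (cases "z = i")
    case False
    then have "z \<in> Z" using that by simp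
    then have "z \<noteq> b" using ib(3) by auto
    with False have "(h ** M) $ z $ b = M $ z $ b" by (rule h(4))
    then show ?thesis using g(4)[OF \<open>z \<in> Z\<close>] by (simp add: M_def)
  qed (simp add: h(3))
  moreover have "h ** M = (h ** g) ** U" by (simp add: M_def matrix_mul_assoc)
  ultimately show ?case
    using h(1,2) g(1,2) by (intro bexI[of _ "h ** g"]) (auto intro: mult unitaries_mult)
qed

text \<open>Elimination clears column b only in rows outside \<open>F\<close> and b. The rows in
  \<open>F\<close> vanish because column b is orthogonal to the columns already fixed; what remains
  is one entry of modulus 1, removed by a phase.\<close>

lemma reduce_columns:
  assumes "finite F" and U: "U \<in> unitaries"
  shows "\<exists>g\<in>S \<inter> unitaries. col_fixed F (g ** U)"
  using assms(1)
proof (induction F rule: finite_induct)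
  case empty
  show ?case
    using mat_1_diag_unitaries diag unitaries_mat_1
    by (intro bexI[of _ "mat 1"]) (auto simp: col_fixed_def)
next
  case (insert b F)
  then obtain g where g: "g \<in> S" "g \<in> unitaries" "col_fixed F (g ** U)" by auto
  obtain h where h: "h \<in> S" "h \<in> unitaries" "col_fixed F (h ** (g ** U))"
    "\<And>z. z \<in> - insert b F \<Longrightarrow> (h ** (g ** U)) $ z $ b = 0"
    using eliminate_column[OF finite g(3) insert.hyps(2), of "- insert b F"] by auto
  define M where "M = h ** (g ** U)"
  have M: "M \<in> unitaries" unfolding M_def by (intro unitaries_mult h g U)
  have adjM: "(adj M ** M) $ x $ y = (if x = y then 1 else 0)" for x y
    using M by (simp add: mem_unitaries mat_def)
  have col: "M $ x $ a = (if x = a then 1 else 0)" if "a \<in> F" for a x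
    using h(3) that by (simp add: col_fixed_def M_def)
  have zero: "M $ z $ b = 0" if "z \<noteq> b" for z
  proof (cases "z \<in> F")
    case True
    have "(adj M ** M) $ z $ b = (\<Sum>k\<in>UNIV. if k = z then M $ k $ b else 0)"
      unfolding matrix_matrix_mult_def vec_lambda_beta
      by (intro sum.cong) (simp_all add: col[OF True])
    then show ?thesis using that adjM[of z b] by simp
  next
    case False
    then show ?thesis using h(4)[of z] that by (simp add: M_def)
  qed
  have "(adj M ** M) $ b $ b = (\<Sum>k\<in>UNIV. if k = b then cnj (M $ k $ b) * M $ k $ b else 0)"
    unfolding matrix_matrix_mult_def vec_lambda_beta
    by (intro sum.cong) (auto simp: zero)
  then have "cnj (M $ b $ b) * M $ b $ b = 1" using adjM[of b b] by simp
  then have "(cmod (M $ b $ b))\<^sup>2 = 1"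
    unfolding cnj_mult_norm by (metis of_real_eq_1_iff of_real_power)
  then have norm: "cmod (M $ b $ b) = 1"
    using norm_ge_zero[of "M $ b $ b"] by (auto simp: power2_eq_1_iff)
  define e where "e x = (if x = b then cnj (M $ b $ b) else 1)" for x
  have e: "diag_mat e \<in> diag_unitaries" by (intro diag_unitariesI) (simp add: e_def norm)
  have "col_fixed (insert b F) (diag_mat e ** M)"
    unfolding col_fixed_def diag_mat_mult_left
    using insert.hyps(2) by (auto simp: e_def col zero cmod_1_cnj[OF norm])
  moreover have "diag_mat e ** M = (diag_mat e ** (h ** g)) ** U" by (simp add: M_def matrix_mul_assoc)
  moreover have "diag_mat e ** (h ** g) \<in> S"
    using e diag by (intro mult h g) auto
  moreover have "diag_mat e ** (h ** g) \<in> unitaries"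
    using e diag_unitaries_subset by (intro unitaries_mult h g) auto
  ultimately show ?case by (intro bexI[of _ "diag_mat e ** (h ** g)"]) auto
qed

text \<open>Elimination is applied to \<open>adj U\<close>, so that the product of elimination steps
  is \<open>U\<close> itself and no inverse has to be taken in \<open>S\<close>.\<close>

lemma unitaries_subset: "unitaries \<subseteq> S"
proof
  fix U :: "complex^'n^'n" assume U: "U \<in> unitaries"
  then obtain g where g: "g \<in> S" "g \<in> unitaries" "col_fixed UNIV (g ** adj U)"
    using reduce_columns[of UNIV "adj U"] unitaries_adj by auto
  then have "g ** adj U = mat 1"
    by (simp add: col_fixed_def vec_eq_iff mat_def)
  then have "(g ** adj U) ** U = U" by simp
  then have "g = U"
    using U by (simp add: mem_unitaries flip: matrix_mul_assoc)
  with g(1) show "U \<in> S" by simp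
qed

end

section \<open>The dynamical Lie algebra\<close>

context butterfly_modes
begin

text \<open>Clearing one set bit at a time leads from any mode to mode 0 through pairs of the
  butterfly, with decreasing index. Transitivity is asked only for three distinct modes, as both
  \<open>givens_conj\<close> and the commutator of skew units require.\<close>

lemma modes_connected:
  assumes sym: "\<And>a b. Q a b \<Longrightarrow> Q b a"
    and trans: "\<And>a b c. a \<noteq> b \<Longrightarrow> b \<noteq> c \<Longrightarrow> a \<noteq> c \<Longrightarrow> Q a b \<Longrightarrow> Q b c \<Longrightarrow> Q a c"
    and step: "\<And>l a. 1 \<le> l \<Longrightarrow> l \<le> K \<Longrightarrow> low l a \<Longrightarrow> Q a (partner l a)"
    and "a \<noteq> b"
  shows "Q a b"
proof -
  define z where "z = mode 0"
  have idx_z: "idx z = 0" by (simp add: z_def)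
  have root: "c \<noteq> z \<longrightarrow> Q c z" for c
  proof (induction "idx c" arbitrary: c rule: less_induct)
    case less
    show ?case
    proof
      assume "c \<noteq> z"
      have "\<exists>m. bit (idx c) m"
      proof (rule ccontr)
        assume "\<nexists>m. bit (idx c) m"
        then have "idx c = idx z" unfolding idx_z by (intro bit_eqI) simp
        with \<open>c \<noteq> z\<close> show False by (simp add: idx_eq_iff)
      qed
      then obtain m where m: "bit (idx c) m" by blast
      have "m < K"
      proof (rule ccontr)
        assume "\<not> m < K"
        then have "\<not> bit (take_bit K (idx c)) m" by (simp add: bit_take_bit_iff)
        with m show False by (simp add: take_bit_nat_eq_self idx_less)
      qed
      then have l: "1 \<le> Suc m" "Suc m \<le> K" by auto
      interpret pairing "partner (Suc m)" by (rule pairing_partner[OF l])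
      define d where "d = partner (Suc m) c"
      have "low (Suc m) d" using m by (simp add: d_def low_partner[OF l]) (simp add: low_def)
      then have "Q d c" using step[OF l, of d] by (simp add: d_def)
      then have Qcd: "Q c d" by (rule sym)
      have "idx d < idx c"
      proof -
        have "\<not> bit (idx d) m" using m by (simp add: d_def idx_partner[OF l] bit_flip_bit_iff)
        moreover have "idx c = flip_bit m (idx d)"
          using idx_partner[OF l, of d] by (simp add: d_def)
        ultimately show ?thesis by (simp add: flip_bit_eq_if set_bit_eq)
      qed
      then have IH: "d \<noteq> z \<longrightarrow> Q d z" by (rule less)
      show "Q c z"
      proof (cases "d = z")
        case True
        then show ?thesis using Qcd by simp
      next
        case False
        have "c \<noteq> d" using fixfree[of c] unfolding d_def by metis
        show ?thesis by (rule trans[OF \<open>c \<noteq> d\<close> False \<open>c \<noteq> z\<close> Qcd IH[rule_format, OF False]])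
      qed
    qed
  qed
  consider "a = z" | "b = z" | "a \<noteq> z" "z \<noteq> b" by blast
  then show ?thesis
  proof cases
    case 1
    then show ?thesis using root[of b] \<open>a \<noteq> b\<close> by (intro sym[of b a]) simp
  next
    case 2
    then show ?thesis using root[of a] \<open>a \<noteq> b\<close> by simp
  next
    case 3
    then have "Q a z" "Q b z" using root[of a] root[of b] by simp_all
    then show ?thesis by (intro trans[OF 3 \<open>a \<noteq> b\<close>] sym[of b z])
  qed
qed

end

section \<open>Matrix units and the Lie algebra of skew-Hermitian matrices\<close>

definition matrix_unit :: "complex \<Rightarrow> 'n \<Rightarrow> 'n \<Rightarrow> complex^'n::finite^'n" where
  "matrix_unit c a b = (\<chi> i j. if i = a \<and> j = b then c else 0)"

lemma matrix_unit_mult: "matrix_unit c a b ** matrix_unit d e f = (if b = e then matrix_unit (c * d) a f else 0)"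
proof -
  have "(matrix_unit c a b ** matrix_unit d e f) $ i $ j = (if b = e then matrix_unit (c * d) a f else 0) $ i $ j" for i j
  proof -
    have "(matrix_unit c a b ** matrix_unit d e f) $ i $ j
        = (\<Sum>k\<in>UNIV. if k = b then (if i = a \<and> b = e \<and> j = f then c * d else 0) else 0)"
      unfolding matrix_matrix_mult_def vec_lambda_beta
      by (intro sum.cong refl) (simp add: matrix_unit_def)
    then show ?thesis by (simp add: matrix_unit_def)
  qed
  then show ?thesis by (simp add: vec_eq_iff)
qed

lemma matrix_unit_0 [simp]: "matrix_unit 0 a b = 0"
  by (simp add: matrix_unit_def vec_eq_iff)

text \<open>For a = b the two terms add up to 2 i Im z in one diagonal entry, hence the factor 1/2
  at the phase generators.\<close>

definition skew_unit :: "complex \<Rightarrow> 'n \<Rightarrow> 'n \<Rightarrow> complex^'n::finite^'n" where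
  "skew_unit z a b = matrix_unit z a b - matrix_unit (cnj z) b a"

lemma skew_unit_nth:
  "skew_unit z a b $ i $ j = (if i = a \<and> j = b then z else 0) - (if i = b \<and> j = a then cnj z else 0)"
  by (simp add: skew_unit_def matrix_unit_def)

text \<open>Only real coefficients are available in a real Lie algebra, so both z = 1 and z = i are
  needed as generators.\<close>

lemma skew_unit_decompose:
  fixes a b :: "'n::finite"
  shows "skew_unit z a b = Re z *\<^sub>R skew_unit 1 a b + Im z *\<^sub>R skew_unit \<i> a b"
proof -
  have z: "z = Re z *\<^sub>R 1 + Im z *\<^sub>R \<i>" "cnj z = Re z *\<^sub>R 1 - Im z *\<^sub>R \<i>"
    by (simp_all add: complex_eq_iff)
  have matrix_unit: "matrix_unit (r *\<^sub>R 1 + s *\<^sub>R \<i>) c d = r *\<^sub>R matrix_unit 1 c d + s *\<^sub>R matrix_unit \<i> c d"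
    "matrix_unit (r *\<^sub>R 1 - s *\<^sub>R \<i>) c d = r *\<^sub>R matrix_unit 1 c d - s *\<^sub>R matrix_unit \<i> c d"
    "matrix_unit (- \<i>) c d = - matrix_unit \<i> c d" for r s and c d :: 'n
    by (simp_all add: matrix_unit_def vec_eq_iff)
  have "skew_unit z a b = (Re z *\<^sub>R matrix_unit 1 a b + Im z *\<^sub>R matrix_unit \<i> a b) - (Re z *\<^sub>R matrix_unit 1 b a - Im z *\<^sub>R matrix_unit \<i> b a)"
    unfolding skew_unit_def by (metis z matrix_unit(1,2))
  then show ?thesis by (simp add: skew_unit_def matrix_unit(3) algebra_simps)
qed

lemma unitary_algebra_nth: "A \<in> unitary_algebra \<longleftrightarrow> (\<forall>i j. cnj (A $ j $ i) = - A $ i $ j)"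
  unfolding unitary_algebra_def mem_Collect_eq vec_eq_iff
  by (simp only: adj_nth vector_uminus_component)

text \<open>Off the diagonal each unordered pair is met twice; on the diagonal the skew unit is
  itself doubled. So 1/2 is right in both cases.\<close>

lemma unitary_algebra_eq_sum:
  fixes A :: "complex^'n::finite^'n"
  assumes "A \<in> unitary_algebra"
  shows "A = (\<Sum>a\<in>UNIV. \<Sum>b\<in>UNIV. (1 / 2) *\<^sub>R skew_unit (A $ a $ b) a b)"
proof -
  have A: "cnj (A $ j $ i) = - A $ i $ j" for i j
    using assms by (simp add: unitary_algebra_nth)
  have "(\<Sum>a\<in>UNIV. \<Sum>b\<in>UNIV. (1 / 2) *\<^sub>R skew_unit (A $ a $ b) a b) $ i $ j = A $ i $ j" for i j
  proof -
    have entry: "((1 / 2) *\<^sub>R skew_unit (A $ a $ b) a b) $ i $ j =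
      (if b = j then if a = i then A $ i $ j / 2 else 0 else 0) -
      (if b = i then if a = j then cnj (A $ j $ i) / 2 else 0 else 0)" for a b
      by (cases "a = i"; cases "b = j"; cases "a = j"; cases "b = i")
        (simp_all add: skew_unit_nth scaleR_conv_of_real[where 'a = complex] diff_divide_distrib)
    have "(\<Sum>a\<in>UNIV. \<Sum>b\<in>UNIV. (1 / 2) *\<^sub>R skew_unit (A $ a $ b) a b) $ i $ j =
      (\<Sum>a\<in>UNIV. \<Sum>b\<in>UNIV. if b = j then if a = i then A $ i $ j / 2 else 0 else 0) -
      (\<Sum>a\<in>UNIV. \<Sum>b\<in>UNIV. if b = i then if a = j then cnj (A $ j $ i) / 2 else 0 else 0)"
      by (simp only: sum_component entry sum_subtractf)
    also have "\<dots> = A $ i $ j / 2 - cnj (A $ j $ i) / 2" by simp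
    also have "\<dots> = A $ i $ j" by (simp add: A)
    finally show ?thesis .
  qed
  then show ?thesis by (simp add: vec_eq_iff)
qed

lemma lie_subalgebra_unitary_algebra: "lie_subalgebra (unitary_algebra :: (complex^'n::finite^'n) set)"
proof -
  interpret bl: bounded_linear "adj :: complex^'n^'n \<Rightarrow> complex^'n^'n" by (rule bounded_linear_adj)
  interpret bm: bounded_bilinear "(**) :: complex^'n^'n \<Rightarrow> complex^'n^'n \<Rightarrow> complex^'n^'n"
    by (rule bounded_bilinear_matrix_mult)
  show ?thesis
    by (auto simp: lie_subalgebra_def subspace_def unitary_algebra_def bl.add bl.diff bl.scaleR bl.zero adj_mult
        bm.minus_left bm.minus_right)
qed

text \<open>In a skew-Hermitian matrix the real part is antisymmetric and the imaginary part
  symmetric. Their sum is an arbitrary real matrix, which determines both parts, so \<open>f\<close>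
  is an isomorphism onto the real n by n matrices.\<close>

lemma dim_unitary_algebra: "dim (unitary_algebra :: (complex^'n::finite^'n) set) = CARD('n)\<^sup>2"
proof -
  define f :: "complex^'n^'n \<Rightarrow> real^'n^'n" where "f A = (\<chi> i j. Re (A $ i $ j) + Im (A $ i $ j))" for A
  have "linear f" by (auto simp: f_def linear_iff vec_eq_iff distrib_left)
  have sub: "subspace (unitary_algebra :: (complex^'n^'n) set)"
    using lie_subalgebra_unitary_algebra by (auto simp: lie_subalgebra_def)
  have parts: "2 * Re (A $ i $ j) = f A $ i $ j - f A $ j $ i" "2 * Im (A $ i $ j) = f A $ i $ j + f A $ j $ i"
    if "A \<in> unitary_algebra" for A :: "complex^'n^'n" and i j
  proof -
    have "cnj (A $ j $ i) = - A $ i $ j" using that by (simp add: unitary_algebra_nth)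
    then have "Re (A $ j $ i) = - Re (A $ i $ j)" "Im (A $ j $ i) = Im (A $ i $ j)"
      by (simp_all add: complex_eq_iff)
    then show "2 * Re (A $ i $ j) = f A $ i $ j - f A $ j $ i" "2 * Im (A $ i $ j) = f A $ i $ j + f A $ j $ i"
      by (simp_all add: f_def)
  qed
  have "inj_on f unitary_algebra"
  proof (rule inj_onI)
    fix A B assume AB: "A \<in> unitary_algebra" "B \<in> unitary_algebra" "f A = f B"
    have "A $ i $ j = B $ i $ j" for i j
      using parts[OF AB(1), of i j] parts[OF AB(2), of i j] AB(3) by (simp add: complex_eq_iff)
    then show "A = B" by (simp add: vec_eq_iff)
  qed
  then have "dim (f ` unitary_algebra) = dim (unitary_algebra :: (complex^'n^'n) set)"
    by (intro dim_image_eq \<open>linear f\<close>) (simp add: span_eq_iff[THEN iffD2, OF sub])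
  moreover have "f ` unitary_algebra = UNIV"
  proof -
    have "M \<in> f ` unitary_algebra" for M
    proof (rule image_eqI)
      let ?A = "\<chi> i j. Complex ((M $ i $ j - M $ j $ i) / 2) ((M $ i $ j + M $ j $ i) / 2)"
      show "M = f ?A" by (simp add: f_def vec_eq_iff field_simps)
      show "?A \<in> unitary_algebra" by (simp add: unitary_algebra_nth complex_eq_iff field_simps)
    qed
    then show ?thesis by blast
  qed
  moreover have "dim (UNIV :: (real^'n^'n) set) = CARD('n)\<^sup>2" by (simp add: power2_eq_square)
  ultimately show ?thesis by simp
qed

context butterfly_modes
begin

lemma set_concat_butterfly:
  "set (concat (butterfly K mode)) = (\<Union>l\<in>{1..K}. set (rz_layer K mode l) \<union> set (rbs_layer K mode l))"
proof -
  have "set [1..<Suc K] = {1..K}" by auto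
  then show ?thesis by (simp add: butterfly_def)
qed

lemma rz_mem: "1 \<le> K \<Longrightarrow> Rz (Phi 1 (idx a)) a \<in> set (concat (butterfly K mode))"
  unfolding set_concat_butterfly using idx_less[of a]
  by (intro UN_I[of 1] UnI1) (auto simp: rz_layer_def intro!: image_eqI[of _ _ "idx a"])

lemma rbs_mem:
  assumes "1 \<le> l" "l \<le> K" "low l a"
  shows "RBS (Theta l (idx a)) a (partner l a) \<in> set (concat (butterfly K mode))"
  unfolding set_concat_butterfly using idx_less[of a] assms
  by (intro UN_I[of l] UnI2) (auto simp: rbs_layer_eq low_def intro!: image_eqI[of _ _ "idx a"])

lemma generator_rz: "map_matrix ((*) \<i>) (gate_generator (Rz p a)) = (1 / 2) *\<^sub>R skew_unit \<i> a a"
proof -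
  have "map_matrix ((*) \<i>) (gate_generator (Rz p a)) $ i $ j = ((1 / 2) *\<^sub>R skew_unit \<i> a a) $ i $ j" for i j
    by (cases "i = a"; cases "j = a") (simp_all add: skew_unit_nth complex_eq_iff)
  then show ?thesis unfolding vec_eq_iff by blast
qed

lemma generator_rbs:
  assumes "a \<noteq> b" shows "map_matrix ((*) \<i>) (gate_generator (RBS p a b)) = skew_unit 1 a b"
proof -
  have "map_matrix ((*) \<i>) (gate_generator (RBS p a b)) $ i $ j = skew_unit 1 a b $ i $ j" for i j
    using assms by (cases "i = a"; cases "j = a"; cases "i = b"; cases "j = b") (simp_all add: skew_unit_nth)
  then show ?thesis unfolding vec_eq_iff by blast
qed

text \<open>Commuting the real skew units of (a, b) and (b, c) gives that of (a, c), so
  connectedness yields all real ones. Commuting with i times a diagonal unit turns them into the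
  imaginary ones.\<close>

lemma unitary_algebra_subset_lie_subalgebra:
  assumes K: "1 \<le> K" and L: "lie_subalgebra L"
    and gen: "(\<lambda>g. map_matrix ((*) \<i>) (gate_generator g)) ` set (concat (butterfly K mode)) \<subseteq> L"
  shows "unitary_algebra \<subseteq> L"
proof -
  interpret bm: bounded_bilinear "(**) :: complex^'n^'n \<Rightarrow> complex^'n^'n \<Rightarrow> complex^'n^'n"
    by (rule bounded_bilinear_matrix_mult)
  have sub: "subspace L" and comm: "\<And>A B. A \<in> L \<Longrightarrow> B \<in> L \<Longrightarrow> A ** B - B ** A \<in> L"
    using L unfolding lie_subalgebra_def by blast+
  have diag: "skew_unit \<i> a a \<in> L" for a
  proof -
    have "(1 / 2) *\<^sub>R skew_unit \<i> a a \<in> L"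
      using subsetD[OF gen imageI[OF rz_mem[OF K, of a]]] by (simp only: generator_rz)
    from subspace_scale[OF sub this, of 2] show ?thesis by simp
  qed
  have real: "skew_unit 1 a b \<in> L" if "a \<noteq> b" for a b
  proof (rule modes_connected[where Q = "\<lambda>a b. skew_unit 1 a b \<in> L", OF _ _ _ that])
    fix a b assume "skew_unit 1 a b \<in> L"
    then have "- 1 *\<^sub>R skew_unit 1 a b \<in> L" by (rule subspace_scale[OF sub])
    moreover have "- 1 *\<^sub>R skew_unit 1 a b = skew_unit 1 b a" by (simp add: skew_unit_def)
    ultimately show "skew_unit 1 b a \<in> L" by simp
  next
    fix a b c assume ne: "a \<noteq> b" "b \<noteq> c" "a \<noteq> c" and ab: "skew_unit 1 a b \<in> L" "skew_unit 1 b c \<in> L"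
    have "skew_unit 1 a b ** skew_unit 1 b c - skew_unit 1 b c ** skew_unit 1 a b = skew_unit 1 a c"
      using ne ne[symmetric] by (simp add: skew_unit_def bm.diff_left bm.diff_right matrix_unit_mult)
    with comm[OF ab] show "skew_unit 1 a c \<in> L" by simp
  next
    fix l a assume l: "1 \<le> l" "l \<le> K" "low l a"
    interpret pairing "partner l" by (rule pairing_partner[OF l(1,2)])
    show "skew_unit 1 a (partner l a) \<in> L"
      using subsetD[OF gen imageI[OF rbs_mem[OF l]]] by (simp only: generator_rbs[OF fixfree'])
  qed
  have imag: "skew_unit \<i> a b \<in> L" for a b
  proof (cases "a = b")
    case False
    have "(1 / 2) *\<^sub>R skew_unit \<i> a a = matrix_unit \<i> a a"
      by (auto simp: vec_eq_iff skew_unit_nth matrix_unit_def complex_eq_iff)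
    with diag[of a] have "matrix_unit \<i> a a \<in> L" using subspace_scale[OF sub, of _ "1 / 2"] by metis
    from comm[OF this real[OF False]]
    have "matrix_unit \<i> a a ** skew_unit 1 a b - skew_unit 1 a b ** matrix_unit \<i> a a \<in> L" .
    moreover have "matrix_unit \<i> a a ** skew_unit 1 a b - skew_unit 1 a b ** matrix_unit \<i> a a = matrix_unit \<i> a b + matrix_unit \<i> b a"
      using False by (simp add: skew_unit_def bm.diff_left bm.diff_right matrix_unit_mult)
    moreover have "matrix_unit \<i> a b + matrix_unit \<i> b a = skew_unit \<i> a b"
      by (simp add: vec_eq_iff skew_unit_nth matrix_unit_def)
    ultimately show ?thesis by simp
  qed (simp add: diag)
  have unit: "skew_unit z a b \<in> L" for z a b
  proof (cases "a = b")
    case True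
    then have "skew_unit 1 a b = 0" by (simp add: skew_unit_def)
    then show ?thesis
      unfolding skew_unit_decompose[of z] using imag subspace_0[OF sub]
      by (intro subspace_add[OF sub] subspace_scale[OF sub]) simp_all
  next
    case False
    then show ?thesis
      unfolding skew_unit_decompose[of z]
      by (intro subspace_add[OF sub] subspace_scale[OF sub] imag real)
  qed
  show ?thesis
  proof
    fix A :: "complex^'n^'n" assume "A \<in> unitary_algebra"
    then have "A = (\<Sum>a\<in>UNIV. \<Sum>b\<in>UNIV. (1 / 2) *\<^sub>R skew_unit (A $ a $ b) a b)"
      by (rule unitary_algebra_eq_sum)
    also have "\<dots> \<in> L" by (intro subspace_sum[OF sub] subspace_scale[OF sub] unit)
    finally show "A \<in> L" .
  qed
qed

lemma dynamical_lie_algebra_butterfly: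
  assumes K: "1 \<le> K"
  shows "dynamical_lie_algebra (butterfly K mode) = unitary_algebra"
proof
  have "map_matrix ((*) \<i>) (gate_generator g) \<in> unitary_algebra"
    if g: "g \<in> set (concat (butterfly K mode))" for g
  proof -
    obtain l where l: "1 \<le> l" "l \<le> K" "g \<in> set (rz_layer K mode l) \<or> g \<in> set (rbs_layer K mode l)"
      using g unfolding set_concat_butterfly by auto
    interpret pairing "partner l" by (rule pairing_partner[OF l(1,2)])
    have "p \<noteq> q" if "g = RBS r p q" for r p q
      using l(3) that unfolding rbs_layer_eq[OF l(1,2)] by (auto simp: rz_layer_def)
    then have "adj (gate_generator g) = gate_generator g"
      by (rule gate_generator_hermitian)
    then have "cnj (gate_generator g $ j $ i) = gate_generator g $ i $ j" for i j
      by (metis adj_nth)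
    then show ?thesis
      by (simp add: unitary_algebra_nth map_matrix_def)
  qed
  then show "dynamical_lie_algebra (butterfly K mode) \<subseteq> unitary_algebra"
    unfolding dynamical_lie_algebra_def
    by (intro hull_minimal lie_subalgebra_unitary_algebra) blast
  show "unitary_algebra \<subseteq> dynamical_lie_algebra (butterfly K mode)"
    \<comment> \<open>The hull is an intersection, so it suffices that every competing subalgebra
      contains \<open>unitary_algebra\<close>.\<close>
    unfolding dynamical_lie_algebra_def hull_def
    using unitary_algebra_subset_lie_subalgebra[OF K] by blast
qed

end

section \<open>Universality and conclusion\<close>

lemma foldr_circuit_op_append:
  "foldr (\<lambda>v M. circuit_op v C ** M) (vs @ ws) (mat 1) =
    foldr (\<lambda>v M. circuit_op v C ** M) vs (mat 1) ** foldr (\<lambda>v M. circuit_op v C ** M) ws (mat 1)"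
  by (induction vs) (simp_all add: matrix_mul_assoc)

context butterfly_modes
begin

lemma givens_closed_superset:
  assumes K: "1 \<le> K" and S: "butterfly_set K mode \<subseteq> S"
    and mult: "\<And>A B. A \<in> S \<Longrightarrow> B \<in> S \<Longrightarrow> A ** B \<in> S"
  shows "givens_closed S"
proof
  show "A ** B \<in> S" if "A \<in> S" "B \<in> S" for A B using mult that .
  show "diag_unitaries \<subseteq> S" using butterfly_set_superset(1)[OF K order_refl] S by blast
  show "givens a b t \<in> S" if "a \<noteq> b" for a b t
  proof -
    have "a \<noteq> b \<and> (\<forall>t. givens a b t \<in> S)"
    \<comment> \<open>Distinctness is part of \<open>Q\<close> because the symmetry premise does not
      provide it, while \<open>givens_commute\<close> requires it.\<close>
    proof (rule modes_connected[where Q = "\<lambda>a b. a \<noteq> b \<and> (\<forall>t. givens a b t \<in> S)", OF _ _ _ that])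
      fix a b assume "a \<noteq> b \<and> (\<forall>t. givens a b t \<in> S)"
      then show "b \<noteq> a \<and> (\<forall>t. givens b a t \<in> S)" using givens_commute[of a b] by auto
    next
      fix a b c
      assume ne: "a \<noteq> b" "b \<noteq> c" "a \<noteq> c"
        and "a \<noteq> b \<and> (\<forall>t. givens a b t \<in> S)" "b \<noteq> c \<and> (\<forall>t. givens b c t \<in> S)"
      then have "givens a c t \<in> S" for t
        unfolding givens_conj[OF ne, symmetric] by (intro mult) auto
      with ne show "a \<noteq> c \<and> (\<forall>t. givens a c t \<in> S)" by blast
    next
      fix l a assume l: "1 \<le> l" "l \<le> K"
      have "givens a (partner l a) t \<in> S" for t
        using givens_pair_rotations[OF pairing_partner[OF l]] butterfly_set_superset(2)[OF l] S by blast
      then show "a \<noteq> partner l a \<and> (\<forall>t. givens a (partner l a) t \<in> S)"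
        using pairing.fixfree'[OF pairing_partner[OF l]] by blast
    qed
    then show ?thesis by blast
  qed
qed

text \<open>Equality, which is stronger than density: elimination is exact and uses finitely many
  factors.\<close>

lemma generate_butterfly_set:
  assumes K: "1 \<le> K" shows "generate unitary_group (butterfly_set K mode) = unitaries"
proof
  show "generate unitary_group (butterfly_set K mode) \<subseteq> unitaries"
    by (rule group.generate_incl[OF group_unitary_group butterfly_set_subset_unitaries[OF K]])
  have "givens_closed (generate unitary_group (butterfly_set K mode))"
  proof (rule givens_closed_superset[OF K])
    fix A B assume "A \<in> generate unitary_group (butterfly_set K mode)" "B \<in> generate unitary_group (butterfly_set K mode)"
    from generate.eng[OF this] show "A ** B \<in> generate unitary_group (butterfly_set K mode)"
      by (simp add: unitary_group_def)
  qed (auto intro: generate.incl)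
  then show "unitaries \<subseteq> generate unitary_group (butterfly_set K mode)"
    by (rule givens_closed.unitaries_subset)
qed

text \<open>A list of assignments stands for a product of butterflies without inverses;
  concatenation of lists makes these products closed under multiplication.\<close>

lemma unitary_eq_product:
  assumes K: "1 \<le> K" and "W \<in> unitaries"
  shows "\<exists>vs. W = foldr (\<lambda>v M. circuit_op v (butterfly K mode) ** M) vs (mat 1)"
proof -
  let ?P = "\<lambda>vs. foldr (\<lambda>v M. circuit_op v (butterfly K mode) ** M) vs (mat 1)"
  have "givens_closed (range ?P)"
  proof (rule givens_closed_superset[OF K])
    show "butterfly_set K mode \<subseteq> range ?P"
    proof
      fix A assume "A \<in> butterfly_set K mode"
      then obtain v where "A = ?P [v]" by (auto simp: butterfly_set_def)
      then show "A \<in> range ?P" by (rule range_eqI)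
    qed
    fix A B assume "A \<in> range ?P" "B \<in> range ?P"
    then obtain vs ws where "A = ?P vs" "B = ?P ws" by blast
    then have "A ** B = ?P (vs @ ws)" by (simp only: foldr_circuit_op_append)
    then show "A ** B \<in> range ?P" by (rule range_eqI)
  qed
  then show ?thesis using givens_closed.unitaries_subset assms(2) by blast
qed

end

text \<open>This is 3/2 n log n < n^2 divided by n/2, with n = 2^K. In the induction the left side
  grows by 3 and the right side by at least 2 (K + 1) >= 4.\<close>

lemma three_mult_less_power: "1 \<le> K \<Longrightarrow> 3 * K < 2 * 2 ^ K"
proof (induction K rule: nat_induct_at_least)
  case (Suc K)
  have "2 * (K + 1) \<le> 2 * 2 ^ K" using Suc.hyps by (metis Suc_eq_plus1 Suc_leI less_exp mult_le_mono2)
  with Suc show ?case by simp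
qed simp

theorem proposition7:
  fixes K :: nat and mode :: "nat \<Rightarrow> 'n::finite"
  assumes "K \<ge> 1" and "CARD('n) = 2 ^ K"
    and "bij_betw mode {..<2 ^ K} UNIV"
  shows
    "(\<forall>gs\<in>set (butterfly K mode). parallel_layer gs) \<and>
     real (circuit_depth (butterfly K mode)) = 2 * log 2 (real CARD('n)) \<and>
     real (card (circuit_params (butterfly K mode))) =
       3 / 2 * real CARD('n) * log 2 (real CARD('n)) \<and>
     butterfly_set K mode \<subseteq> carrier unitary_group \<and>
     top_of_set (carrier unitary_group) closure_of generate unitary_group (butterfly_set K mode) =
       carrier unitary_group \<and>
     (\<forall>W\<in>carrier unitary_group. \<forall>\<epsilon>>0. \<exists>vs :: (param \<Rightarrow> real) list.
        dist (foldr (\<lambda>v M. circuit_op v (butterfly K mode) ** M) vs (mat 1)) W < \<epsilon>) \<and>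
     compact (butterfly_set K mode) \<and>
     (\<exists>d. embedded_submanifold d (butterfly_set K mode) \<and>
          real d \<le> 3 / 2 * real CARD('n) * log 2 (real CARD('n))) \<and>
     3 / 2 * real CARD('n) * log 2 (real CARD('n)) < (real CARD('n))\<^sup>2 \<and>
     top_of_set (carrier unitary_group) closure_of butterfly_set K mode \<noteq>
       carrier unitary_group \<and>
     dynamical_lie_algebra (butterfly K mode) = unitary_algebra \<and>
     dim (unitary_algebra :: (complex^'n^'n) set) = CARD('n)\<^sup>2"
proof -
  interpret butterfly_modes K mode by (rule butterfly_modes.intro[OF assms(3)])
  have K: "1 \<le> K" by (rule assms(1))
  have n: "real CARD('n) = 2 ^ K" by (simp add: assms(2))
  have log: "log 2 (real CARD('n)) = real K" by (simp add: n log_nat_power)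
  have params: "real (card (circuit_params (butterfly K mode))) = 3 / 2 * real CARD('n) * log 2 (real CARD('n))"
  proof -
    have "real (2 * card (circuit_params (butterfly K mode))) = real (3 * K * 2 ^ K)"
      by (simp only: card_circuit_params_butterfly)
    then show ?thesis unfolding log n by (simp add: mult_ac)
  qed
  have closure: "top_of_set unitaries closure_of generate unitary_group (butterfly_set K mode) = unitaries"
    unfolding generate_butterfly_set[OF K] using closure_of_topspace[of "top_of_set unitaries"] by simp
  have approx: "\<forall>W\<in>unitaries. \<forall>\<epsilon>>0. \<exists>vs. dist (foldr (\<lambda>v M. circuit_op v (butterfly K mode) ** M) vs (mat 1)) W < \<epsilon>"
    using unitary_eq_product[OF K] by (metis dist_self)
  have manifold: "\<exists>d. embedded_submanifold d (butterfly_set K mode) \<and>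
      real d \<le> 3 / 2 * real CARD('n) * log 2 (real CARD('n))"
  proof -
    obtain d where d: "embedded_submanifold d (butterfly_set K mode)" "2 * d \<le> (2 * K + 1) * CARD('n)"
      using embedded_submanifold_butterfly_set[OF K] by blast
    \<comment> \<open>The dimension bound (2K + 1) n/2 is weakened to the parameter count 3Kn/2,
      using 1 <= K; the two agree at K = 1.\<close>
    have "(2 * K + 1) * CARD('n) \<le> (3 * K) * CARD('n)" using K by (intro mult_le_mono1) simp
    with d(2) have "real (2 * d) \<le> real ((3 * K) * CARD('n))" by (simp only: of_nat_le_iff)
    then show ?thesis using d(1) unfolding log by (intro exI[of _ d]) (simp add: mult_ac)
  qed
  have dim: "3 / 2 * real CARD('n) * log 2 (real CARD('n)) < (real CARD('n))\<^sup>2"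
  proof -
    have "real (3 * K) < real (2 * 2 ^ K)"
      using three_mult_less_power[OF K] by (simp only: of_nat_less_iff)
    then have "3 / 2 * real K < 2 ^ K" by simp
    then have "3 / 2 * real K * 2 ^ K < 2 ^ K * (2 ^ K :: real)" by (intro mult_strict_right_mono) simp_all
    then show ?thesis unfolding log n by (simp add: power2_eq_square mult_ac)
  qed
  show ?thesis
    by (intro conjI ballI parallel_layer_butterfly params butterfly_set_subset_unitaries[OF K] closure
        compact_range_circuit_op[of "butterfly K mode", folded butterfly_set_def] manifold dim
        closure_butterfly_set[OF K] dynamical_lie_algebra_butterfly[OF K] dim_unitary_algebra
        approx[rule_format]) (simp_all add: circuit_depth_butterfly log approx)
qed

end
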